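(* Let $d \ge 3$. There is a constant $C_{\mathrm{DG}}(d,\mathbf{a}) < \infty$, depending only on $d$ and, as far as the coefficient field $\mathbf{a}$ is concerned, only on its ellipticity ratio $\Lambda/\lambda$, such that the following holds. Let $\mathbf{a}$ be an elliptic coefficient field on $B_1$ with ellipticity constants $0<\lambda\le\Lambda<\infty$. If $u$ is a weak subsolution of $-\nabla\cdot(\mathbf{a}\nabla u)\le 0$ on $B_1$ and $u_+ = \max(u,0)$ belongs to $L^2(B_1)$, then for almost every $x \in B_{1/2}$, $$\max(u(x),0) \le C_{\mathrm{DG}}(d,\mathbf{a}) \Bigl(\int_{B_1} |u_+|^2\Bigr)^{1/2}.$$
   Context: $B_r$ denotes the open ball of radius $r$ centered at the origin in $\mathbb{R}^d$. An elliptic coefficient field on an open set $\Omega\subseteq\mathbb{R}^d$ is a measurable map $\mathbf{a}:\Omega\to\mathbb{R}^{d\times d}$ (not necessarily symmetric) together with constants $0<\lambda\le\Lambda<\infty$ such that, for Lebesgue-a.e. $x\in\Omega$ and every $\xi\in\mathbb{R}^d$, $\xi\cdot\mathbf{a}(x)\xi\ge\lambda|\xi|^2$ and $\xi\cdot\mathbf{a}(x)^{-1}\xi\ge\Lambda^{-1}|\xi|^2$. The space $W^{1,2}(\Omega)$ consists of the functions in $L^2(\Omega)$ all of whose first-order weak partial derivatives (defined by integration by parts against $C_c^\infty(\Omega)$) belong to $L^2(\Omega)$, and $W^{1,2}_0(\Omega)$ is the closure of $C_c^\infty(\Omega)$ in the $W^{1,2}$ topology. For $u,\varphi\in W^{1,2}(\Omega)$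 set $B_{\mathbf{a}}(u,\varphi):=\int_\Omega\nabla\varphi(x)\cdot\mathbf{a}(x)\nabla u(x)\,dx$. A weak subsolution of $-\nabla\cdot(\mathbf{a}\nabla u)\le 0$ on $\Omega$ is a function $u\in W^{1,2}(\Omega)$ with $B_{\mathbf{a}}(u,\varphi)\le 0$ for every nonnegative $\varphi\in W^{1,2}_0(\Omega)$. *)

theory Defs
  imports "HOL-Analysis.Analysis"
begin

text \<open>
  The ambient space \<open>\<real>\<^sup>d\<close> is \<^typ>\<open>real ^ 'n\<close> with \<open>d = CARD('n)\<close>.  A function on an open set
  \<open>\<Omega>\<close> is represented by a total function of which only the values on \<open>\<Omega>\<close> matter; integrals and
  measurability on \<open>\<Omega>\<close> refer to Lebesgue measure \<^term>\<open>lebesgue_on \<Omega>\<close>.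
\<close>

definition partial_deriv :: "'n::finite \<Rightarrow> (real ^ 'n \<Rightarrow> real) \<Rightarrow> real ^ 'n \<Rightarrow> real" where
  "partial_deriv i f x = frechet_derivative f (at x) (axis i 1)"

primrec Ck :: "nat \<Rightarrow> (real ^ 'n::finite \<Rightarrow> real) \<Rightarrow> bool" where
  "Ck 0 f \<longleftrightarrow> continuous_on UNIV f"
| "Ck (Suc k) f \<longleftrightarrow> (\<forall>x. f differentiable (at x)) \<and> (\<forall>i. Ck k (partial_deriv i f))"

text \<open>\<open>C\<^sub>c\<^sup>\<infinity>(\<Omega>)\<close>, its elements being extended by zero to the whole space.\<close>

definition test_functions :: "(real ^ 'n::finite) set \<Rightarrow> (real ^ 'n \<Rightarrow> real) set" where
  "test_functions \<Omega> =
     {\<phi>. (\<forall>k. Ck k \<phi>) \<and> compact (closure {x. \<phi> x \<noteq> 0}) \<and> closure {x. \<phi> x \<noteq> 0} \<subseteq> \<Omega>}"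

definition L2 :: "(real ^ 'n::finite) set \<Rightarrow> (real ^ 'n \<Rightarrow> real) set" where
  "L2 \<Omega> = {f. f \<in> borel_measurable (lebesgue_on \<Omega>) \<and> integrable (lebesgue_on \<Omega>) (\<lambda>x. (f x)\<^sup>2)}"

definition locally_integrable :: "(real ^ 'n::finite) set \<Rightarrow> (real ^ 'n \<Rightarrow> real) \<Rightarrow> bool" where
  "locally_integrable \<Omega> f \<longleftrightarrow> (\<forall>K. compact K \<and> K \<subseteq> \<Omega> \<longrightarrow> integrable (lebesgue_on K) f)"

definition has_weak_partial ::
    "(real ^ 'n::finite) set \<Rightarrow> 'n \<Rightarrow> (real ^ 'n \<Rightarrow> real) \<Rightarrow> (real ^ 'n \<Rightarrow> real) \<Rightarrow> bool" where
  "has_weak_partial \<Omega> i u g \<longleftrightarrow>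
     locally_integrable \<Omega> u \<and> locally_integrable \<Omega> g \<and>
     (\<forall>\<phi> \<in> test_functions \<Omega>.
        (\<integral>x. u x * partial_deriv i \<phi> x \<partial>lebesgue_on \<Omega>) = - (\<integral>x. g x * \<phi> x \<partial>lebesgue_on \<Omega>))"

definition W12 :: "(real ^ 'n::finite) set \<Rightarrow> (real ^ 'n \<Rightarrow> real) set" where
  "W12 \<Omega> = {u \<in> L2 \<Omega>. \<forall>i. \<exists>g \<in> L2 \<Omega>. has_weak_partial \<Omega> i u g}"

text \<open>
  Weak partial derivatives on an open set are unique up to null sets, so the representative
  selected here does not affect any of the integrals below.
\<close>

definition weak_grad :: "(real ^ 'n::finite) set \<Rightarrow> (real ^ 'n \<Rightarrow> real) \<Rightarrow> real ^ 'n \<Rightarrow> real ^ 'n" where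
  "weak_grad \<Omega> u = (SOME G. \<forall>i. has_weak_partial \<Omega> i u (\<lambda>x. G x $ i))"

definition W12_norm :: "(real ^ 'n::finite) set \<Rightarrow> (real ^ 'n \<Rightarrow> real) \<Rightarrow> real" where
  "W12_norm \<Omega> u =
     sqrt ((\<integral>x. (u x)\<^sup>2 \<partial>lebesgue_on \<Omega>) + (\<integral>x. (norm (weak_grad \<Omega> u x))\<^sup>2 \<partial>lebesgue_on \<Omega>))"

definition W12_0 :: "(real ^ 'n::finite) set \<Rightarrow> (real ^ 'n \<Rightarrow> real) set" where
  "W12_0 \<Omega> = {u \<in> W12 \<Omega>. \<forall>\<epsilon>>0. \<exists>\<phi> \<in> test_functions \<Omega>. W12_norm \<Omega> (\<lambda>x. u x - \<phi> x) < \<epsilon>}"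

definition elliptic_field ::
    "(real ^ 'n::finite) set \<Rightarrow> (real ^ 'n \<Rightarrow> real ^ 'n ^ 'n) \<Rightarrow> real \<Rightarrow> real \<Rightarrow> bool" where
  "elliptic_field \<Omega> a lam Lam \<longleftrightarrow>
     a \<in> borel_measurable (lebesgue_on \<Omega>) \<and> 0 < lam \<and> lam \<le> Lam \<and>
     (AE x in lebesgue_on \<Omega>. \<forall>\<xi>.
        \<xi> \<bullet> (a x *v \<xi>) \<ge> lam * (norm \<xi>)\<^sup>2 \<and>
        \<xi> \<bullet> (matrix_inv (a x) *v \<xi>) \<ge> inverse Lam * (norm \<xi>)\<^sup>2)"

definition bilinear_form ::
    "(real ^ 'n::finite) set \<Rightarrow> (real ^ 'n \<Rightarrow> real ^ 'n ^ 'n) \<Rightarrow>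
     (real ^ 'n \<Rightarrow> real) \<Rightarrow> (real ^ 'n \<Rightarrow> real) \<Rightarrow> real" where
  "bilinear_form \<Omega> a u \<phi> =
     (\<integral>x. weak_grad \<Omega> \<phi> x \<bullet> (a x *v weak_grad \<Omega> u x) \<partial>lebesgue_on \<Omega>)"

definition weak_subsolution ::
    "(real ^ 'n::finite) set \<Rightarrow> (real ^ 'n \<Rightarrow> real ^ 'n ^ 'n) \<Rightarrow> (real ^ 'n \<Rightarrow> real) \<Rightarrow> bool" where
  "weak_subsolution \<Omega> a u \<longleftrightarrow>
     u \<in> W12 \<Omega> \<and>
     (\<forall>\<phi> \<in> W12_0 \<Omega>. (AE x in lebesgue_on \<Omega>. \<phi> x \<ge> 0) \<longrightarrow> bilinear_form \<Omega> a u \<phi> \<le> 0)"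

end

theory Submission
  imports Defs
begin

text \<open>
  De Giorgi's iteration. Mollifying a subsolution with gradient \<open>G\<close> and flux \<open>H = a G\<close> turns the weak
  inequality into the pointwise one \<open>div H\<^sub>\<epsilon> \<ge> 0\<close>, which is multiplied by \<open>\<eta>\<^sup>2 F(U\<^sub>\<epsilon>)\<close> for a cutoff
  \<open>\<eta>\<close> and a smoothed truncation \<open>F\<close> of \<open>t \<mapsto> (t - c)\<^sub>+\<close>. Letting \<open>\<epsilon> \<rightarrow> 0\<close>, ellipticity
  gives Caccioppoli's inequality in the form
  \<open>\<integral> (w (x + h) - w x)\<^sup>2 dx \<le> C |h|\<^sup>2 \<integral> (U - c)\<^sub>+\<^sup>2 |\<nabla>\<eta>|\<^sup>2\<close> for \<open>w = \<eta> F(U)\<close>. Averaging over \<open>h\<close> in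
  a cube of twice the volume of \<open>{w \<noteq> 0}\<close> bounds \<open>\<integral> w\<^sup>2\<close>, and Chebyshev's inequality bounds that
  volume. On balls shrinking to \<open>B\<^bsub>1/2\<^esub>\<close> with levels increasing to a multiple \<open>K\<close> of the \<open>L\<^sup>2\<close> norm of
  \<open>u\<^sub>+\<close>, the integrals of \<open>(U - c)\<^sub>+\<^sup>2\<close> decay geometrically, so \<open>u \<le> K\<close> almost everywhere on
  \<open>B\<^bsub>1/2\<^esub>\<close>.
\<close>

subsection \<open>Smooth kernels and \<open>C\<^sup>1\<close> functions\<close>

text \<open>The coefficients are merely measurable, so a mollified \<open>u\<close> is not a
  subsolution for \<open>a\<close>. What survives convolution is the linear inequality for the flux;
  hence \<open>G\<close> and \<open>H\<close> are mollified as independent fields, and ellipticity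
  enters only after the limit. The subsolution property is thus used with smooth test functions
  alone, every integration by parts concerns \<open>C^1\<close> functions, and no calculus of
  truncations inside \<open>W12_0\<close> is involved. For nonsymmetric \<open>a\<close> the
  condition on the inverse matrix is exploited as |H|^2 <= Lam G.H, so the cross term costs one
  factor \<open>Lam\<close> and the energy constant is linear in \<open>Lam / lam\<close>. The
  iteration closes because its bound is superlinear: a step costs the inverse square of the gap
  between the radii, but gains the squared side of the cube, which is a power 2/d of a volume that
  Chebyshev bounds by the excess.\<close>

lemma Ck_SucD: "Ck (Suc k) f \<Longrightarrow> Ck k f"
proof (induction k arbitrary: f)
  case 0
  then show ?case
    by (auto intro!: continuous_at_imp_continuous_on differentiable_imp_continuous_within)
qed auto

lemma partial_deriv_eq:
  assumes "(f has_derivative f') (at x)"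
  shows "partial_deriv i f x = f' (axis i 1)"
  using frechet_derivative_at[OF assms] by (simp add: partial_deriv_def)

section \<open>Stability of \<open>Ck\<close> under sums and products\<close>

lemma Ck_const: "Ck k (\<lambda>x. c)"
proof (induction k arbitrary: c)
  case (Suc k)
  have "partial_deriv i (\<lambda>x. c) = (\<lambda>x::real^'a. 0)" for i
    by (rule ext, subst partial_deriv_eq[OF has_derivative_const]) simp
  with Suc show ?case by simp
qed simp

lemma Ck_add: "Ck k f \<Longrightarrow> Ck k g \<Longrightarrow> Ck k (\<lambda>x. f x + g x)"
proof (induction k arbitrary: f g)
  case 0 then show ?case by (auto intro: continuous_intros)
next
  case (Suc k)
  have d: "(f has_derivative frechet_derivative f (at x)) (at x)"
    "(g has_derivative frechet_derivative g (at x)) (at x)" for x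
    using Suc.prems by (auto simp: frechet_derivative_works[symmetric])
  have "partial_deriv i (\<lambda>x. f x + g x) = (\<lambda>x. partial_deriv i f x + partial_deriv i g x)" for i
    by (rule ext, subst partial_deriv_eq[OF has_derivative_add[OF d]]) (simp add: partial_deriv_def)
  with Suc show ?case by (auto intro: derivative_intros)
qed

lemma Ck_mult: "Ck k f \<Longrightarrow> Ck k g \<Longrightarrow> Ck k (\<lambda>x. f x * g x)"
proof (induction k arbitrary: f g)
  case 0 then show ?case by (auto intro: continuous_intros)
next
  case (Suc k)
  have d: "(f has_derivative frechet_derivative f (at x)) (at x)"
    "(g has_derivative frechet_derivative g (at x)) (at x)" for x
    using Suc.prems by (auto simp: frechet_derivative_works[symmetric])
  have "partial_deriv i (\<lambda>x. f x * g x)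
      = (\<lambda>x. f x * partial_deriv i g x + partial_deriv i f x * g x)" for i
    by (rule ext, subst partial_deriv_eq[OF has_derivative_mult[OF d]]) (simp add: partial_deriv_def)
  moreover have "Ck k f" "Ck k g" using Suc.prems by (auto intro: Ck_SucD simp del: Ck.simps)
  ultimately show ?case using Suc by (auto intro!: derivative_intros Ck_add)
qed

lemma Ck_coord: "Ck k (\<lambda>x. x $ i)"
proof (cases k)
  case (Suc n)
  have d: "((\<lambda>x::real^'a. x $ i) has_derivative (\<lambda>h. h $ i)) (at x)" for x
    by (intro bounded_linear_imp_has_derivative bounded_linear_vec_nth)
  have "partial_deriv j (\<lambda>x. x $ i) = (\<lambda>x::real^'a. axis j 1 $ i)" for j
    by (rule ext, subst partial_deriv_eq[OF d]) simp
  then show ?thesis using Suc d by (auto simp: Ck_const differentiable_def)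
qed (auto intro: continuous_intros)

text \<open>The standard flat function exp(-1/t), divided by t^m. The extra parameter closes the
  family under differentiation: the derivative of a member is a combination of members with larger
  \<open>m\<close>, so smoothness follows from one induction over all \<open>m\<close> at
  once.\<close>

definition flat_exp :: "nat \<Rightarrow> real \<Rightarrow> real" where
  "flat_exp m t = (if t > 0 then exp (- 1 / t) / t ^ m else 0)"

text \<open>Comes from exp y >= (1 + y/N)^N >= (y/N)^N with y = 1/t and N = m + 2: of the powers of
  t gained, m pay for the denominator. The remaining quadratic order makes the difference quotient
  at 0 vanish.\<close>

lemma flat_exp_bound: "\<bar>flat_exp m t\<bar> \<le> real (m + 2) ^ (m + 2) * t\<^sup>2"
proof (cases "t > 0")
  case True
  have "(1 / t / real (m+2)) ^ (m+2) \<le> (1 + 1 / t / real (m+2)) ^ (m+2)"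
    using True by (intro power_mono) auto
  also have "\<dots> \<le> exp (1 / t)"
  proof (rule exp_ge_one_plus_x_over_n_power_n)
    show "- real (m + 2) \<le> 1 / t" using True by (meson le_minus_iff neg_le_0_iff_le of_nat_0_le_iff order_trans zero_le_divide_1_iff less_imp_le)
  qed simp
  finally have "exp (- (1 / t)) \<le> (t * real (m+2)) ^ (m+2)"
    using True by (simp add: exp_minus divide_simps power_divide power_mult_distrib del: power_Suc power_add of_nat_add) (simp add: mult_ac)
  then have "exp (- (1 / t)) \<le> (real (m+2) ^ (m+2) * t\<^sup>2) * t ^ m"
    by (simp add: power_mult_distrib power_add mult_ac power2_eq_square)
  then show ?thesis using True by (simp add: flat_exp_def field_simps)
qed (simp add: flat_exp_def)

lemma flat_exp_deriv:
  "(flat_exp m has_real_derivative flat_exp (m + 2) t - real m * flat_exp (m + 1) t) (at t)"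
proof -
  consider "t > 0" | "t < 0" | "t = 0" by linarith
  then show ?thesis
  proof cases
    case 1
    have "((\<lambda>t. exp (- 1 / t) / t ^ m) has_real_derivative
        flat_exp (m + 2) t - real m * flat_exp (m + 1) t) (at t)"
    proof (cases m)
      case (Suc n)
      have "t ^ (m * 2) = t ^ m * t ^ m" by (simp add: power_mult power2_eq_square mult_2_right power_add)
      then show ?thesis
        using 1 Suc by (auto intro!: derivative_eq_intros simp: flat_exp_def field_simps power2_eq_square)
          (use power_minus_mult[of n t] in \<open>cases n; simp\<close>)
    qed (use 1 in \<open>auto intro!: derivative_eq_intros simp: flat_exp_def field_simps power2_eq_square\<close>)
    then show ?thesis
      by (rule has_field_derivative_transform_within_open[where S="{0<..}"])
         (use 1 in \<open>auto simp: flat_exp_def\<close>)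
  next
    case 2
    have "((\<lambda>t. 0) has_real_derivative flat_exp (m + 2) t - real m * flat_exp (m + 1) t) (at t)"
      using 2 by (auto simp: flat_exp_def)
    then show ?thesis
      by (rule has_field_derivative_transform_within_open[where S="{..<0}"])
         (use 2 in \<open>auto simp: flat_exp_def\<close>)
  next
    case 3
    \<comment> \<open>At the flat point the quadratic bound leaves a quotient of size at most a
      constant times |h|.\<close>
    have "((\<lambda>h. flat_exp m h / h) \<longlongrightarrow> 0) (at 0)"
    proof (rule Lim_null_comparison)
      show "\<forall>\<^sub>F h in at 0. norm (flat_exp m h / h) \<le> real (m+2) ^ (m+2) * \<bar>h\<bar>"
      proof (rule always_eventually, rule allI)
        fix h :: real
        have "\<bar>flat_exp m h\<bar> / \<bar>h\<bar> \<le> (real (m+2) ^ (m+2) * h\<^sup>2) / \<bar>h\<bar>"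
          by (intro divide_right_mono flat_exp_bound) simp
        also have "h\<^sup>2 = \<bar>h\<bar> * \<bar>h\<bar>" by (simp add: power2_eq_square)
        also have "real (m+2) ^ (m+2) * (\<bar>h\<bar> * \<bar>h\<bar>) / \<bar>h\<bar> = real (m+2) ^ (m+2) * \<bar>h\<bar>"
          by (cases "h = 0") (simp_all del: abs_mult_self_eq)
        finally show "norm (flat_exp m h / h) \<le> real (m+2) ^ (m+2) * \<bar>h\<bar>" by simp
      qed
      show "((\<lambda>h. real (m+2) ^ (m+2) * \<bar>h\<bar>) \<longlongrightarrow> 0) (at 0)"
        by (auto intro!: tendsto_eq_intros)
    qed
    then show ?thesis using 3 by (simp add: DERIV_def flat_exp_def)
  qed
qed

lemma continuous_flat_exp: "continuous_on A (flat_exp m)"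
  by (meson DERIV_isCont continuous_at_imp_continuous_on flat_exp_deriv)

lemma sq_dist_has_derivative:
  fixes c :: "'a::real_inner"
  shows "((\<lambda>x. r - (norm (x - c))\<^sup>2) has_derivative (\<lambda>h. - 2 * ((x - c) \<bullet> h))) (at x)"
  unfolding power2_norm_eq_inner by (auto intro!: derivative_eq_intros simp: inner_commute)

lemma flat_exp_sq_dist_has_derivative:
  fixes c :: "'a::real_inner"
  shows "((\<lambda>x. flat_exp m (r - (norm (x - c))\<^sup>2)) has_derivative
      (\<lambda>h. (flat_exp (m + 2) (r - (norm (x - c))\<^sup>2) - real m * flat_exp (m + 1) (r - (norm (x - c))\<^sup>2))
        * (- 2 * ((x - c) \<bullet> h)))) (at x)"
  using has_derivative_compose[OF sq_dist_has_derivative flat_exp_deriv[unfolded has_field_derivative_def]]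
  by simp

text \<open>A partial derivative combines members of index \<open>m + 1\<close> and
  \<open>m + 2\<close> with a linear factor, so the induction on \<open>k\<close> has to keep
  \<open>m\<close> arbitrary.\<close>

lemma Ck_flat_exp_sq_dist: "Ck k (\<lambda>x::real^'n::finite. flat_exp m (r - (norm (x - c))\<^sup>2))"
proof (induction k arbitrary: m)
  case 0
  show ?case
    by (auto intro!: continuous_at_imp_continuous_on has_derivative_continuous flat_exp_sq_dist_has_derivative)
next
  case (Suc k)
  have "partial_deriv i (\<lambda>x::real^'n. flat_exp m (r - (norm (x - c))\<^sup>2))
    = (\<lambda>x. (flat_exp (m + 2) (r - (norm (x - c))\<^sup>2) + (- real m) * flat_exp (m + 1) (r - (norm (x - c))\<^sup>2))
        * ((- 2) * (x $ i + (- c $ i))))" for i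
    by (rule ext, subst partial_deriv_eq[OF flat_exp_sq_dist_has_derivative])
       (simp add: inner_axis)
  moreover have "Ck k (\<lambda>x. (flat_exp (m + 2) (r - (norm (x - c))\<^sup>2)
      + (- real m) * flat_exp (m + 1) (r - (norm (x - c))\<^sup>2)) * ((- 2) * (x $ i + (- c $ i))))" for i
    by (intro Ck_mult Ck_add Suc.IH Ck_const Ck_coord)
  moreover have "(\<lambda>x::real^'n. flat_exp m (r - (norm (x - c))\<^sup>2)) differentiable at x" for x
    using flat_exp_sq_dist_has_derivative by (rule differentiableI)
  ultimately show ?case by auto
qed

text \<open>The gradient is an explicit argument instead of a choice through
  \<open>frechet_derivative\<close>, so product and chain rules produce concrete terms. Functions
  live on the whole space; those of the ball are extended by zero.\<close>

definition C1_grad :: "('a::euclidean_space \<Rightarrow> real) \<Rightarrow> ('a \<Rightarrow> 'a) \<Rightarrow> bool" where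
  "C1_grad f g \<longleftrightarrow> (\<forall>x. (f has_derivative (\<lambda>h. g x \<bullet> h)) (at x)) \<and> continuous_on UNIV g"

lemma C1_grad_derivative: "C1_grad f g \<Longrightarrow> (f has_derivative (\<lambda>h. g x \<bullet> h)) (at x)"
  by (simp add: C1_grad_def)

lemma C1_grad_continuous_grad: "C1_grad f g \<Longrightarrow> continuous_on UNIV g"
  by (simp add: C1_grad_def)

lemma C1_grad_continuous: "C1_grad f g \<Longrightarrow> continuous_on UNIV f"
  by (meson C1_grad_def continuous_at_imp_continuous_on has_derivative_continuous)

lemma C1_grad_mult:
  assumes "C1_grad f f'" "C1_grad g g'"
  shows "C1_grad (\<lambda>x. f x * g x) (\<lambda>x. f x *\<^sub>R g' x + g x *\<^sub>R f' x)"
  unfolding C1_grad_def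
proof (intro conjI allI)
  fix x
  show "((\<lambda>x. f x * g x) has_derivative (\<lambda>h. (f x *\<^sub>R g' x + g x *\<^sub>R f' x) \<bullet> h)) (at x)"
    using has_derivative_mult[OF C1_grad_derivative[OF assms(1)] C1_grad_derivative[OF assms(2)], of x]
    by (rule has_derivative_eq_rhs) (auto simp: inner_add_left mult_ac)
qed (intro continuous_intros assms[THEN C1_grad_continuous] assms[THEN C1_grad_continuous_grad])

lemma C1_grad_compose:
  assumes f: "C1_grad f f'" and F: "\<And>t. (F has_real_derivative F' t) (at t)"
    and F': "continuous_on UNIV F'"
  shows "C1_grad (\<lambda>x. F (f x)) (\<lambda>x. F' (f x) *\<^sub>R f' x)"
  unfolding C1_grad_def
proof (intro conjI allI)
  fix x
  show "((\<lambda>x. F (f x)) has_derivative (\<lambda>h. (F' (f x) *\<^sub>R f' x) \<bullet> h)) (at x)"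
    using has_derivative_compose[OF C1_grad_derivative[OF f] F[unfolded has_field_derivative_def]]
    by simp
  show "continuous_on UNIV (\<lambda>x. F' (f x) *\<^sub>R f' x)"
    by (intro continuous_intros C1_grad_continuous_grad[OF f]
        continuous_on_compose2[OF F' C1_grad_continuous[OF f]]) simp
qed

lemma C1_grad_sq_dist: "C1_grad (\<lambda>x. r - (norm (x - c))\<^sup>2) (\<lambda>x. - (2 *\<^sub>R (x - c)))"
  unfolding C1_grad_def
proof (intro conjI allI)
  fix x
  show "((\<lambda>x. r - (norm (x - c))\<^sup>2) has_derivative (\<lambda>h. - (2 *\<^sub>R (x - c)) \<bullet> h)) (at x)"
    using sq_dist_has_derivative[of r c x] by (rule has_derivative_eq_rhs) auto
qed (intro continuous_intros)

lemma C1_grad_zero: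
  assumes "C1_grad f g" "open S" "x \<in> S" "\<And>y. y \<in> S \<Longrightarrow> f y = 0"
  shows "g x = 0"
proof -
  have "((\<lambda>y. 0) has_derivative (\<lambda>h. g x \<bullet> h)) (at x)"
    by (rule has_derivative_transform_within_open[OF C1_grad_derivative[OF assms(1)] assms(2,3)])
       (use assms(4) in auto)
  then have "(\<lambda>h. g x \<bullet> h) = (\<lambda>h. 0)"
    by (rule has_derivative_unique) simp
  then have "g x \<bullet> g x = 0" by meson
  then show ?thesis by simp
qed

text \<open>The strict inequality makes the region open, which forces the gradient to vanish
  there.\<close>

lemma C1_grad_support_grad:
  assumes "C1_grad f g" "\<And>y. norm y > r \<Longrightarrow> f y = 0" "norm x > r"
  shows "g x = 0"
  by (rule C1_grad_zero[OF assms(1), of "{x. norm x > r}"])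
     (use assms in \<open>auto intro!: open_Collect_less continuous_intros\<close>)

text \<open>The translates of this kernel are the only test functions ever needed: after mollification the
  differential inequality holds pointwise, and can then be multiplied by any nonnegative \<open>C\<^sup>1\<close>
  function.\<close>

lemma mollifier_kernel_exists:
  assumes e: "e > 0"
  obtains k :: "real^'n::finite \<Rightarrow> real" and kg where
    "C1_grad k kg" "\<And>z. k z \<ge> 0" "\<And>z. k (- z) = k z" "\<And>z. norm z \<ge> e \<Longrightarrow> k z = 0"
    "integrable lborel k" "integral\<^sup>L lborel k = 1"
    "\<And>x. norm x + e < 1 \<Longrightarrow> (\<lambda>y. k (x - y)) \<in> test_functions (ball 0 1)"
proof -
  \<comment> \<open>The unnormalised bump exp(-1/(e^2 - |z|^2)) on the ball of radius
    \<open>e\<close>, extended by zero.\<close>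
  define b where "b = (\<lambda>z::real^'n. flat_exp 0 (e\<^sup>2 - (norm z)\<^sup>2))"
  have C: "C1_grad b (\<lambda>z. flat_exp 2 (e\<^sup>2 - (norm z)\<^sup>2) *\<^sub>R (- (2 *\<^sub>R z)))"
    unfolding b_def
    using C1_grad_compose[OF C1_grad_sq_dist[of "e\<^sup>2" 0] flat_exp_deriv[of 0]] continuous_flat_exp
    by (simp add: numeral_2_eq_2)
  have cont: "continuous_on UNIV b" by (rule C1_grad_continuous[OF C])
  have nn: "b z \<ge> 0" for z by (simp add: b_def flat_exp_def)
  have z0: "b z = 0" if "norm z \<ge> e" for z
    using that e by (simp add: b_def flat_exp_def power_mono not_less)
  have bi: "integrable lborel (\<lambda>x. indicator (cball 0 e) x *\<^sub>R b x)"
    by (rule borel_integrable_compact) (auto intro: continuous_on_subset[OF cont])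
  moreover have "(\<lambda>x. indicator (cball 0 e) x *\<^sub>R b x) = b"
    using z0 by (auto simp: indicator_def fun_eq_iff)
  ultimately have ib: "integrable lborel b" by simp
  define c where "c = integral\<^sup>L lborel b"
  \<comment> \<open>A vanishing integral would force \<open>b\<close> to vanish almost everywhere,
    although it is positive on a ball of positive measure.\<close>
  have "c \<noteq> 0"
  proof
    assume "c = 0"
    then have "AE x in lborel. b x = 0"
      using integral_nonneg_eq_0_iff_AE[OF ib] nn c_def by auto
    then have "AE x in lborel. x \<notin> ball (0::real^'n) e"
    proof eventually_elim
      case (elim x)
      have "b x > 0" if "norm x < e"
        using that e by (simp add: b_def flat_exp_def abs_less_iff power_strict_mono)
      with elim show ?case by auto
    qed
    then have "emeasure lborel (ball (0::real^'n) e) = 0"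
      by (subst (asm) AE_iff_measurable[of "ball 0 e"]) auto
    then have "measure lborel (ball (0::real^'n) e) = 0" by (simp add: measure_def)
    then show False using content_ball_pos[OF e, of "0::real^'n"] by simp
  qed
  moreover have "c \<ge> 0" unfolding c_def using nn by simp
  ultimately have c: "c > 0" by simp
  define k where "k z = b z / c" for z
  have Ck: "C1_grad k (\<lambda>z. (1 / c) *\<^sub>R (flat_exp 2 (e\<^sup>2 - (norm z)\<^sup>2) *\<^sub>R (- (2 *\<^sub>R z))))"
    unfolding k_def[abs_def]
    by (rule C1_grad_compose[OF C, of "\<lambda>t. t / c" "\<lambda>t. 1 / c"]) (use c in \<open>auto intro!: derivative_eq_intros\<close>)
  have test: "(\<lambda>y. k (x - y)) \<in> test_functions (ball 0 1)" if "norm x + e < 1" for x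
  proof -
    have sub: "{y. k (x - y) \<noteq> 0} \<subseteq> cball x e"
    proof
      fix y assume "y \<in> {y. k (x - y) \<noteq> 0}"
      then have "\<not> e \<le> norm (x - y)" using z0[of "x - y"] by (auto simp: k_def)
      then show "y \<in> cball x e" by (simp add: dist_norm)
    qed
    then have cl: "closure {y. k (x - y) \<noteq> 0} \<subseteq> cball x e"
      by (rule closure_minimal) simp
    have "cball x e \<subseteq> ball 0 1"
    proof
      fix y assume "y \<in> cball x e"
      then have "norm y \<le> norm x + e" using norm_triangle_sub[of y x] by (simp add: dist_norm norm_minus_commute)
      then show "y \<in> ball 0 1" using that by simp
    qed
    \<comment> \<open>The bump is radial, so the reflected translate is again a bump, centred at
      \<open>x\<close>.\<close>
    moreover have "Ck n (\<lambda>y. k (x - y))" for n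
      using Ck_mult[OF Ck_const[of n "1/c"] Ck_flat_exp_sq_dist[of n 0 "e\<^sup>2" x]]
      by (simp add: k_def b_def norm_minus_commute)
    moreover have "compact (closure {y. k (x - y) \<noteq> 0})"
      using bounded_subset[OF bounded_cball sub] by simp
    ultimately show ?thesis using cl by (auto simp: test_functions_def)
  qed
  show ?thesis
  proof (rule that[OF Ck _ _ _ _ _ test])
    show "k z \<ge> 0" "norm z \<ge> e \<Longrightarrow> k z = 0" for z
      using nn z0 c by (simp_all add: k_def)
    show "k (- z) = k z" for z by (simp add: k_def b_def)
    show "integrable lborel k" using ib by (simp add: k_def[abs_def])
    show "integral\<^sup>L lborel k = 1" using c by (simp add: k_def[abs_def] c_def)
  qed
qed

subsection \<open>Integration of \<open>C\<^sup>1\<close> functions and convolution\<close>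

lemma lborel_distr_plus': "distr lborel borel (\<lambda>x. x + h) = (lborel :: 'a::euclidean_space measure)"
  using lborel_distr_plus[of h] by (simp add: add.commute[of h, abs_def])

lemma lborel_distr_reflect: "distr lborel borel (\<lambda>y. x - y) = (lborel :: 'a::euclidean_space measure)"
  using lborel_affine[of "-1" x] by (simp add: density_1)

lemma integrable_translate:
  fixes f :: "'a::euclidean_space \<Rightarrow> 'b::{banach, second_countable_topology}"
  assumes "integrable lborel f"
  shows "integrable lborel (\<lambda>x. f (x + h))"
  using integrable_distr[of "\<lambda>x. x + h" lborel borel f] assms by (simp add: lborel_distr_plus')

lemma integral_translate:
  fixes f :: "'a::euclidean_space \<Rightarrow> 'b::{banach, second_countable_topology}"
  assumes "f \<in> borel_measurable borel"
  shows "integral\<^sup>L lborel (\<lambda>x. f (x + h)) = integral\<^sup>L lborel f"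
  using integral_distr[of "\<lambda>x. x + h" lborel borel f] assms by (simp add: lborel_distr_plus')

lemma nn_integral_translate:
  fixes f :: "'a::euclidean_space \<Rightarrow> ennreal"
  assumes "f \<in> borel_measurable borel"
  shows "(\<integral>\<^sup>+x. f (x + h) \<partial>lborel) = integral\<^sup>N lborel f"
  using nn_integral_distr[of "\<lambda>x. x + h" lborel borel f] assms by (simp add: lborel_distr_plus')

lemma integrable_reflect:
  fixes f :: "'a::euclidean_space \<Rightarrow> 'b::{banach, second_countable_topology}"
  assumes "integrable lborel f"
  shows "integrable lborel (\<lambda>y. f (x - y))"
  using integrable_distr[of "\<lambda>y. x - y" lborel borel f] assms by (simp add: lborel_distr_reflect)

lemma integral_reflect:
  fixes f :: "'a::euclidean_space \<Rightarrow> 'b::{banach, second_countable_topology}"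
  assumes "f \<in> borel_measurable borel"
  shows "integral\<^sup>L lborel (\<lambda>y. f (x - y)) = integral\<^sup>L lborel f"
  using integral_distr[of "\<lambda>y. x - y" lborel borel f] assms by (simp add: lborel_distr_reflect)

section \<open>Uniform control of continuous functions with bounded support\<close>

lemma compact_support_integrable:
  fixes f :: "'a::euclidean_space \<Rightarrow> 'b::euclidean_space"
  assumes "continuous_on UNIV f" "\<And>x. norm x > R \<Longrightarrow> f x = 0"
  shows "integrable lborel f"
proof -
  have "integrable lborel (\<lambda>x. indicator (cball 0 R) x *\<^sub>R f x)"
    by (rule borel_integrable_compact) (auto intro: continuous_on_subset[OF assms(1)])
  moreover have "(\<lambda>x. indicator (cball 0 R) x *\<^sub>R f x) = f"
    using assms(2) by (auto simp: indicator_def fun_eq_iff)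
  ultimately show ?thesis by simp
qed

lemma compact_support_bounded:
  fixes f :: "'a::euclidean_space \<Rightarrow> 'b::euclidean_space"
  assumes "continuous_on UNIV f" "\<And>x. norm x > R \<Longrightarrow> f x = 0"
  obtains M where "M \<ge> 0" "\<And>x. norm (f x) \<le> M"
proof -
  have "compact (f ` cball 0 R)"
    by (intro compact_continuous_image continuous_on_subset[OF assms(1)]) auto
  then obtain M where M: "\<And>x. norm x \<le> R \<Longrightarrow> norm (f x) \<le> M"
    using compact_imp_bounded bounded_iff by (metis image_eqI mem_cball_0)
  show ?thesis
  proof
    show "norm (f x) \<le> max M 0" for x
      using M[of x] assms(2)[of x] by (cases "norm x \<le> R") auto
  qed simp
qed

lemma compact_support_uniformly_continuous:
  fixes f :: "'a::euclidean_space \<Rightarrow> 'b::euclidean_space"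
  assumes "continuous_on UNIV f" "\<And>x. norm x > R \<Longrightarrow> f x = 0" "e > 0"
  obtains d where "d > 0" "\<And>x h. norm h < d \<Longrightarrow> norm (f (x + h) - f x) \<le> e"
proof -
  \<comment> \<open>Shifts are kept below 1: a point of norm at most \<open>R + 1\<close> stays in
    the larger ball after the shift, and any other point is outside the support both before and
    after it.\<close>
  have "uniformly_continuous_on (cball 0 (R + 2)) f"
    by (intro compact_uniformly_continuous continuous_on_subset[OF assms(1)]) auto
  then obtain d where d: "d > 0"
    "\<And>x y. \<lbrakk>norm x \<le> R + 2; norm y \<le> R + 2; dist y x < d\<rbrakk> \<Longrightarrow> dist (f y) (f x) < e"
    using \<open>e > 0\<close> unfolding uniformly_continuous_on_def by (metis mem_cball_0)
  show ?thesis
  proof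
    fix x h :: 'a assume h: "norm h < min d 1"
    have t: "norm (x + h) \<le> norm x + norm h" "norm x \<le> norm (x + h) + norm h"
      using norm_triangle_ineq[of x h] norm_triangle_ineq[of "x + h" "- h"] by auto
    show "norm (f (x + h) - f x) \<le> e"
    proof (cases "norm x \<le> R + 1")
      case True
      then have "dist (f (x + h)) (f x) < e"
        using h t by (intro d(2)) (auto simp: dist_norm)
      then show ?thesis by (simp add: dist_norm)
    next
      case False
      then show ?thesis using h t assms(2)[of x] assms(2)[of "x + h"] \<open>e > 0\<close> by simp
    qed
  qed (use d in auto)
qed

lemma C1_grad_mean_value:
  assumes "C1_grad f g"
  obtains t where "0 < t" "t < 1" "f (x + h) - f x = g (x + t *\<^sub>R h) \<bullet> h"
proof -
  have "((\<lambda>t. f (x + t *\<^sub>R h)) has_derivative (\<lambda>s. g (x + t *\<^sub>R h) \<bullet> (s *\<^sub>R h))) (at t within S)" for t :: real and S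
    by (rule has_derivative_compose[OF _ C1_grad_derivative[OF assms]])
       (auto intro!: derivative_eq_intros)
  then have "\<exists>t\<in>{0<..<1}. f (x + 1 *\<^sub>R h) - f (x + 0 *\<^sub>R h) = g (x + t *\<^sub>R h) \<bullet> ((1 - 0) *\<^sub>R h)"
    by (intro mvt_simple) auto
  then show ?thesis using that by auto
qed

text \<open>Difference quotients in direction \<open>v\<close> integrate to zero by translation
  invariance, and dominated convergence passes this to the derivative. Applied to products, it is
  the source of every integration by parts below.\<close>

lemma integral_grad_eq_0:
  assumes C: "C1_grad f g" and R: "\<And>x. norm x > R \<Longrightarrow> f x = 0"
  shows "(LBINT x. g x \<bullet> v) = 0"
proof -
  define h where "h n = (1 / real (Suc n))" for n
  have h: "h n > 0" "h n \<le> 1" for n by (auto simp: h_def)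
  have fi: "integrable lborel f" by (rule compact_support_integrable[OF C1_grad_continuous[OF C] R])
  have gR: "norm x > R \<Longrightarrow> g x = 0" for x by (rule C1_grad_support_grad[OF C R])
  obtain M where M: "M \<ge> 0" "\<And>x. norm (g x) \<le> M"
    using compact_support_bounded[OF C1_grad_continuous_grad[OF C] gR] by blast
  have [measurable]: "f \<in> borel_measurable borel" "g \<in> borel_measurable borel"
    using C1_grad_continuous[OF C] C1_grad_continuous_grad[OF C] by (auto intro: borel_measurable_continuous_onI)
  define q where "q n x = (f (x + h n *\<^sub>R v) - f x) / h n" for n x
  have [measurable]: "q n \<in> borel_measurable borel" for n unfolding q_def by measurable
  have "(\<lambda>n. integral\<^sup>L lborel (q n)) \<longlonglongrightarrow> (LBINT x. g x \<bullet> v)"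
  \<comment> \<open>The mean value theorem bounds the quotients by \<open>M\<close> |v|; steps of
    size at most 1 keep them supported in the ball enlarged by |v|.\<close>
  proof (rule integral_dominated_convergence[where w = "\<lambda>x. indicator (cball 0 (R + norm v)) x *\<^sub>R (M * norm v)"])
    show "integrable lborel (\<lambda>x. indicator (cball 0 (R + norm v)) x *\<^sub>R (M * norm v))"
      by (rule borel_integrable_compact) auto
    show "AE x in lborel. (\<lambda>n. q n x) \<longlonglongrightarrow> g x \<bullet> v"
    proof (rule AE_I2)
      fix x
      have "((\<lambda>t. f (x + t *\<^sub>R v)) has_real_derivative g x \<bullet> v) (at 0)"
      proof -
        have "((\<lambda>t. f (x + t *\<^sub>R v)) has_derivative (\<lambda>s. g (x + 0 *\<^sub>R v) \<bullet> (s *\<^sub>R v))) (at 0)"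
          by (rule has_derivative_compose[OF _ C1_grad_derivative[OF C]])
             (auto intro!: derivative_eq_intros)
        then show ?thesis by (auto simp: has_field_derivative_def elim!: has_derivative_eq_rhs)
      qed
      then have "((\<lambda>s. (f (x + s *\<^sub>R v) - f x) / s) \<longlongrightarrow> g x \<bullet> v) (at 0)"
        by (simp add: DERIV_def)
      moreover have "filterlim h (at 0) sequentially"
        unfolding filterlim_at using h(1) LIMSEQ_Suc[OF lim_inverse_n'] by (auto simp: h_def[abs_def])
      ultimately show "(\<lambda>n. q n x) \<longlonglongrightarrow> g x \<bullet> v"
        unfolding q_def by (rule filterlim_compose)
    qed
    show "AE x in lborel. norm (q n x) \<le> indicator (cball 0 (R + norm v)) x *\<^sub>R (M * norm v)" for n
    proof (rule AE_I2)
      fix x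
      obtain t where t: "0 < t" "t < 1" "f (x + h n *\<^sub>R v) - f x = g (x + t *\<^sub>R (h n *\<^sub>R v)) \<bullet> (h n *\<^sub>R v)"
        by (rule C1_grad_mean_value[OF C])
      then have q: "q n x = g (x + (t * h n) *\<^sub>R v) \<bullet> v" using h(1)[of n] by (simp add: q_def)
      show "norm (q n x) \<le> indicator (cball 0 (R + norm v)) x *\<^sub>R (M * norm v)"
      proof (cases "norm x \<le> R + norm v")
        case True
        have "norm (q n x) \<le> norm (g (x + (t * h n) *\<^sub>R v)) * norm v" unfolding q by (simp add: Cauchy_Schwarz_ineq2)
        also have "\<dots> \<le> M * norm v" by (intro mult_right_mono M) auto
        finally show ?thesis using True by simp
      next
        case False
        have "norm ((t * h n) *\<^sub>R v) \<le> norm v"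
          using t h[of n] by (auto simp: abs_mult intro!: mult_left_le_one_le mult_le_one)
        moreover have "norm x \<le> norm (x + (t * h n) *\<^sub>R v) + norm ((t * h n) *\<^sub>R v)"
          using norm_triangle_ineq[of "x + (t * h n) *\<^sub>R v" "- ((t * h n) *\<^sub>R v)"] by simp
        ultimately have "norm (x + (t * h n) *\<^sub>R v) > R" using False by linarith
        then have "q n x = 0" unfolding q by (simp add: gR)
        then show ?thesis using False by simp
      qed
    qed
  qed (auto)
  moreover have "integral\<^sup>L lborel (q n) = 0" for n
    unfolding q_def by (simp add: fi integrable_translate integral_translate)
  ultimately have "(\<lambda>n. 0) \<longlonglongrightarrow> (LBINT x. g x \<bullet> v)" by simp
  then show ?thesis by (simp add: LIMSEQ_const_iff)
qed

text \<open>Write the increment as an integral of \<open>g (x + t h) . h\<close> over t in [0,1],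
  apply Jensen's inequality in t, exchange the integrals and shift back. With nonnegative integrals
  the bound makes sense whether or not the right side is finite.\<close>

lemma C1_grad_translation_L2:
  assumes C: "C1_grad f g"
  shows "(\<integral>\<^sup>+x. ennreal ((f (x + h) - f x)\<^sup>2) \<partial>lborel)
    \<le> ennreal ((norm h)\<^sup>2) * (\<integral>\<^sup>+x. ennreal ((norm (g x))\<^sup>2) \<partial>lborel)"
proof -
  have cg: "continuous_on UNIV g" by (rule C1_grad_continuous_grad[OF C])
  have [measurable]: "f \<in> borel_measurable borel" "g \<in> borel_measurable borel"
    using C1_grad_continuous[OF C] cg by (auto intro: borel_measurable_continuous_onI)
  have pw: "ennreal ((f (x + h) - f x)\<^sup>2)
    \<le> (\<integral>\<^sup>+t. indicator {0..1} t * ennreal ((norm h)\<^sup>2 * (norm (g (x + t *\<^sub>R h)))\<^sup>2) \<partial>lborel)" for x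
  proof -
    define p where "p t = g (x + t *\<^sub>R h) \<bullet> h" for t :: real
    have cp: "continuous_on A p" for A
      unfolding p_def by (intro continuous_intros continuous_on_compose2[OF cg]) auto
    define c where "c = f (x + h) - f x"
    have der: "((\<lambda>t. f (x + t *\<^sub>R h)) has_vector_derivative p t) (at t within {0..1})" for t
    proof -
      have "((\<lambda>t. f (x + t *\<^sub>R h)) has_derivative (\<lambda>s. g (x + t *\<^sub>R h) \<bullet> (s *\<^sub>R h))) (at t within {0..1})"
        by (rule has_derivative_compose[OF _ C1_grad_derivative[OF C]])
           (auto intro!: derivative_eq_intros)
      then show ?thesis by (simp add: has_vector_derivative_def p_def)
    qed
    have b1: "has_bochner_integral lborel (\<lambda>t. indicator {0..1} t *\<^sub>R p t) c"
      using integral_FTC_atLeastAtMost[of 0 1 "\<lambda>t. f (x + t *\<^sub>R h)" p, OF _ der cp]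
        borel_integrable_atLeastAtMost'[of 0 1 p, OF cp]
      by (simp add: has_bochner_integral_iff set_integrable_def set_lebesgue_integral_def c_def)
    have i2: "integrable lborel (\<lambda>t. indicator {0..1} t *\<^sub>R (p t)\<^sup>2)"
      by (rule borel_integrable_compact) (auto intro!: continuous_intros cp)
    have i0: "has_bochner_integral lborel (\<lambda>t. indicator {0..1::real} t *\<^sub>R (c\<^sup>2)) (c\<^sup>2)"
      by (simp add: has_bochner_integral_iff)
    \<comment> \<open>Jensen on the unit interval, obtained by expanding the variance of
      \<open>p\<close> around its mean \<open>c\<close>.\<close>
    have "0 \<le> (LBINT t. indicator {0..1} t *\<^sub>R (p t - c)\<^sup>2)"
      by (intro Bochner_Integration.integral_nonneg) auto
    also have "(\<lambda>t. indicator {0..1} t *\<^sub>R (p t - c)\<^sup>2) = (\<lambda>t. indicator {0..1} t *\<^sub>R (p t)\<^sup>2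
        - 2 * c * (indicator {0..1} t *\<^sub>R p t) + indicator {0..1} t *\<^sub>R (c\<^sup>2))"
      by (auto simp: fun_eq_iff indicator_def power2_eq_square algebra_simps)
    also have "(LBINT t. \<dots> t) = (LBINT t. indicator {0..1} t *\<^sub>R (p t)\<^sup>2) - 2 * c * c + c\<^sup>2"
      using b1 i0 i2 by (subst Bochner_Integration.integral_add Bochner_Integration.integral_diff; simp add: has_bochner_integral_iff)+
    finally have "c\<^sup>2 \<le> (LBINT t. indicator {0..1} t *\<^sub>R (p t)\<^sup>2)" by (simp add: power2_eq_square)
    then have "ennreal (c\<^sup>2) \<le> ennreal (LBINT t. indicator {0..1} t *\<^sub>R (p t)\<^sup>2)" by (rule ennreal_leI)
    also have "\<dots> = (\<integral>\<^sup>+t. ennreal (indicator {0..1} t *\<^sub>R (p t)\<^sup>2) \<partial>lborel)"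
      by (rule nn_integral_eq_integral[symmetric, OF i2]) auto
    also have "\<dots> \<le> (\<integral>\<^sup>+t. indicator {0..1} t * ennreal ((norm h)\<^sup>2 * (norm (g (x + t *\<^sub>R h)))\<^sup>2) \<partial>lborel)"
    proof (rule nn_integral_mono)
      fix t
      have "(p t)\<^sup>2 \<le> (norm h)\<^sup>2 * (norm (g (x + t *\<^sub>R h)))\<^sup>2"
        unfolding p_def using Cauchy_Schwarz_ineq[of "g (x + t *\<^sub>R h)" h]
        by (simp add: power2_norm_eq_inner mult.commute)
      then show "ennreal (indicator {0..1} t *\<^sub>R (p t)\<^sup>2)
        \<le> indicator {0..1} t * ennreal ((norm h)\<^sup>2 * (norm (g (x + t *\<^sub>R h)))\<^sup>2)"
        by (auto simp: indicator_def intro: ennreal_leI)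
    qed
    finally show ?thesis by (simp add: c_def)
  qed
  have "(\<integral>\<^sup>+x. ennreal ((f (x + h) - f x)\<^sup>2) \<partial>lborel)
    \<le> (\<integral>\<^sup>+x. (\<integral>\<^sup>+t. indicator {0..1} t * ennreal ((norm h)\<^sup>2 * (norm (g (x + t *\<^sub>R h)))\<^sup>2) \<partial>lborel) \<partial>lborel)"
    by (intro nn_integral_mono pw)
  also have "\<dots> = (\<integral>\<^sup>+t. (\<integral>\<^sup>+x. indicator {0..1::real} t * ennreal ((norm h)\<^sup>2 * (norm (g (x + t *\<^sub>R h)))\<^sup>2) \<partial>lborel) \<partial>lborel)"
    by (rule lborel_pair.Fubini') measurable
  also have "\<dots> = (\<integral>\<^sup>+t. indicator {0..1::real} t * (ennreal ((norm h)\<^sup>2) * (\<integral>\<^sup>+x. ennreal ((norm (g x))\<^sup>2) \<partial>lborel)) \<partial>lborel)"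
  proof (rule nn_integral_cong)
    fix t :: real
    have "(\<integral>\<^sup>+x. indicator {0..1::real} t * ennreal ((norm h)\<^sup>2 * (norm (g (x + t *\<^sub>R h)))\<^sup>2) \<partial>lborel)
      = indicator {0..1::real} t * (ennreal ((norm h)\<^sup>2) * (\<integral>\<^sup>+x. ennreal ((norm (g (x + t *\<^sub>R h)))\<^sup>2) \<partial>lborel))"
      by (simp add: nn_integral_cmult ennreal_mult)
    also have "(\<integral>\<^sup>+x. ennreal ((norm (g (x + t *\<^sub>R h)))\<^sup>2) \<partial>lborel) = (\<integral>\<^sup>+x. ennreal ((norm (g x))\<^sup>2) \<partial>lborel)"
      by (rule nn_integral_translate[where f = "\<lambda>x. ennreal ((norm (g x))\<^sup>2)"]) measurable
    finally show "(\<integral>\<^sup>+x. indicator {0..1::real} t * ennreal ((norm h)\<^sup>2 * (norm (g (x + t *\<^sub>R h)))\<^sup>2) \<partial>lborel)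
      = indicator {0..1::real} t * (ennreal ((norm h)\<^sup>2) * (\<integral>\<^sup>+x. ennreal ((norm (g x))\<^sup>2) \<partial>lborel))" .
  qed
  also have "\<dots> = ennreal ((norm h)\<^sup>2) * (\<integral>\<^sup>+x. ennreal ((norm (g x))\<^sup>2) \<partial>lborel)"
    by (simp add: nn_integral_multc)
  finally show ?thesis .
qed

text \<open>All regularity comes from the kernel: its uniform continuity is integrated against
  |f|.\<close>

lemma convolution_continuous:
  fixes K :: "'a::euclidean_space \<Rightarrow> 'b::euclidean_space" and f :: "'a \<Rightarrow> real"
  assumes K: "continuous_on UNIV K" and R: "\<And>x. norm x > R \<Longrightarrow> K x = 0" and f: "integrable lborel f"
  shows "integrable lborel (\<lambda>y. f y *\<^sub>R K (x - y))"
    and "continuous_on UNIV (\<lambda>x. LBINT y. f y *\<^sub>R K (x - y))"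
proof -
  obtain M where M: "M \<ge> 0" "\<And>x. norm (K x) \<le> M" using compact_support_bounded[OF K R] by blast
  have [measurable]: "K \<in> borel_measurable borel" by (rule borel_measurable_continuous_onI[OF K])
  have [measurable]: "f \<in> borel_measurable borel" using f by auto
  show i: "integrable lborel (\<lambda>y. f y *\<^sub>R K (x - y))" for x
  proof (rule Bochner_Integration.integrable_bound)
    show "integrable lborel (\<lambda>y. M * f y)" using f by simp
    show "AE y in lborel. norm (f y *\<^sub>R K (x - y)) \<le> norm (M * f y)"
      using M by (auto simp: abs_mult mult.commute[of M] intro!: AE_I2 mult_left_mono)
  qed simp
  show "continuous_on UNIV (\<lambda>x. LBINT y. f y *\<^sub>R K (x - y))"
    unfolding continuous_on_iff
  proof (intro ballI allI impI)
    fix x :: 'a and e :: real assume e: "e > 0"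
    define I where "I = (LBINT y. \<bar>f y\<bar>)"
    have I: "I \<ge> 0" by (simp add: I_def)
    \<comment> \<open>The denominator \<open>I + 1\<close> stays positive even if \<open>f\<close>
      vanishes almost everywhere.\<close>
    obtain d where d: "d > 0" "\<And>x h. norm h < d \<Longrightarrow> norm (K (x + h) - K x) \<le> e / (I + 1)"
      using compact_support_uniformly_continuous[OF K R, where e = "e / (I + 1)"] I e
      by (smt (verit) divide_pos_pos)
    show "\<exists>d>0. \<forall>x'\<in>UNIV. dist x' x < d \<longrightarrow>
       dist (LBINT y. f y *\<^sub>R K (x' - y)) (LBINT y. f y *\<^sub>R K (x - y)) < e"
    proof (intro exI[of _ d] conjI ballI impI d)
      fix x' assume x': "dist x' x < d"
      have "dist (LBINT y. f y *\<^sub>R K (x' - y)) (LBINT y. f y *\<^sub>R K (x - y))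
        = norm (LBINT y. f y *\<^sub>R K (x' - y) - f y *\<^sub>R K (x - y))"
        by (simp add: dist_norm i)
      also have "\<dots> \<le> (LBINT y. \<bar>f y\<bar> * (e / (I + 1)))"
      proof (rule Bochner_Integration.integral_norm_bound_integral)
        fix y
        have "norm (K ((x - y) + (x' - x)) - K (x - y)) \<le> e / (I + 1)"
          using x' by (intro d) (simp add: dist_norm)
        then have "norm (K (x' - y) - K (x - y)) \<le> e / (I + 1)" by simp
        then have "\<bar>f y\<bar> * norm (K (x' - y) - K (x - y)) \<le> \<bar>f y\<bar> * (e / (I + 1))" by (intro mult_left_mono) auto
        then show "norm (f y *\<^sub>R K (x' - y) - f y *\<^sub>R K (x - y)) \<le> \<bar>f y\<bar> * (e / (I + 1))"
          by (simp flip: scaleR_diff_right)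
      qed (use f i in auto)
      also have "\<dots> = I * (e / (I + 1))" by (simp add: I_def)
      also have "\<dots> < e" using I e by (simp add: field_simps)
      finally show "dist (LBINT y. f y *\<^sub>R K (x' - y)) (LBINT y. f y *\<^sub>R K (x - y)) < e" .
    qed
  qed
qed

text \<open>Differentiation under the integral: the mean value theorem turns the first-order error
  of \<open>k\<close> into an increment of \<open>kg\<close> along a segment, which is uniformly
  small because \<open>kg\<close> has bounded support.\<close>

lemma convolution_C1_grad:
  assumes C: "C1_grad k kg" and R: "\<And>x. norm x > R \<Longrightarrow> k x = 0" and f: "integrable lborel f"
  shows "C1_grad (\<lambda>x. LBINT y. f y * k (x - y)) (\<lambda>x. LBINT y. f y *\<^sub>R kg (x - y))"
proof -
  have ck: "continuous_on UNIV k" and cg: "continuous_on UNIV kg"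
    using C C1_grad_continuous C1_grad_continuous_grad by auto
  have gR: "norm x > R \<Longrightarrow> kg x = 0" for x by (rule C1_grad_support_grad[OF C R])
  have i: "integrable lborel (\<lambda>y. f y * k (x - y))" for x
    using convolution_continuous(1)[OF ck R f] by simp
  have ig: "integrable lborel (\<lambda>y. f y *\<^sub>R kg (x - y))" for x
    using convolution_continuous(1)[OF cg gR f, of R] by blast
  have "((\<lambda>x. LBINT y. f y * k (x - y)) has_derivative
      (\<lambda>h. (LBINT y. f y *\<^sub>R kg (x - y)) \<bullet> h)) (at x)" for x
    unfolding has_derivative_at_alt
  proof (intro conjI allI impI bounded_linear_inner_right)
    fix e :: real assume e: "e > 0"
    define I where "I = (LBINT y. \<bar>f y\<bar>)"
    have I: "I \<ge> 0" by (simp add: I_def)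
    obtain d where d: "d > 0" "\<And>x h. norm h < d \<Longrightarrow> norm (kg (x + h) - kg x) \<le> e / (I + 1)"
      using compact_support_uniformly_continuous[OF cg gR, where e = "e / (I + 1)"] I e
      by (smt (verit) divide_pos_pos)
    show "\<exists>d>0. \<forall>x'. norm (x' - x) < d \<longrightarrow>
      norm ((LBINT y. f y * k (x' - y)) - (LBINT y. f y * k (x - y))
         - (LBINT y. f y *\<^sub>R kg (x - y)) \<bullet> (x' - x)) \<le> e * norm (x' - x)"
    proof (intro exI[of _ d] conjI allI impI d)
      fix x' assume x': "norm (x' - x) < d"
      define h where "h = x' - x"
      have "(LBINT y. f y * k (x' - y)) - (LBINT y. f y * k (x - y))
         - (LBINT y. f y *\<^sub>R kg (x - y)) \<bullet> h
        = (LBINT y. f y * k (x' - y) - f y * k (x - y) - (f y *\<^sub>R kg (x - y)) \<bullet> h)"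
        using i integrable_inner_left[OF ig] integral_inner_left[OF ig, of x h]
        by (subst Bochner_Integration.integral_diff; simp)+
      also have "norm \<dots> \<le> (LBINT y. \<bar>f y\<bar> * (e / (I + 1) * norm h))"
      proof (rule Bochner_Integration.integral_norm_bound_integral)
        fix y
        obtain t where t: "0 < t" "t < 1" "k ((x - y) + h) - k (x - y) = kg ((x - y) + t *\<^sub>R h) \<bullet> h"
          by (rule C1_grad_mean_value[OF C])
        have "norm (t *\<^sub>R h) \<le> norm h" using t by (simp add: mult_left_le_one_le)
        then have "norm (kg ((x - y) + t *\<^sub>R h) - kg (x - y)) \<le> e / (I + 1)"
          using x' by (intro d) (simp add: h_def)
        then have "\<bar>(kg ((x - y) + t *\<^sub>R h) - kg (x - y)) \<bullet> h\<bar> \<le> e / (I + 1) * norm h"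
          by (meson Cauchy_Schwarz_ineq2 mult_right_mono norm_ge_zero order_trans)
        then have "\<bar>f y\<bar> * \<bar>(kg ((x - y) + t *\<^sub>R h) - kg (x - y)) \<bullet> h\<bar> \<le> \<bar>f y\<bar> * (e / (I + 1) * norm h)"
          by (intro mult_left_mono) auto
        moreover have "k (x' - y) = k (x - y) + kg ((x - y) + t *\<^sub>R h) \<bullet> h"
          using t(3) by (simp add: h_def)
        then have "f y * k (x' - y) - f y * k (x - y) - (f y *\<^sub>R kg (x - y)) \<bullet> h
          = f y * ((kg ((x - y) + t *\<^sub>R h) - kg (x - y)) \<bullet> h)"
          by (simp only: inner_diff_left right_diff_distrib distrib_left inner_scaleR_left)
        ultimately show "norm (f y * k (x' - y) - f y * k (x - y) - (f y *\<^sub>R kg (x - y)) \<bullet> h)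
            \<le> \<bar>f y\<bar> * (e / (I + 1) * norm h)" by (simp add: abs_mult)
      qed (use f i integrable_inner_left[OF ig] in auto)
      also have "\<dots> = I * (e / (I + 1)) * norm h" by (simp add: I_def)
      also have "\<dots> \<le> e * norm h"
        using I e by (intro mult_right_mono) (auto simp: field_simps)
      finally show "norm ((LBINT y. f y * k (x' - y)) - (LBINT y. f y * k (x - y))
         - (LBINT y. f y *\<^sub>R kg (x - y)) \<bullet> (x' - x)) \<le> e * norm (x' - x)" by (simp add: h_def)
    qed
  qed
  then show ?thesis
    unfolding C1_grad_def using convolution_continuous(2)[OF cg gR f] by blast
qed

subsection \<open>Continuity of translations\<close>

text \<open>Translation is an isometry of \<open>L^1\<close>, so replacing \<open>f\<close> by an
  approximation \<open>g\<close> costs the approximation error twice, once before and once after the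
  shift.\<close>

lemma translation_L1_closed:
  fixes f :: "'a::euclidean_space \<Rightarrow> 'b::{banach, second_countable_topology}"
  assumes f: "integrable lborel f"
    and approx: "\<And>e. e > 0 \<Longrightarrow> \<exists>g. integrable lborel g \<and> (LBINT x. norm (f x - g x)) \<le> e
      \<and> (\<lambda>n. LBINT x. norm (g (x + h n) - g x)) \<longlonglongrightarrow> 0"
  shows "(\<lambda>n. LBINT x. norm (f (x + h n) - f x)) \<longlonglongrightarrow> 0"
proof (rule LIMSEQ_I)
  let ?T = "\<lambda>f n. LBINT x. norm (f (x + h n) - f x)"
  fix r :: real assume r: "r > 0"
  obtain g where g: "integrable lborel g" "(LBINT x. norm (f x - g x)) \<le> r / 4"
    "(\<lambda>n. ?T g n) \<longlonglongrightarrow> 0"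
    using approx[of "r / 4"] r by auto
  obtain N where N: "\<And>n. n \<ge> N \<Longrightarrow> norm (?T g n - 0) < r / 4"
    using LIMSEQ_D[OF g(3), of "r / 4"] r by auto
  have "norm (?T f n - 0) < r" if "n \<ge> N" for n
  proof -
    note t = integrable_translate[OF f, of "h n"] integrable_translate[OF g(1), of "h n"]
    have i: "integrable lborel (\<lambda>x. norm (f x - g x))" using f g by simp
    have "?T f n \<le> (LBINT x. norm (f (x + h n) - g (x + h n))
        + norm (g (x + h n) - g x) + norm (f x - g x))"
    proof (rule integral_mono)
      fix x
      show "norm (f (x + h n) - f x) \<le> norm (f (x + h n) - g (x + h n)) + norm (g (x + h n) - g x) + norm (f x - g x)"
        using norm_triangle_ineq[of "f (x + h n) - g (x + h n) + (g (x + h n) - g x)" "g x - f x"]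
          norm_triangle_ineq[of "f (x + h n) - g (x + h n)" "g (x + h n) - g x"]
        by (simp add: norm_minus_commute)
    qed (use f g t in auto)
    also have "\<dots> = (LBINT x. norm (f (x + h n) - g (x + h n)))
        + ?T g n + (LBINT x. norm (f x - g x))"
      using f g t by (subst Bochner_Integration.integral_add; simp)+
    also have "(LBINT x. norm (f (x + h n) - g (x + h n))) = (LBINT x. norm (f x - g x))"
      using integral_translate[of "\<lambda>x. norm (f x - g x)" "h n"] i by auto
    finally have "?T f n < r" using g(2) N[OF that] r by simp
    moreover have "?T f n \<ge> 0" by simp
    ultimately show ?thesis by simp
  qed
  then show "\<exists>N. \<forall>n\<ge>N. norm (?T f n - 0) < r" by blast
qed

text \<open>A point of an open set stays in it under small shifts, so dominated convergence handles
  the part of \<open>U\<close> that is shifted out; the part shifted in has the same measure by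
  invariance.\<close>

lemma translation_L1_open:
  fixes U :: "'a::euclidean_space set" and c :: "'b::{banach, second_countable_topology}"
  assumes U: "open U" "emeasure lborel U < \<infinity>" and h: "h \<longlonglongrightarrow> 0"
  shows "(\<lambda>n. LBINT x. norm (indicator U (x + h n) *\<^sub>R c - indicator U x *\<^sub>R c)) \<longlonglongrightarrow> 0"
proof -
  have [measurable]: "U \<in> sets borel" using U by simp
  have i: "integrable lborel (indicator U :: 'a \<Rightarrow> real)" using U by (simp add: integrable_indicator_iff)
  have "(\<lambda>n. LBINT x. indicator U x * (1 - indicator U (x + h n))) \<longlonglongrightarrow> (\<integral>x. (0::real) \<partial>(lborel::'a measure))"
  proof (rule integral_dominated_convergence[where w = "indicator U"])
    show "AE x in lborel. (\<lambda>n. indicator U x * (1 - indicator U (x + h n))) \<longlonglongrightarrow> (0::real)"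
    proof (rule AE_I2)
      fix x
      show "(\<lambda>n. indicator U x * (1 - indicator U (x + h n))) \<longlonglongrightarrow> (0::real)"
      proof (cases "x \<in> U")
        case True
        have "(\<lambda>n. x + h n) \<longlonglongrightarrow> x" using tendsto_add[OF tendsto_const h, of x] by simp
        then have "\<forall>\<^sub>F n in sequentially. x + h n \<in> U" using U(1) True topological_tendstoD by blast
        then have "\<forall>\<^sub>F n in sequentially. indicator U x * (1 - indicator U (x + h n)) = (0::real)"
          by eventually_elim simp
        then show ?thesis by (rule tendsto_eventually)
      qed simp
    qed
  qed (use i in \<open>auto simp: indicator_def\<close>)
  then have lim: "(\<lambda>n. 2 * (LBINT x. indicator U x * (1 - indicator U (x + h n))) * norm c) \<longlonglongrightarrow> 0"
    by (intro tendsto_eq_intros) auto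
  have "(LBINT x. norm (indicator U (x + h n) *\<^sub>R c - indicator U x *\<^sub>R c))
      = 2 * (LBINT x. indicator U x * (1 - indicator U (x + h n))) * norm c" for n
  proof -
    note t = integrable_translate[OF i, of "h n"]
    have p: "integrable lborel (\<lambda>x. indicator U x * (1 - indicator U (x + h n)) :: real)"
      by (rule Bochner_Integration.integrable_bound[OF i]) (auto simp: indicator_def)
    \<comment> \<open>Pointwise, the absolute difference of the two indicators is twice the
      indicator of leaving \<open>U\<close> plus a signed difference whose integral is zero.\<close>
    have "(LBINT x. norm (indicator U (x + h n) *\<^sub>R c - indicator U x *\<^sub>R c))
      = (LBINT x. (2 * (indicator U x * (1 - indicator U (x + h n))) + (indicator U (x + h n) - indicator U x)) * norm c)"
      by (intro Bochner_Integration.integral_cong) (auto simp: indicator_def)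
    also have "\<dots> = (2 * (LBINT x. indicator U x * (1 - indicator U (x + h n)))
        + ((LBINT x. indicator U (x + h n)) - (LBINT x. indicator U x))) * norm c"
      using p t i by (simp add: Bochner_Integration.integral_add Bochner_Integration.integral_diff)
    also have "(LBINT x. indicator U (x + h n)) = (\<integral>x. indicator U x \<partial>lborel :: real)"
      by (rule integral_translate) simp
    finally show ?thesis by simp
  qed
  with lim show ?thesis by simp
qed

text \<open>Induction on integrable functions: open sets are settled, outer regularity passes to
  Borel sets of finite measure, and closedness under \<open>L^1\<close> limits gives the
  rest.\<close>

lemma translation_L1_tendsto:
  fixes f :: "'a::euclidean_space \<Rightarrow> 'b::{banach, second_countable_topology}"
  assumes "integrable lborel f" and h: "h \<longlonglongrightarrow> 0"
  shows "(\<lambda>n. LBINT x. norm (f (x + h n) - f x)) \<longlonglongrightarrow> 0"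
  using assms(1)
proof (induction f rule: integrable_induct)
  case (base A c)
  then have A: "A \<in> sets borel" "emeasure lborel A < \<infinity>" by auto
  show ?case
  proof (rule translation_L1_closed)
    show "integrable lborel (\<lambda>x. indicator A x *\<^sub>R c)" using A by auto
    fix e :: real assume e: "e > 0"
    obtain U where U: "open U" "A \<subseteq> U" "emeasure lborel (U - A) < e / (norm c + 1)"
      using outer_regular_lborel[OF A(1), of "e / (norm c + 1)"] e
      by (metis add_nonneg_pos divide_pos_pos norm_ge_zero zero_less_one)
    have m: "U \<in> sets borel" using U by simp
    have "emeasure lborel U = emeasure lborel A + emeasure lborel (U - A)"
      using U(2) A m by (subst plus_emeasure) (auto simp: Un_absorb1)
    also have "\<dots> < \<infinity>" using A(2) U(3) by (simp add: less_top[symmetric]) (metis ennreal_less_top order_less_trans top.not_eq_extremum)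
    finally have Uf: "emeasure lborel U < \<infinity>" .
    have "measure lborel (U - A) \<le> e / (norm c + 1)"
      using U(3) e by (simp add: measure_def) (smt (verit) enn2real_leI less_imp_le divide_nonneg_nonneg norm_ge_zero)
    then have "(LBINT x. norm (indicator A x *\<^sub>R c - indicator U x *\<^sub>R c)) \<le> e"
    proof -
      have "(LBINT x. norm (indicator A x *\<^sub>R c - indicator U x *\<^sub>R c)) = (LBINT x. indicator (U - A) x * norm c)"
        using U(2) by (intro Bochner_Integration.integral_cong) (auto simp: indicator_def)
      also have "\<dots> = measure lborel (U - A) * norm c" by simp
      also have "\<dots> \<le> e / (norm c + 1) * norm c"
        by (intro mult_right_mono \<open>measure lborel (U - A) \<le> _\<close>) auto
      also have "\<dots> \<le> e" using e by (simp add: field_simps add_pos_nonneg)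
      finally show ?thesis .
    qed
    moreover have "integrable lborel (\<lambda>x. indicator U x *\<^sub>R c)" using m Uf by auto
    ultimately show "\<exists>g. integrable lborel g \<and> (LBINT x. norm (indicator A x *\<^sub>R c - g x)) \<le> e
      \<and> (\<lambda>n. LBINT x. norm (g (x + h n) - g x)) \<longlonglongrightarrow> 0"
      using translation_L1_open[OF U(1) Uf h] by blast
  qed
next
  case (add f g)
  have "(\<lambda>n. (LBINT x. norm (f (x + h n) - f x)) + (LBINT x. norm (g (x + h n) - g x))) \<longlonglongrightarrow> 0 + 0"
    by (intro tendsto_add add.IH)
  then have L: "(\<lambda>n. (LBINT x. norm (f (x + h n) - f x)) + (LBINT x. norm (g (x + h n) - g x))) \<longlonglongrightarrow> 0"
    by simp
  show ?case
  proof (rule tendsto_sandwich[OF _ _ tendsto_const L])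
    show "\<forall>\<^sub>F n in sequentially. (LBINT x. norm (f (x + h n) + g (x + h n) - (f x + g x)))
      \<le> (LBINT x. norm (f (x + h n) - f x)) + (LBINT x. norm (g (x + h n) - g x))"
    proof (rule always_eventually, rule allI)
      fix n
      note t = integrable_translate[OF add.hyps(1), of "h n"] integrable_translate[OF add.hyps(2), of "h n"]
      have "(LBINT x. norm (f (x + h n) + g (x + h n) - (f x + g x)))
        \<le> (LBINT x. norm (f (x + h n) - f x) + norm (g (x + h n) - g x))"
        using add.hyps t by (intro integral_mono) (auto simp: add_diff_add norm_triangle_ineq)
      then show "(LBINT x. norm (f (x + h n) + g (x + h n) - (f x + g x)))
      \<le> (LBINT x. norm (f (x + h n) - f x)) + (LBINT x. norm (g (x + h n) - g x))"
        using add.hyps t by simp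
    qed
  qed simp
next
  case (lim f s)
  show ?case
  proof (rule translation_L1_closed[OF lim.hyps(4)])
    fix e :: real assume e: "e > 0"
    have "(\<lambda>i. LBINT x. norm (f x - s i x)) \<longlonglongrightarrow> (\<integral>x. 0 \<partial>(lborel::'a measure))"
    \<comment> \<open>The approximating simple functions satisfy |s| <= 2 |f|, hence the factor
      3.\<close>
    proof (rule integral_dominated_convergence[where w = "\<lambda>x. 3 * norm (f x)"])
      show "AE x in lborel. (\<lambda>i. norm (f x - s i x)) \<longlonglongrightarrow> 0"
      proof (rule AE_I2)
        fix x
        have "(\<lambda>i. norm (f x - s i x)) \<longlonglongrightarrow> norm (f x - f x)"
          using lim.hyps(2)[of x] by (intro tendsto_intros) simp
        then show "(\<lambda>i. norm (f x - s i x)) \<longlonglongrightarrow> 0" by simp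
      qed
      show "AE x in lborel. norm (norm (f x - s i x)) \<le> 3 * norm (f x)" for i
      proof (rule AE_I2)
        fix x
        show "norm (norm (f x - s i x)) \<le> 3 * norm (f x)"
          using lim.hyps(3)[of x i] norm_triangle_ineq4[of "f x" "s i x"] by simp
      qed
      show "(\<lambda>x. norm (f x - s i x)) \<in> borel_measurable lborel" for i
        using borel_measurable_integrable[OF lim.hyps(1)] borel_measurable_integrable[OF lim.hyps(4)] by simp
    qed (use lim.hyps(4) in auto)
    then obtain i where "(LBINT x. norm (f x - s i x)) < e"
      using LIMSEQ_D[of "\<lambda>i. LBINT x. norm (f x - s i x)" 0 e] e by force
    then show "\<exists>g. integrable lborel g \<and> (LBINT x. norm (f x - g x)) \<le> e
      \<and> (\<lambda>n. LBINT x. norm (g (x + h n) - g x)) \<longlonglongrightarrow> 0"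
      using lim.hyps(1)[of i] lim.IH[of i] by (intro exI[of _ "s i"]) auto
  qed
qed

text \<open>Cutting \<open>f\<close> at height \<open>M\<close> reduces this to \<open>L^1\<close>:
  for the bounded part the square of an increment is at most \<open>2 M\<close> times the increment,
  and the other part is small in \<open>L^2\<close> uniformly in the shift.\<close>

lemma translation_L2_tendsto:
  fixes f :: "'a::euclidean_space \<Rightarrow> 'b::euclidean_space"
  assumes f: "integrable lborel f" and f2: "integrable lborel (\<lambda>x. (norm (f x))\<^sup>2)" and h: "h \<longlonglongrightarrow> 0"
  shows "(\<lambda>n. \<integral>\<^sup>+x. ennreal ((norm (f (x + h n) - f x))\<^sup>2) \<partial>lborel) \<longlonglongrightarrow> 0"
proof -
  have [measurable]: "f \<in> borel_measurable borel" using f by auto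
  define b where "b M x = (if norm (f x) \<le> M then f x else 0)" for M :: real and x
  define r where "r M x = (if norm (f x) \<le> M then 0 else f x)" for M :: real and x
  have [measurable]: "b M \<in> borel_measurable borel" "r M \<in> borel_measurable borel" for M
    unfolding b_def r_def by measurable
  have split: "f x = b M x + r M x" for M x by (simp add: b_def r_def)
  have ib: "integrable lborel (b M)" for M
    by (rule Bochner_Integration.integrable_bound[OF f]) (auto simp: b_def)
  have ir: "integrable lborel (\<lambda>x. (norm (r M x))\<^sup>2)" for M
    by (rule Bochner_Integration.integrable_bound[OF f2]) (auto simp: r_def)
  have rlim: "(\<lambda>M. LBINT x. (norm (r (real M) x))\<^sup>2) \<longlonglongrightarrow> (\<integral>x. 0 \<partial>(lborel::'a measure))"
  proof (rule integral_dominated_convergence[OF _ _ f2])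
    show "AE x in lborel. (\<lambda>M. (norm (r (real M) x))\<^sup>2) \<longlonglongrightarrow> 0"
    proof (rule AE_I2)
      fix x
      obtain N where "norm (f x) \<le> real N" using real_arch_simple by blast
      then have "\<forall>\<^sub>F M in sequentially. (norm (r (real M) x))\<^sup>2 = 0"
        by (auto simp: r_def eventually_sequentially intro!: exI[of _ N])
      then show "(\<lambda>M. (norm (r (real M) x))\<^sup>2) \<longlonglongrightarrow> 0" by (rule tendsto_eventually)
    qed
  qed (auto simp: r_def)
  have main: "(\<integral>\<^sup>+x. ennreal ((norm (f (x + v) - f x))\<^sup>2) \<partial>lborel)
    \<le> ennreal (4 * M * (LBINT x. norm (b M (x + v) - b M x)) + 8 * (LBINT x. (norm (r M x))\<^sup>2))"
    if M: "M \<ge> 0" for M v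
  proof -
    have tb: "integrable lborel (\<lambda>x. norm (b M (x + v) - b M x))"
      using ib integrable_translate[OF ib] by auto
    have tr: "integrable lborel (\<lambda>x. (norm (r M (x + v)))\<^sup>2)"
      by (rule integrable_translate[OF ir])
    have "(norm (f (x + v) - f x))\<^sup>2
      \<le> 4 * M * norm (b M (x + v) - b M x) + 4 * (norm (r M (x + v)))\<^sup>2 + 4 * (norm (r M x))\<^sup>2" for x
    proof -
      define p q s where "p = norm (b M (x + v) - b M x)" and "q = norm (r M (x + v))" and "s = norm (r M x)"
      have "norm (f (x + v) - f x) \<le> p + (q + s)"
      proof -
        have "f (x + v) - f x = (b M (x + v) - b M x) + (r M (x + v) - r M x)"
          by (simp add: split[of _ M])
        then show ?thesis unfolding p_def q_def s_def
          by (metis add_left_mono norm_triangle_ineq norm_triangle_ineq4 order_trans)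
      qed
      then have "(norm (f (x + v) - f x))\<^sup>2 \<le> (p + (q + s))\<^sup>2" by (intro power_mono) auto
      \<comment> \<open>Twice (a + b)^2 <= 2 a^2 + 2 b^2, so that the bounded part gets the factor 2
        and each tail the factor 4.\<close>
      also have "\<dots> \<le> 2 * p\<^sup>2 + 4 * q\<^sup>2 + 4 * s\<^sup>2"
        using zero_le_power2[of "p - (q + s)"] zero_le_power2[of "q - s"] by (simp add: power2_eq_square algebra_simps)
      also have "p\<^sup>2 \<le> (2 * M) * p"
      proof -
        have "norm (b M y) \<le> M" for y using M by (auto simp: b_def)
        then have "p \<le> 2 * M" unfolding p_def using norm_triangle_ineq4[of "b M (x + v)" "b M x"]
          by (smt (verit))
        then show ?thesis unfolding power2_eq_square by (rule mult_right_mono) (simp add: p_def)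
      qed
      finally show ?thesis by (simp add: p_def q_def s_def)
    qed
    then have "(\<integral>\<^sup>+x. ennreal ((norm (f (x + v) - f x))\<^sup>2) \<partial>lborel)
      \<le> (\<integral>\<^sup>+x. ennreal (4 * M * norm (b M (x + v) - b M x) + 4 * (norm (r M (x + v)))\<^sup>2 + 4 * (norm (r M x))\<^sup>2) \<partial>lborel)"
      by (intro nn_integral_mono ennreal_leI) auto
    also have "\<dots> = ennreal (LBINT x. 4 * M * norm (b M (x + v) - b M x) + 4 * (norm (r M (x + v)))\<^sup>2 + 4 * (norm (r M x))\<^sup>2)"
      using tb tr ir M by (intro nn_integral_eq_integral) auto
    also have "(LBINT x. 4 * M * norm (b M (x + v) - b M x) + 4 * (norm (r M (x + v)))\<^sup>2 + 4 * (norm (r M x))\<^sup>2)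
      = 4 * M * (LBINT x. norm (b M (x + v) - b M x)) + 4 * (LBINT x. (norm (r M (x + v)))\<^sup>2)
        + 4 * (LBINT x. (norm (r M x))\<^sup>2)"
      using tb tr ir by simp
    also have "(LBINT x. (norm (r M (x + v)))\<^sup>2) = (LBINT x. (norm (r M x))\<^sup>2)"
      by (rule integral_translate[of "\<lambda>x. (norm (r M x))\<^sup>2"]) measurable
    finally show ?thesis by (simp add: algebra_simps)
  qed
  show ?thesis
  proof (rule order_tendstoI)
    fix e :: ennreal assume "0 < e"
    then obtain e' where e': "0 < e'" "ennreal e' < e"
      by (metis dense ennreal_cases ennreal_less_zero_iff not_less_iff_gr_or_eq ennreal_less_top top.not_eq_extremum)
    \<comment> \<open>The height is fixed first and leaves the tails less than half of
      \<open>e'\<close>; only then does the shift tend to zero.\<close>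
    obtain M where M: "(LBINT x. (norm (r (real M) x))\<^sup>2) < e' / 16"
      using LIMSEQ_D[OF rlim, of "e' / 16"] e' by force
    have "(\<lambda>n. 4 * real M * (LBINT x. norm (b (real M) (x + h n) - b (real M) x))) \<longlonglongrightarrow> 0"
      using translation_L1_tendsto[OF ib h, of "real M"] by (intro tendsto_eq_intros) auto
    then have "\<forall>\<^sub>F n in sequentially. 4 * real M * (LBINT x. norm (b (real M) (x + h n) - b (real M) x)) < e' / 2"
      using e' by (intro order_tendstoD) auto
    then show "\<forall>\<^sub>F n in sequentially. (\<integral>\<^sup>+x. ennreal ((norm (f (x + h n) - f x))\<^sup>2) \<partial>lborel) < e"
    proof eventually_elim
      case (elim n)
      then have "ennreal (4 * real M * (LBINT x. norm (b (real M) (x + h n) - b (real M) x))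
          + 8 * (LBINT x. (norm (r (real M) x))\<^sup>2)) \<le> ennreal e'"
        using M by (intro ennreal_leI) simp
      then show ?case using main[of "real M" "h n"] e' by (meson of_nat_0_le_iff order_le_less_trans order_trans)
    qed
  qed simp
qed

subsection \<open>Mollification and Borel representatives\<close>

definition mollify :: "('a::euclidean_space \<Rightarrow> real) \<Rightarrow> ('a \<Rightarrow> 'b::euclidean_space) \<Rightarrow> 'a \<Rightarrow> 'b" where
  "mollify k f x = (LBINT y. k (x - y) *\<^sub>R f y)"

lemma mollify_integrable:
  fixes f :: "'a::euclidean_space \<Rightarrow> 'b::euclidean_space"
  assumes k: "continuous_on UNIV k" and R: "\<And>x. norm x > R \<Longrightarrow> k x = 0" and f: "integrable lborel f"
  shows "integrable lborel (\<lambda>y. k (x - y) *\<^sub>R f y)"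
proof -
  obtain M where M: "M \<ge> 0" "\<And>x. norm (k x) \<le> M" using compact_support_bounded[OF k R] by blast
  have [measurable]: "k \<in> borel_measurable borel" by (rule borel_measurable_continuous_onI[OF k])
  have [measurable]: "f \<in> borel_measurable borel" using f by auto
  show ?thesis
  proof (rule Bochner_Integration.integrable_bound)
    show "integrable lborel (\<lambda>y. M *\<^sub>R f y)" using f by simp
    show "AE y in lborel. norm (k (x - y) *\<^sub>R f y) \<le> norm (M *\<^sub>R f y)"
      using M by (auto intro!: AE_I2 mult_right_mono)
  qed simp
qed

lemma mollify_measurable [measurable]:
  fixes f :: "'a::euclidean_space \<Rightarrow> 'b::euclidean_space"
  assumes [measurable]: "k \<in> borel_measurable borel" "f \<in> borel_measurable borel"
  shows "mollify k f \<in> borel_measurable borel"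
  unfolding mollify_def[abs_def] by measurable

lemma mollify_inner:
  fixes f :: "'a::euclidean_space \<Rightarrow> 'b::euclidean_space"
  assumes "continuous_on UNIV k" "\<And>x. norm x > R \<Longrightarrow> k x = 0" "integrable lborel f"
  shows "mollify k f x \<bullet> b = mollify k (\<lambda>y. f y \<bullet> b) x"
  using integral_inner_left[OF mollify_integrable[OF assms, of R], of b x] by (simp add: mollify_def)

lemma mollify_C1_grad:
  fixes f :: "'a::euclidean_space \<Rightarrow> real"
  assumes C: "C1_grad k kg" and R: "\<And>x. norm x > R \<Longrightarrow> k x = 0" and f: "integrable lborel f"
  shows "C1_grad (mollify k f) (\<lambda>x. LBINT y. f y *\<^sub>R kg (x - y))"
  using convolution_C1_grad[OF assms, of R] by (simp add: mollify_def[abs_def] mult.commute)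

text \<open>The mollified function averages translates against the probability density
  \<open>k\<close>, so Jensen's inequality bounds its error pointwise by the average of the
  translation errors. Integration in x leaves the worst shift of length below
  \<open>e\<close>.\<close>

lemma mollify_error:
  fixes f :: "'a::euclidean_space \<Rightarrow> 'b::euclidean_space"
  assumes k: "continuous_on UNIV k" and e: "\<And>z. norm z \<ge> e \<Longrightarrow> k z = 0"
    and nn: "\<And>z. k z \<ge> 0" and k1: "integral\<^sup>L lborel k = 1" and f: "integrable lborel f"
    and p: "p = 1 \<or> p = 2"
    and c: "\<And>v. norm v < e \<Longrightarrow> (\<integral>\<^sup>+x. ennreal (norm (f (x + v) - f x) ^ p) \<partial>lborel) \<le> c"
  shows "(\<integral>\<^sup>+x. ennreal (norm (mollify k f x - f x) ^ p) \<partial>lborel) \<le> c"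
proof -
  have eR: "norm z > e \<Longrightarrow> k z = 0" for z using e by simp
  have ki: "integrable lborel k" by (rule compact_support_integrable[OF k eR])
  have [measurable]: "k \<in> borel_measurable borel" "f \<in> borel_measurable borel"
    using borel_measurable_continuous_onI[OF k] f by auto
  have nk1: "(\<integral>\<^sup>+z. ennreal (k z) \<partial>lborel) = 1"
    using nn_integral_eq_integral[OF ki] nn k1 by simp
  have pw: "ennreal (norm (mollify k f x - f x) ^ p)
     \<le> (\<integral>\<^sup>+z. ennreal (k z) * ennreal (norm (f (x - z) - f x) ^ p) \<partial>lborel)" for x
  proof -
    have i1: "integrable lborel (\<lambda>z. k z *\<^sub>R f (x - z))"
      using integrable_reflect[OF mollify_integrable[OF k eR f, of e x], of x] by simp
    have "mollify k f x = (LBINT z. k z *\<^sub>R f (x - z))"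
      unfolding mollify_def using integral_reflect[of "\<lambda>y. k (x - y) *\<^sub>R f y" x] by simp
    then have "mollify k f x - f x = (LBINT z. k z *\<^sub>R (f (x - z) - f x))"
      using i1 ki k1 by (simp add: scaleR_diff_right)
    then have n1: "ennreal (norm (mollify k f x - f x)) \<le> (\<integral>\<^sup>+z. ennreal (k z) * ennreal (norm (f (x - z) - f x)) \<partial>lborel)"
      using integral_norm_bound_ennreal[of lborel "\<lambda>z. k z *\<^sub>R (f (x - z) - f x)"] i1 ki nn
      by (simp add: scaleR_diff_right[symmetric] ennreal_mult)
         (simp add: scaleR_diff_right)
    show ?thesis
    proof (cases "p = 1")
      case False
      then have p2: "p = 2" using p by simp
      have "(ennreal (norm (mollify k f x - f x)))\<^sup>2
        \<le> (\<integral>\<^sup>+z. ennreal (k z) * ennreal (norm (f (x - z) - f x)) \<partial>lborel)\<^sup>2"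
        by (intro power_mono n1) simp
      \<comment> \<open>Cauchy-Schwarz with \<open>k\<close> split into two square roots is Jensen
        for the square, since \<open>k\<close> has integral 1.\<close>
      also have "(\<integral>\<^sup>+z. ennreal (k z) * ennreal (norm (f (x - z) - f x)) \<partial>lborel)
        = (\<integral>\<^sup>+z. ennreal (sqrt (k z)) * ennreal (sqrt (k z) * norm (f (x - z) - f x)) \<partial>lborel)"
        using nn by (intro nn_integral_cong) (simp flip: ennreal_mult add: mult.assoc[symmetric])
      also have "\<dots>\<^sup>2 \<le> (\<integral>\<^sup>+z. (ennreal (sqrt (k z)))\<^sup>2 \<partial>lborel)
         * (\<integral>\<^sup>+z. (ennreal (sqrt (k z) * norm (f (x - z) - f x)))\<^sup>2 \<partial>lborel)"
        by (rule Cauchy_Schwarz_nn_integral) measurable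
      also have "\<dots> = (\<integral>\<^sup>+z. ennreal (k z) * ennreal (norm (f (x - z) - f x) ^ 2) \<partial>lborel)"
        using nn nk1 by (simp add: ennreal_power power_mult_distrib flip: ennreal_mult)
      finally show ?thesis using p2 by (simp add: ennreal_power)
    qed (use n1 in simp)
  qed
  have "(\<integral>\<^sup>+x. ennreal (norm (mollify k f x - f x) ^ p) \<partial>lborel)
    \<le> (\<integral>\<^sup>+x. (\<integral>\<^sup>+z. ennreal (k z) * ennreal (norm (f (x - z) - f x) ^ p) \<partial>lborel) \<partial>lborel)"
    by (intro nn_integral_mono pw)
  also have "\<dots> = (\<integral>\<^sup>+z. (\<integral>\<^sup>+x. ennreal (k z) * ennreal (norm (f (x - z) - f x) ^ p) \<partial>lborel) \<partial>lborel)"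
    by (rule lborel_pair.Fubini') measurable
  also have "\<dots> = (\<integral>\<^sup>+z. ennreal (k z) * (\<integral>\<^sup>+x. ennreal (norm (f (x + (- z)) - f x) ^ p) \<partial>lborel) \<partial>lborel)"
    by (simp add: nn_integral_cmult)
  also have "\<dots> \<le> (\<integral>\<^sup>+z. ennreal (k z) * c \<partial>lborel)"
  proof (rule nn_integral_mono)
    fix z
    show "ennreal (k z) * (\<integral>\<^sup>+x. ennreal (norm (f (x + (- z)) - f x) ^ p) \<partial>lborel) \<le> ennreal (k z) * c"
    proof (cases "norm z < e")
      case True
      then show ?thesis using c[of "- z"] by (intro mult_left_mono) auto
    qed (use e[of z] in simp)
  qed
  also have "\<dots> = c" by (simp add: nn_integral_multc nk1)
  finally show ?thesis .
qed

text \<open>The exponent 1 yields almost everywhere convergence along a subsequence later on, the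
  exponent 2 the \<open>L^2\<close> limits; each rests on the continuity of translations in the same
  norm.\<close>

lemma mollify_tendsto:
  fixes f :: "'a::euclidean_space \<Rightarrow> 'b::euclidean_space"
  assumes k: "\<And>n. continuous_on UNIV (k n)" and e: "\<And>n z. norm z \<ge> e n \<Longrightarrow> k n z = 0"
    and nn: "\<And>n z. k n z \<ge> 0" and k1: "\<And>n. integral\<^sup>L lborel (k n) = 1" and f: "integrable lborel f"
    and p: "p = 1 \<or> p = 2" and f2: "p = 2 \<Longrightarrow> integrable lborel (\<lambda>x. (norm (f x))\<^sup>2)"
    and e0: "e \<longlonglongrightarrow> 0"
  shows "(\<lambda>n. \<integral>\<^sup>+x. ennreal (norm (mollify (k n) f x - f x) ^ p) \<partial>lborel) \<longlonglongrightarrow> 0"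
proof -
  define w where "w v = (\<integral>\<^sup>+x. ennreal (norm (f (x + v) - f x) ^ p) \<partial>lborel)" for v
  have wlim: "(\<lambda>n. w (h n)) \<longlonglongrightarrow> 0" if h: "h \<longlonglongrightarrow> 0" for h
  proof (cases "p = 2")
    case True
    then show ?thesis using translation_L2_tendsto[OF f f2 h] by (simp add: w_def)
  next
    case False
    have "w (h n) = ennreal (LBINT x. norm (f (x + h n) - f x))" for n
      unfolding w_def using False p f integrable_translate[OF f, of "h n"]
      by (simp, intro nn_integral_eq_integral) auto
    then show ?thesis using tendsto_ennrealI[OF translation_L1_tendsto[OF f h]] by simp
  qed
  show ?thesis
  proof (rule order_tendstoI)
    fix c :: ennreal assume "0 < c"
    then obtain c' where c': "0 < c'" "c' < c" using dense by blast
    \<comment> \<open>Continuity of translations is available along sequences; a sequence of bad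
      shifts of length below 1/(n+1) would contradict it, which gives a modulus.\<close>
    have "\<exists>d>0. \<forall>v. norm v < d \<longrightarrow> w v \<le> c'"
    proof (rule ccontr)
      assume "\<not> ?thesis"
      then have "\<forall>n. \<exists>v. norm v < 1 / real (Suc n) \<and> \<not> w v \<le> c'"
        by (metis of_nat_0_less_iff zero_less_Suc zero_less_divide_1_iff)
      then obtain h where h: "\<And>n. norm (h n) < 1 / real (Suc n)" "\<And>n. \<not> w (h n) \<le> c'" by metis
      have "h \<longlonglongrightarrow> 0"
        by (rule Lim_null_comparison[OF _ LIMSEQ_Suc[OF lim_inverse_n']]) (use h(1) in \<open>auto intro!: always_eventually less_imp_le\<close>)
      then have "\<forall>\<^sub>F n in sequentially. w (h n) < c'" using wlim c' by (intro order_tendstoD) auto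
      then show False using h(2) by (meson eventually_sequentially order.refl order.strict_implies_order)
    qed
    then obtain d where d: "d > 0" "\<And>v. norm v < d \<Longrightarrow> w v \<le> c'" by blast
    have "\<forall>\<^sub>F n in sequentially. e n < d" using e0 d by (intro order_tendstoD) auto
    then show "\<forall>\<^sub>F n in sequentially. (\<integral>\<^sup>+x. ennreal (norm (mollify (k n) f x - f x) ^ p) \<partial>lborel) < c"
    proof eventually_elim
      case (elim n)
      have "(\<integral>\<^sup>+x. ennreal (norm (mollify (k n) f x - f x) ^ p) \<partial>lborel) \<le> c'"
        using d(2) elim by (intro mollify_error[OF k e nn k1 f p]) (auto simp: w_def)
      then show ?case using c'(2) by (rule le_less_trans)
    qed
  qed simp
qed

text \<open>The definitions speak of Lebesgue measurable functions on a subset, whereas convolution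
  and the exchange of integrals are carried out for Borel functions on \<open>lborel\<close>. This
  lemma passes from the former to the latter.\<close>

lemma borel_version_exists:
  fixes f :: "'a::euclidean_space \<Rightarrow> real"
  assumes S: "S \<in> sets borel" and f: "f \<in> borel_measurable (lebesgue_on S)"
  obtains F where "F \<in> borel_measurable borel" "\<And>x. x \<notin> S \<Longrightarrow> F x = 0" "AE x in lborel. x \<in> S \<longrightarrow> f x = F x"
proof -
  have "(\<lambda>x. if x \<in> S then f x else 0) \<in> borel_measurable lebesgue"
    using f S by (simp add: borel_measurable_if)
  then obtain F where F: "F \<in> borel_measurable lborel" "AE x in lborel. (if x \<in> S then f x else 0) = F x"
    using completion_ex_borel_measurable_real by blast
  show ?thesis
  proof (rule that[of "\<lambda>x. indicator S x * F x"])
    show "(\<lambda>x. indicator S x * F x) \<in> borel_measurable borel" using F S by measurable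
    show "AE x in lborel. x \<in> S \<longrightarrow> f x = indicator S x * F x" using F(2) by eventually_elim auto
  qed auto
qed

lemma borel_version_integral:
  fixes q Q :: "'a::euclidean_space \<Rightarrow> real"
  assumes S: "S \<in> sets borel" and Q: "Q \<in> borel_measurable borel"
    and 0: "\<And>x. x \<notin> S \<Longrightarrow> Q x = 0" and ae: "AE x in lborel. x \<in> S \<longrightarrow> q x = Q x"
  shows "integral\<^sup>L (lebesgue_on S) q = integral\<^sup>L lborel Q"
    and "integrable (lebesgue_on S) q \<longleftrightarrow> integrable lborel Q"
proof -
  have SL: "S \<inter> space lebesgue \<in> sets lebesgue" using S by simp
  have Ql: "Q \<in> borel_measurable lebesgue" using Q by (intro measurable_completion) simp
  have ae': "AE x in lebesgue. indicator S x *\<^sub>R q x = Q x"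
    by (rule AE_completion, rule AE_mp[OF ae]) (use 0 in \<open>auto simp: indicator_def\<close>)
  \<comment> \<open>Lebesgue measure is complete, so agreeing almost everywhere with a Borel
    function makes \<open>q\<close> measurable on \<open>S\<close>.\<close>
  have m: "(\<lambda>x. indicator S x *\<^sub>R q x) \<in> borel_measurable lebesgue"
    by (rule borel_measurable_AE[OF Ql]) (use ae' in \<open>simp add: eq_commute\<close>)
  show "integral\<^sup>L (lebesgue_on S) q = integral\<^sup>L lborel Q"
    using integral_cong_AE[OF m Ql ae'] integral_restrict_space[OF SL, of q] integral_completion[of Q lborel] Q by simp
  show "integrable (lebesgue_on S) q \<longleftrightarrow> integrable lborel Q"
    using integrable_cong_AE[OF m Ql ae'] integrable_restrict_space[OF SL, of q] integrable_completion[of Q lborel] Q by simp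
qed

lemma AE_lebesgue_on_iff:
  fixes P :: "'a::euclidean_space \<Rightarrow> bool"
  assumes "S \<in> sets borel"
  shows "(AE x in lebesgue_on S. P x) \<longleftrightarrow> (AE x in lborel. x \<in> S \<longrightarrow> P x)"
  using assms by (subst AE_restrict_space_iff) (auto simp: AE_completion_iff)

subsection \<open>Weak derivatives\<close>

lemma mollifier_kernel_sequence:
  assumes d: "d > 0"
  obtains k :: "nat \<Rightarrow> real^'n::finite \<Rightarrow> real" and kg e where
    "\<And>n. C1_grad (k n) (kg n)" "\<And>n z. k n z \<ge> 0" "\<And>n z. k n (- z) = k n z"
    "\<And>n z. norm z \<ge> e n \<Longrightarrow> k n z = 0" "\<And>n. integral\<^sup>L lborel (k n) = 1"
    "\<And>n x. norm x + e n < 1 \<Longrightarrow> (\<lambda>y. k n (x - y)) \<in> test_functions (ball 0 1)"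
    "\<And>n. 0 < e n" "\<And>n. e n \<le> d" "e \<longlonglongrightarrow> 0"
proof -
  define e where "e n = d * (1 / real (Suc n))" for n
  have e: "0 < e n" "e n \<le> d" for n using d by (auto simp: e_def field_simps)
  have e0: "e \<longlonglongrightarrow> 0" using tendsto_mult[OF tendsto_const LIMSEQ_Suc[OF lim_inverse_n'], of d] by (simp add: e_def[abs_def])
  let ?P = "\<lambda>n (k :: real^'n \<Rightarrow> real) kg. C1_grad k kg \<and> (\<forall>z. k z \<ge> 0) \<and> (\<forall>z. k (- z) = k z)
    \<and> (\<forall>z. norm z \<ge> e n \<longrightarrow> k z = 0) \<and> integral\<^sup>L lborel k = 1
    \<and> (\<forall>x. norm x + e n < 1 \<longrightarrow> (\<lambda>y. k (x - y)) \<in> test_functions (ball 0 1))"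
  have "\<exists>k kg. ?P n k kg" for n
    by (rule mollifier_kernel_exists[OF e(1)[of n], where 'n='n]) blast
  then obtain k kg where "\<And>n. ?P n (k n) (kg n)" by metis
  then show ?thesis by (intro that[of k kg e] e e0) auto
qed

lemma test_function_C1_grad:
  assumes "\<phi> \<in> test_functions \<Omega>"
  shows "C1_grad \<phi> (\<lambda>x. \<chi> i. partial_deriv i \<phi> x)"
proof -
  have "Ck (Suc (Suc 0)) \<phi>" using assms by (simp only: test_functions_def) auto
  then have d: "\<And>x. \<phi> differentiable at x" and c: "\<And>i. continuous_on UNIV (partial_deriv i \<phi>)"
    by (auto intro!: continuous_at_imp_continuous_on differentiable_imp_continuous_within)
  have "(\<phi> has_derivative (\<lambda>h. (\<chi> i. partial_deriv i \<phi> x) \<bullet> h)) (at x)" for x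
  proof -
    have D: "(\<phi> has_derivative frechet_derivative \<phi> (at x)) (at x)"
      using d frechet_derivative_works by blast
    then have bl: "bounded_linear (frechet_derivative \<phi> (at x))" by (rule has_derivative_bounded_linear)
    have "frechet_derivative \<phi> (at x) h = (\<chi> i. partial_deriv i \<phi> x) \<bullet> h" for h
    proof -
      have "frechet_derivative \<phi> (at x) h = frechet_derivative \<phi> (at x) (\<Sum>i\<in>UNIV. h $ i *\<^sub>R axis i 1)"
        using basis_expansion[of h] by (simp add: scalar_mult_eq_scaleR)
      also have "\<dots> = (\<Sum>i\<in>UNIV. h $ i * partial_deriv i \<phi> x)"
        using bl by (simp add: linear_sum bounded_linear.linear linear_cmul partial_deriv_def)
      finally show ?thesis by (simp add: inner_vec_def mult.commute)
    qed
    then show ?thesis using D by (metis (no_types, lifting) ext)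
  qed
  then show ?thesis unfolding C1_grad_def using c by (auto intro!: continuous_on_vec_lambda)
qed

lemma test_function_support:
  assumes "\<phi> \<in> test_functions (ball 0 1)"
  obtains r where "0 < r" "r < 1" "\<And>x. norm x > r \<Longrightarrow> \<phi> x = 0"
proof (cases "closure {x. \<phi> x \<noteq> 0} = {}")
  case True
  then have "\<phi> x = 0" for x using closure_subset[of "{x. \<phi> x \<noteq> 0}"] by blast
  then show ?thesis using that[of "1/2"] by simp
next
  case False
  let ?K = "closure {x. \<phi> x \<noteq> 0}"
  have K: "compact ?K" "?K \<subseteq> ball 0 1" using assms by (auto simp: test_functions_def)
  obtain z where z: "z \<in> ?K" "\<And>x. x \<in> ?K \<Longrightarrow> norm x \<le> norm z"
    using continuous_attains_sup[OF K(1) False, of norm] by (auto intro: continuous_intros)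
  show ?thesis
  \<comment> \<open>The largest norm on the compact support is below 1; the maximum with 1/2 keeps
    the radius positive whatever \<open>z\<close> is.\<close>
  proof (rule that[of "max (norm z) (1/2)"])
    show "max (norm z) (1/2) < 1" using z K by auto
    fix x :: "real^'a" assume "norm x > max (norm z) (1/2)"
    then have "x \<notin> ?K" using z(2)[of x] by auto
    then show "\<phi> x = 0" using closure_subset[of "{x. \<phi> x \<noteq> 0}"] by blast
  qed auto
qed

lemma locally_integrable_ball_cball:
  assumes "locally_integrable (ball 0 1) f" "r < 1"
  shows "integrable (lebesgue_on (cball 0 r)) f"
proof -
  have "cball (0::real^'a) r \<subseteq> ball 0 1" using assms(2) by auto
  then show ?thesis using assms(1) compact_cball unfolding locally_integrable_def by blast
qed

lemma integral_lebesgue_on_support: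
  fixes q :: "'a::euclidean_space \<Rightarrow> real"
  assumes "T \<subseteq> S" "S \<in> sets borel" "T \<in> sets borel" "\<And>x. x \<notin> T \<Longrightarrow> q x = 0"
  shows "integral\<^sup>L (lebesgue_on S) q = integral\<^sup>L (lebesgue_on T) q"
    and "integrable (lebesgue_on S) q \<longleftrightarrow> integrable (lebesgue_on T) q"
proof -
  have "(\<lambda>x. indicator S x *\<^sub>R q x) = (\<lambda>x. indicator T x *\<^sub>R q x)"
    using assms by (auto simp: indicator_def fun_eq_iff)
  then show "integral\<^sup>L (lebesgue_on S) q = integral\<^sup>L (lebesgue_on T) q"
    "integrable (lebesgue_on S) q \<longleftrightarrow> integrable (lebesgue_on T) q"
    using assms by (simp_all add: integral_restrict_space integrable_restrict_space)
qed

lemma continuous_lebesgue_on_measurable: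
  fixes f :: "'a::euclidean_space \<Rightarrow> real"
  assumes "continuous_on UNIV f" "S \<in> sets borel"
  shows "f \<in> borel_measurable (lebesgue_on S)"
  using borel_measurable_continuous_onI[OF assms(1)]
  by (intro measurable_restrict_space1 measurable_completion) simp

text \<open>The fundamental lemma of the calculus of variations. Testing with translated kernels
  makes every mollification vanish on a smaller ball, and the mollifications converge in
  \<open>L^1\<close> to a function equal to \<open>f\<close> there.\<close>

lemma test_orthogonal_imp_AE_zero:
  fixes f :: "real^'n::finite \<Rightarrow> real"
  assumes li: "locally_integrable (ball 0 1) f"
    and z: "\<And>\<phi>. \<phi> \<in> test_functions (ball 0 1) \<Longrightarrow> (\<integral>x. f x * \<phi> x \<partial>lebesgue_on (ball 0 1)) = 0"
  shows "AE x in lebesgue_on (ball 0 1). f x = 0"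
proof -
  have key: "AE x in lborel. norm x \<le> r \<longrightarrow> f x = 0" if r: "r < 1" for r
  proof -
    \<comment> \<open>\<open>f\<close> is only locally integrable, so it is cut off at a radius
      \<open>r'\<close> below 1; kernels of radius at most \<open>r' - r\<close>, centred at points
      of norm at most \<open>r\<close>, never see the cut.\<close>
    define r' where "r' = (1 + r) / 2"
    have r': "r < r'" "r' < 1" using r by (auto simp: r'_def)
    have fi: "integrable (lebesgue_on (cball 0 r')) f" by (rule locally_integrable_ball_cball[OF li r'(2)])
    then have fm: "f \<in> borel_measurable (lebesgue_on (cball 0 r'))" by auto
    obtain F where F: "F \<in> borel_measurable borel" "\<And>x. x \<notin> cball 0 r' \<Longrightarrow> F x = 0"
      "AE x in lborel. x \<in> cball 0 r' \<longrightarrow> f x = F x"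
      by (rule borel_version_exists[OF _ fm]) auto
    note [measurable] = F(1)
    have [measurable]: "cball (0::real^'n) r \<in> sets borel" by simp
    have Fi: "integrable lborel F"
      using borel_version_integral(2)[OF _ F] fi by simp
    obtain k :: "nat \<Rightarrow> real^'n \<Rightarrow> real" and kg e where k: "\<And>n. C1_grad (k n) (kg n)" "\<And>n z. k n z \<ge> 0"
      "\<And>n z. norm z \<ge> e n \<Longrightarrow> k n z = 0" "\<And>n. integral\<^sup>L lborel (k n) = 1"
      "\<And>n x. norm x + e n < 1 \<Longrightarrow> (\<lambda>y. k n (x - y)) \<in> test_functions (ball 0 1)"
      "\<And>n. 0 < e n" "\<And>n. e n \<le> r' - r" "e \<longlonglongrightarrow> 0"
      by (rule mollifier_kernel_sequence[of "r' - r", where 'n='n]) (use r' in auto)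
    note kc = C1_grad_continuous[OF k(1)]
    have lim: "(\<lambda>n. \<integral>\<^sup>+x. ennreal (norm (mollify (k n) F x - F x) ^ 1) \<partial>lborel) \<longlonglongrightarrow> 0"
      by (rule mollify_tendsto[OF kc k(3) k(2) k(4) Fi _ _ k(8)]) auto
    have mz: "mollify (k n) F x = 0" if x: "norm x \<le> r" for n x
    proof -
      let ?\<phi> = "\<lambda>y. k n (x - y)"
      have "norm x + e n < 1" using x k(7)[of n] r' by simp
      then have "(\<integral>y. f y * ?\<phi> y \<partial>lebesgue_on (ball 0 1)) = 0" using z k(5) by blast
      moreover have "(\<integral>y. f y * ?\<phi> y \<partial>lebesgue_on (ball 0 1)) = (\<integral>y. f y * ?\<phi> y \<partial>lebesgue_on (cball 0 r'))"
      proof (rule integral_lebesgue_on_support(1))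
        fix y :: "real^'n" assume "y \<notin> cball 0 r'"
        then have "e n \<le> norm (x - y)"
          using x k(7)[of n] norm_triangle_ineq2[of y x] by (simp add: norm_minus_commute)
        then show "f y * ?\<phi> y = 0" using k(3) by simp
      qed (use r' in auto)
      moreover have "(\<integral>y. f y * ?\<phi> y \<partial>lebesgue_on (cball 0 r')) = (LBINT y. F y * ?\<phi> y)"
      proof (rule borel_version_integral(1))
        have "continuous_on UNIV ?\<phi>" by (intro continuous_on_compose2[OF kc] continuous_intros) auto
        then have [measurable]: "?\<phi> \<in> borel_measurable borel"
          by (auto intro: borel_measurable_continuous_onI)
        show "(\<lambda>y. F y * ?\<phi> y) \<in> borel_measurable borel" by measurable
        show "AE y in lborel. y \<in> cball 0 r' \<longrightarrow> f y * ?\<phi> y = F y * ?\<phi> y"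
          using F(3) by eventually_elim auto
      qed (use F in auto)
      ultimately show ?thesis by (simp add: mollify_def mult.commute)
    qed
    have "(\<integral>\<^sup>+x. indicator (cball 0 r) x * ennreal (norm (F x)) \<partial>lborel)
      \<le> (\<integral>\<^sup>+x. ennreal (norm (mollify (k n) F x - F x) ^ 1) \<partial>lborel)" for n
      by (rule nn_integral_mono) (auto simp: indicator_def mz)
    then have "(\<integral>\<^sup>+x. indicator (cball 0 r) x * ennreal (norm (F x)) \<partial>lborel) \<le> 0"
      using lim by (intro LIMSEQ_le_const) auto
    then have "AE x in lborel. indicator (cball 0 r) x * ennreal (norm (F x)) = 0"
      by (subst (asm) le_zero_eq, subst (asm) nn_integral_0_iff_AE) auto
    then show ?thesis using F(3)
      by eventually_elim (use r' in \<open>auto simp: indicator_def split: if_splits\<close>)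
  qed
  \<comment> \<open>Exhausting the open ball by countably many closed balls keeps the exceptional
    set null.\<close>
  have "AE x in lborel. \<forall>n::nat. norm x \<le> 1 - 1 / real (Suc n) \<longrightarrow> f x = 0"
    by (subst AE_all_countable, intro allI key) auto
  then have "AE x in lborel. x \<in> ball 0 1 \<longrightarrow> f x = 0"
  proof eventually_elim
    case (elim x)
    show ?case
    proof
      assume "x \<in> ball 0 1"
      then have "0 < 1 - norm x" by simp
      then obtain n where "1 / real (Suc n) < 1 - norm x" using nat_approx_posE by blast
      then show "f x = 0" using elim by (metis le_diff_eq less_eq_real_def add.commute)
    qed
  qed
  then show ?thesis by (simp add: AE_lebesgue_on_iff)
qed

lemma locally_integrable_test_integrable:
  fixes f :: "real^'n::finite \<Rightarrow> real"
  assumes li: "locally_integrable (ball 0 1) f" and \<phi>: "\<phi> \<in> test_functions (ball 0 1)"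
  shows "integrable (lebesgue_on (ball 0 1)) (\<lambda>x. f x * \<phi> x)"
proof -
  obtain r where r: "0 < r" "r < 1" "\<And>x. norm x > r \<Longrightarrow> \<phi> x = 0" using test_function_support[OF \<phi>] by blast
  have c: "continuous_on UNIV \<phi>" by (rule C1_grad_continuous[OF test_function_C1_grad[OF \<phi>]])
  obtain M where M: "M \<ge> 0" "\<And>x. norm (\<phi> x) \<le> M" using compact_support_bounded[OF c r(3)] by blast
  have fi: "integrable (lebesgue_on (cball 0 r)) f" by (rule locally_integrable_ball_cball[OF li r(2)])
  have "integrable (lebesgue_on (cball 0 r)) (\<lambda>x. f x * \<phi> x)"
  proof (rule Bochner_Integration.integrable_bound)
    show "integrable (lebesgue_on (cball 0 r)) (\<lambda>x. M * f x)" using fi by simp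
    show "(\<lambda>x. f x * \<phi> x) \<in> borel_measurable (lebesgue_on (cball 0 r))"
      using fi continuous_lebesgue_on_measurable[OF c] by (intro borel_measurable_times) auto
    show "AE x in lebesgue_on (cball 0 r). norm (f x * \<phi> x) \<le> norm (M * f x)"
      using M by (auto simp: abs_mult mult.commute[of M] intro!: AE_I2 mult_left_mono)
  qed
  then show ?thesis
    by (subst integral_lebesgue_on_support(2)[of "cball 0 r"]) (use r in auto)
qed

lemma weak_partial_unique:
  fixes u :: "real^'n::finite \<Rightarrow> real"
  assumes 1: "has_weak_partial (ball 0 1) i u g1" and 2: "has_weak_partial (ball 0 1) i u g2"
  shows "AE x in lebesgue_on (ball 0 1). g1 x = g2 x"
proof -
  have li: "locally_integrable (ball 0 1) g1" "locally_integrable (ball 0 1) g2"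
    using 1 2 by (auto simp: has_weak_partial_def)
  have "AE x in lebesgue_on (ball 0 1). g1 x - g2 x = 0"
  proof (rule test_orthogonal_imp_AE_zero)
    show "locally_integrable (ball 0 1) (\<lambda>x. g1 x - g2 x)" using li by (auto simp: locally_integrable_def)
    fix \<phi> :: "real^'n \<Rightarrow> real" assume \<phi>: "\<phi> \<in> test_functions (ball 0 1)"
    have "(\<integral>x. g1 x * \<phi> x \<partial>lebesgue_on (ball 0 1)) = (\<integral>x. g2 x * \<phi> x \<partial>lebesgue_on (ball 0 1))"
      using 1 2 \<phi> unfolding has_weak_partial_def by force
    then show "(\<integral>x. (g1 x - g2 x) * \<phi> x \<partial>lebesgue_on (ball 0 1)) = 0"
      using locally_integrable_test_integrable[OF li(1) \<phi>] locally_integrable_test_integrable[OF li(2) \<phi>]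
      by (simp add: left_diff_distrib)
  qed
  then show ?thesis by simp
qed

text \<open>\<open>weak_grad\<close> is a choice, so what is known of it comes from existence: the
  scalar weak partials are collected into one vector field as a witness.\<close>

lemma weak_grad_works:
  assumes "\<And>i. \<exists>g. has_weak_partial \<Omega> i u g"
  shows "has_weak_partial \<Omega> i u (\<lambda>x. weak_grad \<Omega> u x $ i)"
proof -
  obtain g where g: "\<And>i. has_weak_partial \<Omega> i u (g i)" using assms by metis
  have "\<forall>i. has_weak_partial \<Omega> i u (\<lambda>x. weak_grad \<Omega> u x $ i)"
    unfolding weak_grad_def by (rule someI[of _ "\<lambda>x. \<chi> i. g i x"]) (simp add: g)
  then show ?thesis by blast
qed

section \<open>Test functions as elements of \<open>W12_0\<close>\<close>

lemma continuous_compact_integrable_lebesgue_on: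
  fixes f :: "'a::euclidean_space \<Rightarrow> real"
  assumes "continuous_on UNIV f" "compact K"
  shows "integrable (lebesgue_on K) f"
proof -
  have K: "K \<in> sets borel" using assms(2) by (simp add: borel_compact)
  have "integrable lborel (\<lambda>x. indicator K x *\<^sub>R f x)"
    by (rule borel_integrable_compact[OF assms(2)]) (rule continuous_on_subset[OF assms(1)], simp)
  then show ?thesis
    by (subst borel_version_integral(2)[OF K, where Q = "\<lambda>x. indicator K x *\<^sub>R f x"])
       (use K borel_measurable_continuous_onI[OF assms(1)] in auto)
qed

lemma integral_lebesgue_on_continuous:
  fixes q :: "'a::euclidean_space \<Rightarrow> real"
  assumes "continuous_on UNIV q" "S \<in> sets borel" "\<And>x. x \<notin> S \<Longrightarrow> q x = 0"
  shows "integral\<^sup>L (lebesgue_on S) q = integral\<^sup>L lborel q"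
    and "integrable (lebesgue_on S) q \<longleftrightarrow> integrable lborel q"
  using borel_version_integral[OF assms(2)
      borel_measurable_continuous_onI[OF assms(1)] assms(3)] by auto

lemma continuous_partial_deriv:
  assumes "\<phi> \<in> test_functions \<Omega>"
  shows "continuous_on UNIV (partial_deriv i \<phi>)"
  using continuous_on_component[OF C1_grad_continuous_grad[OF test_function_C1_grad[OF assms]], of i] by simp

lemma test_function_partial_support:
  assumes \<phi>: "\<phi> \<in> test_functions \<Omega>" and R: "\<And>x. norm x > R \<Longrightarrow> \<phi> x = 0" and "norm x > R"
  shows "partial_deriv i \<phi> x = 0"
  using C1_grad_support_grad[OF test_function_C1_grad[OF \<phi>] R \<open>norm x > R\<close>] by (simp add: vec_eq_iff)

text \<open>The product of two test functions is \<open>C^1\<close> with compact support, so its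
  partial derivative has zero integral.\<close>

lemma test_function_weak_partial:
  fixes \<phi> :: "real^'n::finite \<Rightarrow> real"
  assumes \<phi>: "\<phi> \<in> test_functions (ball 0 1)"
  shows "has_weak_partial (ball 0 1) i \<phi> (partial_deriv i \<phi>)"
  unfolding has_weak_partial_def
proof (intro conjI ballI)
  have c: "continuous_on UNIV \<phi>" by (rule C1_grad_continuous[OF test_function_C1_grad[OF \<phi>]])
  show "locally_integrable (ball 0 1) \<phi>" "locally_integrable (ball 0 1) (partial_deriv i \<phi>)"
    using c continuous_partial_deriv[OF \<phi>]
    by (auto simp: locally_integrable_def intro: continuous_compact_integrable_lebesgue_on)
  fix \<psi> :: "real^'n \<Rightarrow> real" assume \<psi>: "\<psi> \<in> test_functions (ball 0 1)"
  have c': "continuous_on UNIV \<psi>" by (rule C1_grad_continuous[OF test_function_C1_grad[OF \<psi>]])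
  obtain r where r: "0 < r" "r < 1" "\<And>x. norm x > r \<Longrightarrow> \<phi> x = 0" using test_function_support[OF \<phi>] by blast
  have pr: "norm x > r \<Longrightarrow> partial_deriv i \<phi> x = 0" for x
    using test_function_partial_support[OF \<phi> r(3)] by blast
  have c1: "continuous_on UNIV (\<lambda>x. \<phi> x * partial_deriv i \<psi> x)" "continuous_on UNIV (\<lambda>x. partial_deriv i \<phi> x * \<psi> x)"
    using c c' continuous_partial_deriv[OF \<phi>] continuous_partial_deriv[OF \<psi>] by (auto intro!: continuous_on_mult)
  have i: "integrable lborel (\<lambda>x. \<phi> x * partial_deriv i \<psi> x)" "integrable lborel (\<lambda>x. partial_deriv i \<phi> x * \<psi> x)"
    by (rule compact_support_integrable[OF c1(1), of r], use r in simp)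
       (rule compact_support_integrable[OF c1(2), of r], use pr in simp)
  have "(LBINT x. (\<phi> x *\<^sub>R (\<chi> i. partial_deriv i \<psi> x) + \<psi> x *\<^sub>R (\<chi> i. partial_deriv i \<phi> x)) \<bullet> axis i 1) = 0"
    by (rule integral_grad_eq_0[OF C1_grad_mult[OF test_function_C1_grad[OF \<phi>] test_function_C1_grad[OF \<psi>]], of r])
       (use r in simp)
  then have "(LBINT x. \<phi> x * partial_deriv i \<psi> x + partial_deriv i \<phi> x * \<psi> x) = 0"
    by (simp add: inner_axis mult.commute)
  then have "(LBINT x. \<phi> x * partial_deriv i \<psi> x) = - (LBINT x. partial_deriv i \<phi> x * \<psi> x)"
    using i by simp
  moreover have "(\<integral>x. \<phi> x * partial_deriv i \<psi> x \<partial>lebesgue_on (ball 0 1)) = (LBINT x. \<phi> x * partial_deriv i \<psi> x)"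
    by (rule integral_lebesgue_on_continuous(1)[OF c1(1)]) (use r in auto)
  moreover have "(\<integral>x. partial_deriv i \<phi> x * \<psi> x \<partial>lebesgue_on (ball 0 1)) = (LBINT x. partial_deriv i \<phi> x * \<psi> x)"
    by (rule integral_lebesgue_on_continuous(1)[OF c1(2)]) (use r pr in auto)
  ultimately show "(\<integral>x. \<phi> x * partial_deriv i \<psi> x \<partial>lebesgue_on (ball 0 1))
    = - (\<integral>x. partial_deriv i \<phi> x * \<psi> x \<partial>lebesgue_on (ball 0 1))" by simp
qed

lemma weak_grad_unique:
  fixes u :: "real^'n::finite \<Rightarrow> real"
  assumes "\<And>i. has_weak_partial (ball 0 1) i u (g i)"
  shows "AE x in lebesgue_on (ball 0 1). weak_grad (ball 0 1) u x = (\<chi> i. g i x)"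
proof -
  have "AE x in lebesgue_on (ball 0 1). weak_grad (ball 0 1) u x $ i = g i x" for i
    using weak_partial_unique[OF weak_grad_works assms] assms by blast
  then have "AE x in lebesgue_on (ball 0 1). \<forall>i\<in>UNIV. weak_grad (ball 0 1) u x $ i = g i x"
    by (intro AE_finite_allI) auto
  then show ?thesis by eventually_elim (simp add: vec_eq_iff)
qed

text \<open>A test function approximates itself, but at distance zero only if the chosen weak
  gradient of the zero function vanishes almost everywhere; uniqueness of weak derivatives ensures
  this.\<close>

lemma test_function_W12_0:
  fixes \<phi> :: "real^'n::finite \<Rightarrow> real"
  assumes \<phi>: "\<phi> \<in> test_functions (ball 0 1)"
  shows "\<phi> \<in> W12_0 (ball 0 1)"
proof -
  have c: "continuous_on UNIV \<phi>" by (rule C1_grad_continuous[OF test_function_C1_grad[OF \<phi>]])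
  obtain r where r: "0 < r" "r < 1" "\<And>x. norm x > r \<Longrightarrow> \<phi> x = 0" using test_function_support[OF \<phi>] by blast
  have L: "q \<in> L2 (ball 0 1)" if q: "continuous_on UNIV q" "\<And>x. norm x > r \<Longrightarrow> q x = 0" for q :: "real^'n \<Rightarrow> real"
  proof -
    have c2: "continuous_on UNIV (\<lambda>x. (q x)\<^sup>2)" using q by (intro continuous_intros)
    have "integrable lborel (\<lambda>x. (q x)\<^sup>2)"
      by (rule compact_support_integrable[OF c2, of r]) (use q in simp)
    then have "integrable (lebesgue_on (ball 0 1)) (\<lambda>x. (q x)\<^sup>2)"
      by (subst integral_lebesgue_on_continuous(2)[OF c2]) (use q r in auto)
    then show ?thesis by (simp add: L2_def continuous_lebesgue_on_measurable[OF q(1)])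
  qed
  have W: "\<phi> \<in> W12 (ball 0 1)"
    unfolding W12_def
  proof (intro CollectI conjI allI)
    show "\<phi> \<in> L2 (ball 0 1)" by (rule L[OF c r(3)])
    show "\<exists>g\<in>L2 (ball 0 1). has_weak_partial (ball 0 1) i \<phi> g" for i
    proof (rule bexI)
      show "has_weak_partial (ball 0 1) i \<phi> (partial_deriv i \<phi>)" by (rule test_function_weak_partial[OF \<phi>])
      show "partial_deriv i \<phi> \<in> L2 (ball 0 1)"
        by (rule L[OF continuous_partial_deriv[OF \<phi>]]) (rule test_function_partial_support[OF \<phi> r(3)])
    qed
  qed
  have "has_weak_partial (ball 0 1) i (\<lambda>x::real^'n. 0) (\<lambda>x. 0)" for i
    by (simp add: has_weak_partial_def locally_integrable_def)
  then have ae: "AE x in lebesgue_on (ball 0 1). weak_grad (ball 0 1) (\<lambda>x::real^'n. 0) x = (\<chi> i. 0)"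
    by (rule weak_grad_unique)
  have "(\<integral>x. (norm (weak_grad (ball 0 1) (\<lambda>x::real^'n. 0) x))\<^sup>2 \<partial>lebesgue_on (ball 0 1)) = 0"
    by (rule integral_eq_zero_AE, rule AE_mp[OF ae]) (auto simp: zero_vec_def[symmetric])
  then have "W12_norm (ball 0 1) (\<lambda>x. \<phi> x - \<phi> x) = 0" by (simp add: W12_norm_def)
  then have "\<forall>\<epsilon>>0. \<exists>\<psi>\<in>test_functions (ball 0 1). W12_norm (ball 0 1) (\<lambda>x. \<phi> x - \<psi> x) < \<epsilon>"
    using \<phi> by (intro allI impI bexI[of _ \<phi>]) simp
  then show ?thesis using W unfolding W12_0_def by (intro CollectI conjI)
qed

text \<open>Insert \<open>A *v g\<close> into the condition on the inverse. Coercivity makes the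
  kernel trivial, so \<open>matrix_inv\<close>, itself a choice, is a genuine inverse. Bounding by
  the quadratic form rather than by |g|^2 keeps the energy constant linear in
  \<open>Lam / lam\<close>.\<close>

lemma elliptic_matrix_bound:
  fixes A :: "real^'n::finite^'n"
  assumes lam: "lam > 0" and Lam: "Lam > 0"
    and 1: "\<And>\<xi>. \<xi> \<bullet> (A *v \<xi>) \<ge> lam * (norm \<xi>)\<^sup>2" and 2: "\<And>\<xi>. \<xi> \<bullet> (matrix_inv A *v \<xi>) \<ge> inverse Lam * (norm \<xi>)\<^sup>2"
  shows "(norm (A *v g))\<^sup>2 \<le> Lam * (g \<bullet> (A *v g))"
proof -
  have "x = 0" if "A *v x = 0" for x
    using 1[of x] that lam by (simp add: mult_le_0_iff)
  then obtain B where "B ** A = mat 1" using matrix_left_invertible_ker by blast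
  then have "\<exists>A'. A ** A' = mat 1 \<and> A' ** A = mat 1" using matrix_left_right_inverse by blast
  then have "matrix_inv A ** A = mat 1" unfolding matrix_inv_def by (rule someI2_ex) simp
  then have "matrix_inv A *v (A *v g) = g" by (simp add: matrix_vector_mul_assoc)
  then have "inverse Lam * (norm (A *v g))\<^sup>2 \<le> g \<bullet> (A *v g)" using 2[of "A *v g"] by (simp add: inner_commute)
  then show ?thesis using Lam by (simp add: field_simps)
qed

section \<open>Reduction of the subsolution to Borel fields on the whole space\<close>

lemma borel_version_vec_exists:
  fixes f :: "'a::euclidean_space \<Rightarrow> real^'n::finite"
  assumes S: "S \<in> sets borel" and f: "\<And>i. (\<lambda>x. f x $ i) \<in> borel_measurable (lebesgue_on S)"
  obtains F :: "'a \<Rightarrow> real^'n" where "F \<in> borel_measurable borel" "\<And>x. x \<notin> S \<Longrightarrow> F x = 0"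
    "AE x in lborel. x \<in> S \<longrightarrow> f x = F x"
proof -
  have "\<exists>F. F \<in> borel_measurable borel \<and> (\<forall>x. x \<notin> S \<longrightarrow> F x = 0) \<and> (AE x in lborel. x \<in> S \<longrightarrow> f x $ i = F x)" for i
    using borel_version_exists[OF S f[of i]] by metis
  then obtain F where F: "\<And>i. F i \<in> borel_measurable borel" "\<And>i x. x \<notin> S \<Longrightarrow> F i x = 0"
    "\<And>i. AE x in lborel. x \<in> S \<longrightarrow> f x $ i = F i x" by metis
  show ?thesis
  proof (rule that[of "\<lambda>x. \<chi> i. F i x"])
    show "(\<lambda>x. \<chi> i. F i x) \<in> borel_measurable borel"
      using F(1) by (subst borel_measurable_euclidean_space) (auto simp: Basis_vec_def inner_axis)
    have "AE x in lborel. \<forall>i\<in>UNIV. x \<in> S \<longrightarrow> f x $ i = F i x" using F(3) by (intro AE_finite_allI) auto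
    then show "AE x in lborel. x \<in> S \<longrightarrow> f x = (\<chi> i. F i x)" by eventually_elim (auto simp: vec_eq_iff)
  qed (auto simp: F(2) vec_eq_iff)
qed

text \<open>What remains once \<open>a\<close> is forgotten: ellipticity has become a pointwise
  relation between \<open>G\<close> and \<open>H\<close>, so that \<open>H\<close> can be mollified
  as a field of its own. Extension by zero makes convolution meaningful everywhere.\<close>

locale divergence_subsolution =
  fixes U :: "real^'n::finite \<Rightarrow> real" and G H :: "real^'n \<Rightarrow> real^'n" and lam Lam :: real
  assumes U_borel [measurable]: "U \<in> borel_measurable borel"
    and G_borel [measurable]: "G \<in> borel_measurable borel"
    and H_borel [measurable]: "H \<in> borel_measurable borel"
    and U_out: "x \<notin> ball 0 1 \<Longrightarrow> U x = 0" and G_out: "x \<notin> ball 0 1 \<Longrightarrow> G x = 0" and H_out: "x \<notin> ball 0 1 \<Longrightarrow> H x = 0"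
    and U_L2: "integrable lborel (\<lambda>x. (U x)\<^sup>2)" and G_L2: "integrable lborel (\<lambda>x. (norm (G x))\<^sup>2)"
    and H_L2: "integrable lborel (\<lambda>x. (norm (H x))\<^sup>2)"
    and weak_gradient: "\<phi> \<in> test_functions (ball 0 1) \<Longrightarrow>
      (LBINT x. U x * partial_deriv i \<phi> x) = - (LBINT x. G x $ i * \<phi> x)"
    and subsolution: "\<phi> \<in> test_functions (ball 0 1) \<Longrightarrow> (\<And>x. \<phi> x \<ge> 0) \<Longrightarrow>
      (LBINT x. (\<chi> i. partial_deriv i \<phi> x) \<bullet> H x) \<le> 0"
    and ellipticity: "AE x in lborel. lam * (norm (G x))\<^sup>2 \<le> G x \<bullet> H x \<and> (norm (H x))\<^sup>2 \<le> Lam * (G x \<bullet> H x)"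
    and lam_pos: "0 < lam" and lam_le: "lam \<le> Lam"

lemma weak_subsolution_borel_data:
  fixes u :: "real^'n::finite \<Rightarrow> real"
  assumes ell: "elliptic_field (ball 0 1) a lam Lam" and sub: "weak_subsolution (ball 0 1) a u"
  obtains U G H where "divergence_subsolution U G H lam Lam" "AE x in lborel. x \<in> ball 0 1 \<longrightarrow> u x = U x"
proof -
  let ?B = "ball (0::real^'n) 1"
  have B: "?B \<in> sets borel" by simp
  have uW: "u \<in> W12 ?B" and subs: "\<And>\<phi>. \<phi> \<in> W12_0 ?B \<Longrightarrow> (AE x in lebesgue_on ?B. \<phi> x \<ge> 0) \<Longrightarrow> bilinear_form ?B a u \<phi> \<le> 0"
    using sub by (auto simp: weak_subsolution_def)
  have am: "a \<in> borel_measurable (lebesgue_on ?B)" and lam: "0 < lam" "lam \<le> Lam"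
    and ae: "AE x in lebesgue_on ?B. \<forall>\<xi>. \<xi> \<bullet> (a x *v \<xi>) \<ge> lam * (norm \<xi>)\<^sup>2 \<and>
        \<xi> \<bullet> (matrix_inv (a x) *v \<xi>) \<ge> inverse Lam * (norm \<xi>)\<^sup>2"
    using ell by (auto simp: elliptic_field_def)
  \<comment> \<open>The gradient is built from the square integrable components in the definition of
    \<open>W12\<close>; \<open>weak_grad\<close> agrees with them only almost everywhere.\<close>
  have "\<forall>i. \<exists>g. g \<in> L2 ?B \<and> has_weak_partial ?B i u g"
    using uW unfolding W12_def by blast
  then obtain g where "\<forall>i. g i \<in> L2 ?B \<and> has_weak_partial ?B i u (g i)" by (rule choice[THEN exE])
  then have g: "\<And>i. g i \<in> L2 ?B" "\<And>i. has_weak_partial ?B i u (g i)" by auto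
  have uL: "u \<in> L2 ?B" using uW by (simp add: W12_def)
  have gm: "(\<lambda>x. (\<chi> i. g i x) $ i) \<in> borel_measurable (lebesgue_on ?B)" for i using g(1)[of i] by (simp add: L2_def)
  obtain U where U: "U \<in> borel_measurable borel" "\<And>x. x \<notin> ?B \<Longrightarrow> U x = 0" "AE x in lborel. x \<in> ?B \<longrightarrow> u x = U x"
    using borel_version_exists[OF B, of u] uL unfolding L2_def by blast
  obtain G :: "real^'n \<Rightarrow> real^'n" where G: "G \<in> borel_measurable borel" "\<And>x. x \<notin> ?B \<Longrightarrow> G x = 0"
    "AE x in lborel. x \<in> ?B \<longrightarrow> (\<chi> i. g i x) = G x"
    using borel_version_vec_exists[OF B gm] by blast
  have hm: "(\<lambda>x. (a x *v (\<chi> i. g i x)) $ i) \<in> borel_measurable (lebesgue_on ?B)" for i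
  proof -
    have "(\<lambda>x. a x $ i $ j) \<in> borel_measurable (lebesgue_on ?B)" for j
      by (rule borel_measurable_continuous_on[OF _ am, of "\<lambda>M. M $ i $ j"]) (intro continuous_intros)
    then show ?thesis unfolding matrix_vector_mult_def using gm by (simp add: borel_measurable_sum borel_measurable_times)
  qed
  obtain H :: "real^'n \<Rightarrow> real^'n" where H: "H \<in> borel_measurable borel" "\<And>x. x \<notin> ?B \<Longrightarrow> H x = 0"
    "AE x in lborel. x \<in> ?B \<longrightarrow> a x *v (\<chi> i. g i x) = H x"
    using borel_version_vec_exists[OF B hm] by blast
  note [measurable] = U(1) G(1) H(1)
  have U2: "integrable lborel (\<lambda>x. (U x)\<^sup>2)"
  proof (subst borel_version_integral(2)[OF B, symmetric])
    show "integrable (lebesgue_on ?B) (\<lambda>x. (u x)\<^sup>2)"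
      using uL by (auto simp: L2_def)
    show "AE x in lborel. x \<in> ?B \<longrightarrow> (u x)\<^sup>2 = (U x)\<^sup>2" using U(3) by eventually_elim auto
  qed (use U in auto)
  have Gi2: "integrable lborel (\<lambda>x. (G x $ i)\<^sup>2)" for i
  proof (subst borel_version_integral(2)[OF B, symmetric])
    show "integrable (lebesgue_on ?B) (\<lambda>x. (g i x)\<^sup>2)"
      using g(1)[of i] by (auto simp: L2_def)
    show "AE x in lborel. x \<in> ?B \<longrightarrow> (g i x)\<^sup>2 = (G x $ i)\<^sup>2" using G(3) by eventually_elim (auto simp: vec_eq_iff)
    show "(\<lambda>x. (G x $ i)\<^sup>2) \<in> borel_measurable borel"
      by (intro borel_measurable_power borel_measurable_continuous_on[OF _ G(1), of "\<lambda>v. v $ i"] continuous_intros)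
  qed (use G in auto)
  have G2: "integrable lborel (\<lambda>x. (norm (G x))\<^sup>2)"
    using Gi2 by (simp add: norm_vec_def L2_set_def sum_nonneg)
  have ae': "AE x in lborel. x \<in> ?B \<longrightarrow> (\<forall>\<xi>. \<xi> \<bullet> (a x *v \<xi>) \<ge> lam * (norm \<xi>)\<^sup>2 \<and>
        \<xi> \<bullet> (matrix_inv (a x) *v \<xi>) \<ge> inverse Lam * (norm \<xi>)\<^sup>2)"
    using ae by (simp add: AE_lebesgue_on_iff[OF B])
  have GH: "AE x in lborel. lam * (norm (G x))\<^sup>2 \<le> G x \<bullet> H x \<and> (norm (H x))\<^sup>2 \<le> Lam * (G x \<bullet> H x)"
    using ae' G(3) H(3)
  proof eventually_elim
    case (elim x)
    show ?case
    proof (cases "x \<in> ?B")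
      case True
      then have h: "H x = a x *v G x" using elim by auto
      have Lp: "Lam > 0" using lam by simp
      show ?thesis unfolding h using elim(1) True elliptic_matrix_bound[OF lam(1) Lp, of "a x" "G x"] by auto
    qed (simp add: G(2) H(2))
  qed
  \<comment> \<open>Cauchy-Schwarz in |H|^2 <= Lam G.H, cancelling one factor |H|; this gives the
    square integrability of \<open>H\<close>.\<close>
  have Hb: "AE x in lborel. (norm (H x))\<^sup>2 \<le> Lam\<^sup>2 * (norm (G x))\<^sup>2"
    using GH
  proof eventually_elim
    case (elim x)
    have Lp: "Lam > 0" using lam by simp
    have "(norm (H x))\<^sup>2 \<le> Lam * (norm (G x) * norm (H x))"
      using elim Lp by (meson Cauchy_Schwarz_ineq2 abs_ge_self mult_left_mono order_trans less_imp_le)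
    then have "norm (H x) \<le> Lam * norm (G x)"
      using Lp by (cases "norm (H x) = 0") (auto simp: power2_eq_square)
    then have "(norm (H x))\<^sup>2 \<le> (Lam * norm (G x))\<^sup>2" by (intro power_mono) auto
    then show ?case by (simp add: power_mult_distrib)
  qed
  have H2: "integrable lborel (\<lambda>x. (norm (H x))\<^sup>2)"
  proof (rule Bochner_Integration.integrable_bound)
    show "integrable lborel (\<lambda>x. Lam\<^sup>2 * (norm (G x))\<^sup>2)" using G2 by simp
    show "AE x in lborel. norm ((norm (H x))\<^sup>2) \<le> norm (Lam\<^sup>2 * (norm (G x))\<^sup>2)"
      using Hb by eventually_elim simp
  qed measurable
  \<comment> \<open>\<open>bilinear_form\<close> is written with the chosen
    \<open>weak_grad\<close>; uniqueness replaces it by the components from which \<open>G\<close>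
    and \<open>H\<close> were built.\<close>
  have wu: "AE x in lborel. x \<in> ?B \<longrightarrow> weak_grad ?B u x = (\<chi> i. g i x)"
    using weak_grad_unique[of u g, OF g(2)] by (simp add: AE_lebesgue_on_iff[OF B])
  show ?thesis
  proof (rule that[OF divergence_subsolution.intro[OF U(1) G(1) H(1) U(2) G(2) H(2) U2 G2 H2 _ _ GH lam] U(3)])
    fix \<phi> :: "real^'n \<Rightarrow> real" and i assume \<phi>: "\<phi> \<in> test_functions ?B"
    have cp: "continuous_on UNIV (partial_deriv i \<phi>)" "continuous_on UNIV \<phi>"
      using continuous_partial_deriv[OF \<phi>] C1_grad_continuous[OF test_function_C1_grad[OF \<phi>]] by auto
    note [measurable] = cp[THEN borel_measurable_continuous_onI]
    have "(\<integral>x. u x * partial_deriv i \<phi> x \<partial>lebesgue_on ?B) = (LBINT x. U x * partial_deriv i \<phi> x)"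
    proof (rule borel_version_integral(1)[OF B])
      show "AE x in lborel. x \<in> ?B \<longrightarrow> u x * partial_deriv i \<phi> x = U x * partial_deriv i \<phi> x"
        using U(3) by eventually_elim auto
    qed (use U in auto)
    moreover have "(\<integral>x. g i x * \<phi> x \<partial>lebesgue_on ?B) = (LBINT x. G x $ i * \<phi> x)"
    proof (rule borel_version_integral(1)[OF B])
      show "AE x in lborel. x \<in> ?B \<longrightarrow> g i x * \<phi> x = G x $ i * \<phi> x"
        using G(3) by eventually_elim (auto simp: vec_eq_iff)
      have "(\<lambda>x. G x $ i) \<in> borel_measurable borel"
        by (intro borel_measurable_continuous_on[OF _ G(1), of "\<lambda>v. v $ i"] continuous_intros)
      then show "(\<lambda>x. G x $ i * \<phi> x) \<in> borel_measurable borel" by measurable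
    qed (use G in auto)
    ultimately show "(LBINT x. U x * partial_deriv i \<phi> x) = - (LBINT x. G x $ i * \<phi> x)"
      using g(2)[of i] \<phi> unfolding has_weak_partial_def by force
  next
    fix \<phi> :: "real^'n \<Rightarrow> real" assume \<phi>: "\<phi> \<in> test_functions ?B" and nn: "\<And>x. \<phi> x \<ge> 0"
    have cg: "continuous_on UNIV (\<lambda>x. \<chi> i. partial_deriv i \<phi> x)"
      by (rule C1_grad_continuous_grad[OF test_function_C1_grad[OF \<phi>]])
    note [measurable] = borel_measurable_continuous_onI[OF cg]
    have w\<phi>: "AE x in lborel. x \<in> ?B \<longrightarrow> weak_grad ?B \<phi> x = (\<chi> i. partial_deriv i \<phi> x)"
      using weak_grad_unique[of \<phi> "\<lambda>i. partial_deriv i \<phi>", OF test_function_weak_partial[OF \<phi>]]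
      by (simp add: AE_lebesgue_on_iff[OF B])
    have "bilinear_form ?B a u \<phi> = (LBINT x. (\<chi> i. partial_deriv i \<phi> x) \<bullet> H x)"
      unfolding bilinear_form_def
    proof (rule borel_version_integral(1)[OF B])
      show "AE x in lborel. x \<in> ?B \<longrightarrow> weak_grad ?B \<phi> x \<bullet> (a x *v weak_grad ?B u x) = (\<chi> i. partial_deriv i \<phi> x) \<bullet> H x"
        using w\<phi> wu H(3) by eventually_elim auto
    qed (use H in auto)
    then show "(LBINT x. (\<chi> i. partial_deriv i \<phi> x) \<bullet> H x) \<le> 0"
      using subs[OF test_function_W12_0[OF \<phi>]] nn by simp
  qed
qed

subsection \<open>Convergence in \<open>L\<^sup>2\<close>\<close>

lemma L2_inner_integrable:
  fixes f g :: "'a \<Rightarrow> 'b::euclidean_space"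
  assumes [measurable]: "f \<in> borel_measurable M" "g \<in> borel_measurable M"
    and f: "integrable M (\<lambda>x. (norm (f x))\<^sup>2)" and g: "integrable M (\<lambda>x. (norm (g x))\<^sup>2)"
  shows "integrable M (\<lambda>x. norm (f x) * norm (g x))" "integrable M (\<lambda>x. f x \<bullet> g x)"
proof -
  have s: "integrable M (\<lambda>x. (norm (f x))\<^sup>2 + (norm (g x))\<^sup>2)" using f g by simp
  show 1: "integrable M (\<lambda>x. norm (f x) * norm (g x))"
  proof (rule Bochner_Integration.integrable_bound[OF s])
    show "AE x in M. norm (norm (f x) * norm (g x)) \<le> norm ((norm (f x))\<^sup>2 + (norm (g x))\<^sup>2)"
    proof (rule AE_I2)
      fix x
      have "2 * (norm (f x) * norm (g x)) \<le> (norm (f x))\<^sup>2 + (norm (g x))\<^sup>2"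
        using sum_squares_bound[of "norm (f x)" "norm (g x)"] by simp
      moreover have "0 \<le> norm (f x) * norm (g x)" by simp
      ultimately show "norm (norm (f x) * norm (g x)) \<le> norm ((norm (f x))\<^sup>2 + (norm (g x))\<^sup>2)"
        by (simp only: real_norm_def)
    qed
  qed simp
  show "integrable M (\<lambda>x. f x \<bullet> g x)"
    by (rule Bochner_Integration.integrable_bound[OF 1]) (auto simp: Cauchy_Schwarz_ineq2)
qed

lemma L2_Cauchy_Schwarz:
  fixes f g :: "'a \<Rightarrow> 'b::euclidean_space"
  assumes [measurable]: "f \<in> borel_measurable M" "g \<in> borel_measurable M"
    and f: "integrable M (\<lambda>x. (norm (f x))\<^sup>2)" and g: "integrable M (\<lambda>x. (norm (g x))\<^sup>2)"
  shows "(\<integral>x. norm (f x) * norm (g x) \<partial>M) \<le> sqrt (\<integral>x. (norm (f x))\<^sup>2 \<partial>M) * sqrt (\<integral>x. (norm (g x))\<^sup>2 \<partial>M)"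
proof -
  let ?I = "\<integral>x. norm (f x) * norm (g x) \<partial>M"
  note i = L2_inner_integrable(1)[OF assms]
  have "(\<integral>\<^sup>+x. ennreal (norm (f x)) * ennreal (norm (g x)) \<partial>M)\<^sup>2
    \<le> (\<integral>\<^sup>+x. (ennreal (norm (f x)))\<^sup>2 \<partial>M) * (\<integral>\<^sup>+x. (ennreal (norm (g x)))\<^sup>2 \<partial>M)"
    by (rule Cauchy_Schwarz_nn_integral) measurable
  also have "(\<integral>\<^sup>+x. ennreal (norm (f x)) * ennreal (norm (g x)) \<partial>M) = ennreal ?I"
    using nn_integral_eq_integral[OF i] by (simp add: ennreal_mult)
  also have "(\<integral>\<^sup>+x. (ennreal (norm (f x)))\<^sup>2 \<partial>M) = ennreal (\<integral>x. (norm (f x))\<^sup>2 \<partial>M)"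
    using nn_integral_eq_integral[OF f] by (simp add: ennreal_power)
  also have "(\<integral>\<^sup>+x. (ennreal (norm (g x)))\<^sup>2 \<partial>M) = ennreal (\<integral>x. (norm (g x))\<^sup>2 \<partial>M)"
    using nn_integral_eq_integral[OF g] by (simp add: ennreal_power)
  finally have "?I\<^sup>2 \<le> (\<integral>x. (norm (f x))\<^sup>2 \<partial>M) * (\<integral>x. (norm (g x))\<^sup>2 \<partial>M)"
    by (simp add: ennreal_power flip: ennreal_mult)
  then show ?thesis by (simp add: real_le_rsqrt flip: real_sqrt_mult)
qed

lemma L2_norm_diff_integrable:
  fixes f g :: "'a \<Rightarrow> 'b::euclidean_space"
  assumes [measurable]: "f \<in> borel_measurable M" "g \<in> borel_measurable M"
    and f: "integrable M (\<lambda>x. (norm (f x))\<^sup>2)" and g: "integrable M (\<lambda>x. (norm (g x))\<^sup>2)"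
  shows "integrable M (\<lambda>x. (norm (f x - g x))\<^sup>2)"
proof -
  have "(\<lambda>x. (norm (f x - g x))\<^sup>2) = (\<lambda>x. (norm (f x))\<^sup>2 + (norm (g x))\<^sup>2 - 2 * (f x \<bullet> g x))"
    by (auto simp: fun_eq_iff power2_norm_eq_inner inner_diff_left inner_diff_right inner_commute)
  then show ?thesis using f g L2_inner_integrable(2)[OF assms] by simp
qed

text \<open>Expand around the limits: each of the three error terms contains a factor tending to
  zero in \<open>L^2\<close> and is handled by Cauchy-Schwarz and the bound on the multiplier.
  Almost everywhere convergence of the multiplier suffices against the fixed integrable function
  \<open>a . b\<close>.\<close>

lemma L2_product_tendsto:
  fixes a b :: "'a \<Rightarrow> 'b::euclidean_space"
  assumes [measurable]: "\<And>n. an n \<in> borel_measurable M" "\<And>n. bn n \<in> borel_measurable M"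
      "a \<in> borel_measurable M" "b \<in> borel_measurable M" "\<And>n. mn n \<in> borel_measurable M" "m \<in> borel_measurable M"
    and an2: "\<And>n. integrable M (\<lambda>x. (norm (an n x))\<^sup>2)" and bn2: "\<And>n. integrable M (\<lambda>x. (norm (bn n x))\<^sup>2)"
    and a2: "integrable M (\<lambda>x. (norm (a x))\<^sup>2)" and b2: "integrable M (\<lambda>x. (norm (b x))\<^sup>2)"
    and al: "(\<lambda>n. \<integral>x. (norm (an n x - a x))\<^sup>2 \<partial>M) \<longlonglongrightarrow> 0" and bl: "(\<lambda>n. \<integral>x. (norm (bn n x - b x))\<^sup>2 \<partial>M) \<longlonglongrightarrow> 0"
    and C: "\<And>n x. \<bar>mn n x\<bar> \<le> C" and ml: "AE x in M. (\<lambda>n. mn n x) \<longlonglongrightarrow> m x"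
  shows "(\<lambda>n. \<integral>x. mn n x * (an n x \<bullet> bn n x) \<partial>M) \<longlonglongrightarrow> (\<integral>x. m x * (a x \<bullet> b x) \<partial>M)"
proof -
  note ab = L2_inner_integrable(2)[OF assms(3,4) a2 b2]
  note abn = L2_inner_integrable(2)[OF assms(1,2) an2 bn2]
  note da = L2_norm_diff_integrable[OF assms(1,3) an2 a2] and db = L2_norm_diff_integrable[OF assms(2,4) bn2 b2]
  have md: "(\<lambda>x. an n x - a x) \<in> borel_measurable M" "(\<lambda>x. bn n x - b x) \<in> borel_measurable M" for n by measurable
  have mi: "integrable M (\<lambda>x. mn n x * (f x \<bullet> g x))" if "integrable M (\<lambda>x. f x \<bullet> g x)" for n and f g :: "'a \<Rightarrow> 'b"
  proof (rule Bochner_Integration.integrable_bound)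
    show "integrable M (\<lambda>x. C * (f x \<bullet> g x))" using that by simp
    have "(\<lambda>x. f x \<bullet> g x) \<in> borel_measurable M" using that by auto
    then show "(\<lambda>x. mn n x * (f x \<bullet> g x)) \<in> borel_measurable M" by measurable
    have "\<bar>mn n x\<bar> \<le> \<bar>C\<bar>" for x using C[of n x] by linarith
    then show "AE x in M. norm (mn n x * (f x \<bullet> g x)) \<le> norm (C * (f x \<bullet> g x))"
      by (auto simp: abs_mult intro!: AE_I2 mult_right_mono)
  qed
  have l1: "(\<lambda>n. \<integral>x. mn n x * (a x \<bullet> b x) \<partial>M) \<longlonglongrightarrow> (\<integral>x. m x * (a x \<bullet> b x) \<partial>M)"
  proof (rule integral_dominated_convergence[where w = "\<lambda>x. \<bar>C\<bar> * \<bar>a x \<bullet> b x\<bar>"])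
    show "AE x in M. (\<lambda>n. mn n x * (a x \<bullet> b x)) \<longlonglongrightarrow> m x * (a x \<bullet> b x)"
      using ml by eventually_elim (intro tendsto_intros)
    have "\<bar>mn n x\<bar> \<le> \<bar>C\<bar>" for n x using C[of n x] by linarith
    then show "AE x in M. norm (mn n x * (a x \<bullet> b x)) \<le> \<bar>C\<bar> * \<bar>a x \<bullet> b x\<bar>" for n
      by (auto simp: abs_mult intro!: AE_I2 mult_right_mono)
  qed (use ab in auto)
  have bound: "norm ((\<integral>x. mn n x * (an n x \<bullet> bn n x) \<partial>M) - (\<integral>x. mn n x * (a x \<bullet> b x) \<partial>M))
    \<le> \<bar>C\<bar> * (sqrt (\<integral>x. (norm (an n x - a x))\<^sup>2 \<partial>M) * sqrt (\<integral>x. (norm (bn n x - b x))\<^sup>2 \<partial>M)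
       + sqrt (\<integral>x. (norm (a x))\<^sup>2 \<partial>M) * sqrt (\<integral>x. (norm (bn n x - b x))\<^sup>2 \<partial>M)
       + sqrt (\<integral>x. (norm (an n x - a x))\<^sup>2 \<partial>M) * sqrt (\<integral>x. (norm (b x))\<^sup>2 \<partial>M))" for n
  proof -
    note i1 = L2_inner_integrable(1)[OF md da db, of n n] and i2 = L2_inner_integrable(1)[OF assms(3) md(2) a2 db, of n]
      and i3 = L2_inner_integrable(1)[OF md(1) assms(4) da b2, of n]
    have "(\<integral>x. mn n x * (an n x \<bullet> bn n x) \<partial>M) - (\<integral>x. mn n x * (a x \<bullet> b x) \<partial>M)
      = (\<integral>x. mn n x * (an n x \<bullet> bn n x) - mn n x * (a x \<bullet> b x) \<partial>M)"
      using mi[OF ab] mi[OF abn] by simp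
    also have "norm \<dots> \<le> (\<integral>x. norm (mn n x * (an n x \<bullet> bn n x) - mn n x * (a x \<bullet> b x)) \<partial>M)" by (rule integral_norm_bound)
    also have "\<dots> \<le> (\<integral>x. \<bar>C\<bar> * (norm (an n x - a x) * norm (bn n x - b x) + norm (a x) * norm (bn n x - b x)
        + norm (an n x - a x) * norm (b x)) \<partial>M)"
    proof (rule integral_mono)
      fix x
      have "mn n x * (an n x \<bullet> bn n x) - mn n x * (a x \<bullet> b x) = mn n x * ((an n x - a x) \<bullet> (bn n x - b x)
         + a x \<bullet> (bn n x - b x) + (an n x - a x) \<bullet> b x)"
        by (simp add: inner_diff_left inner_diff_right algebra_simps)
      also have "norm \<dots> = \<bar>mn n x\<bar> * \<bar>(an n x - a x) \<bullet> (bn n x - b x) + a x \<bullet> (bn n x - b x) + (an n x - a x) \<bullet> b x\<bar>"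
        by (simp add: abs_mult)
      also have "\<dots> \<le> \<bar>C\<bar> * (norm (an n x - a x) * norm (bn n x - b x) + norm (a x) * norm (bn n x - b x)
        + norm (an n x - a x) * norm (b x))"
      proof (rule mult_mono)
        show "\<bar>mn n x\<bar> \<le> \<bar>C\<bar>" using C[of n x] by linarith
        show "\<bar>(an n x - a x) \<bullet> (bn n x - b x) + a x \<bullet> (bn n x - b x) + (an n x - a x) \<bullet> b x\<bar>
          \<le> norm (an n x - a x) * norm (bn n x - b x) + norm (a x) * norm (bn n x - b x) + norm (an n x - a x) * norm (b x)"
          using Cauchy_Schwarz_ineq2[of "an n x - a x" "bn n x - b x"] Cauchy_Schwarz_ineq2[of "a x" "bn n x - b x"]
            Cauchy_Schwarz_ineq2[of "an n x - a x" "b x"] by linarith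
      qed auto
      finally show "norm (mn n x * (an n x \<bullet> bn n x) - mn n x * (a x \<bullet> b x)) \<le> \<bar>C\<bar> * (norm (an n x - a x) * norm (bn n x - b x) + norm (a x) * norm (bn n x - b x)
        + norm (an n x - a x) * norm (b x))" .
    qed (use mi[OF ab] mi[OF abn] i1 i2 i3 in auto)
    also have "\<dots> = \<bar>C\<bar> * ((\<integral>x. norm (an n x - a x) * norm (bn n x - b x) \<partial>M) + (\<integral>x. norm (a x) * norm (bn n x - b x) \<partial>M)
        + (\<integral>x. norm (an n x - a x) * norm (b x) \<partial>M))"
      using i1 i2 i3 by simp
    also have "\<dots> \<le> \<bar>C\<bar> * (sqrt (\<integral>x. (norm (an n x - a x))\<^sup>2 \<partial>M) * sqrt (\<integral>x. (norm (bn n x - b x))\<^sup>2 \<partial>M)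
       + sqrt (\<integral>x. (norm (a x))\<^sup>2 \<partial>M) * sqrt (\<integral>x. (norm (bn n x - b x))\<^sup>2 \<partial>M)
       + sqrt (\<integral>x. (norm (an n x - a x))\<^sup>2 \<partial>M) * sqrt (\<integral>x. (norm (b x))\<^sup>2 \<partial>M))"
      by (intro mult_left_mono add_mono L2_Cauchy_Schwarz md da db a2 b2) auto
    finally show ?thesis .
  qed
  have "(\<lambda>n. \<bar>C\<bar> * (sqrt (\<integral>x. (norm (an n x - a x))\<^sup>2 \<partial>M) * sqrt (\<integral>x. (norm (bn n x - b x))\<^sup>2 \<partial>M)
       + sqrt (\<integral>x. (norm (a x))\<^sup>2 \<partial>M) * sqrt (\<integral>x. (norm (bn n x - b x))\<^sup>2 \<partial>M)
       + sqrt (\<integral>x. (norm (an n x - a x))\<^sup>2 \<partial>M) * sqrt (\<integral>x. (norm (b x))\<^sup>2 \<partial>M)))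
     \<longlonglongrightarrow> \<bar>C\<bar> * (sqrt 0 * sqrt 0 + sqrt (\<integral>x. (norm (a x))\<^sup>2 \<partial>M) * sqrt 0 + sqrt 0 * sqrt (\<integral>x. (norm (b x))\<^sup>2 \<partial>M))"
    by (intro tendsto_intros al bl)
  then have "(\<lambda>n. (\<integral>x. mn n x * (an n x \<bullet> bn n x) \<partial>M) - (\<integral>x. mn n x * (a x \<bullet> b x) \<partial>M)) \<longlonglongrightarrow> 0"
    by (intro Lim_null_comparison[OF always_eventually, OF allI, OF bound]) simp
  from tendsto_add[OF this l1] show ?thesis by simp
qed

lemma mollify_continuous:
  fixes f :: "'a::euclidean_space \<Rightarrow> 'b::euclidean_space"
  assumes k: "continuous_on UNIV k" and R: "\<And>x. norm x > R \<Longrightarrow> k x = 0" and f: "integrable lborel f"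
  shows "continuous_on UNIV (mollify k f)"
proof (rule continuous_on_componentwise[THEN iffD2], rule ballI)
  fix b :: 'b assume "b \<in> Basis"
  have "continuous_on UNIV (\<lambda>x. LBINT y. (f y \<bullet> b) *\<^sub>R k (x - y))"
    by (rule convolution_continuous(2)[OF k R]) (use f in auto)
  then show "continuous_on UNIV (\<lambda>x. mollify k f x \<bullet> b)"
    by (subst mollify_inner[OF k R f]) (simp_all add: mollify_def mult.commute)
qed

lemma mollify_support:
  fixes f :: "'a::euclidean_space \<Rightarrow> 'b::euclidean_space"
  assumes "\<And>z. norm z \<ge> e \<Longrightarrow> k z = 0" "\<And>x. norm x > r \<Longrightarrow> f x = 0" "norm x > r + e"
  shows "mollify k f x = 0"
proof -
  have "k (x - y) *\<^sub>R f y = 0" for y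
    using assms(1)[of "x - y"] assms(2)[of y] assms(3) norm_triangle_sub[of x y] by (cases "norm y > r") auto
  then show ?thesis unfolding mollify_def by (simp only: integral_zero)
qed

text \<open>Serves the limit in translated functions, where convergence is needed both at
  \<open>x\<close> and at \<open>x + h\<close>.\<close>

lemma AE_translate:
  fixes P :: "'a::euclidean_space \<Rightarrow> bool"
  assumes "AE x in lborel. P x"
  shows "AE x in lborel. P (x + h)"
proof -
  obtain N where N: "{x. \<not> P x} \<subseteq> N" "emeasure lborel N = 0" "N \<in> sets borel"
    using AE_E[OF assms] by auto
  have "AE x in distr lborel borel (\<lambda>x. x + h). x \<notin> N"
    unfolding lborel_distr_plus' using N by (intro AE_not_in) (auto simp: null_sets_def)
  then have "AE x in lborel. x + h \<notin> N" using N by (subst (asm) AE_distr_iff) auto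
  then show ?thesis by eventually_elim (use N in auto)
qed

text \<open>On a set of finite measure, t <= t^2 + 1 turns square integrability into
  integrability.\<close>

lemma L2_bounded_support_integrable:
  fixes f :: "'a::euclidean_space \<Rightarrow> 'b::euclidean_space"
  assumes [measurable]: "f \<in> borel_measurable borel" and "integrable lborel (\<lambda>x. (norm (f x))\<^sup>2)"
    and "\<And>x. x \<notin> ball 0 1 \<Longrightarrow> f x = 0"
  shows "integrable lborel f"
proof (rule Bochner_Integration.integrable_bound)
  have "integrable lborel (\<lambda>x::'a. indicator (cball 0 1) x *\<^sub>R (1::real))"
    by (rule borel_integrable_compact) auto
  then show "integrable lborel (\<lambda>x. (norm (f x))\<^sup>2 + indicator (cball 0 1) x *\<^sub>R (1::real))" using assms(2) by simp
  show "AE x in lborel. norm (f x) \<le> norm ((norm (f x))\<^sup>2 + indicator (cball 0 1) x *\<^sub>R (1::real))"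
  proof (rule AE_I2)
    fix x
    have "norm (f x) \<le> (norm (f x))\<^sup>2 + 1" using sum_squares_bound[of "norm (f x)" 1] by (smt (verit) norm_ge_zero one_power2 mult.right_neutral)
    then show "norm (f x) \<le> norm ((norm (f x))\<^sup>2 + indicator (cball 0 1) x *\<^sub>R (1::real))"
      using assms(3)[of x] by (cases "x \<in> ball 0 1") (auto simp: indicator_def)
  qed
qed simp

subsection \<open>Mollified subsolutions\<close>

context divergence_subsolution
begin

lemma U_int: "integrable lborel U"
  using L2_bounded_support_integrable[OF U_borel] U_L2 U_out by simp

lemma G_int: "integrable lborel G"
  by (rule L2_bounded_support_integrable[OF G_borel G_L2 G_out])

lemma H_int: "integrable lborel H"
  by (rule L2_bounded_support_integrable[OF H_borel H_L2 H_out])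

lemma component_int:
  assumes "integrable lborel (f :: real^'n \<Rightarrow> real^'n)"
  shows "integrable lborel (\<lambda>y. f y $ i)"
  using integrable_inner_left[OF assms, of "axis i 1"] by (simp add: inner_axis)

text \<open>Translates of the kernel are admissible in the weak formulation. Their partial
  derivatives in y carry a minus sign, which turns the weak definition of \<open>G\<close> into the
  gradient of the mollified \<open>U\<close>, and the subsolution inequality into a nonnegative
  divergence of the mollified \<open>H\<close>.\<close>

lemma mollified_gradient:
  assumes C: "C1_grad k kg" and e: "\<And>z. norm z \<ge> e \<Longrightarrow> k z = 0" and nn: "\<And>z. k z \<ge> 0"
    and test: "(\<lambda>y. k (x - y)) \<in> test_functions (ball 0 1)"
  shows "(LBINT y. U y *\<^sub>R kg (x - y)) = mollify k G x"
    and "(LBINT y. kg (x - y) \<bullet> H y) \<ge> 0"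
proof -
  have e': "norm z > e \<Longrightarrow> k z = 0" for z using e by simp
  have gR: "norm z > e \<Longrightarrow> kg z = 0" for z by (rule C1_grad_support_grad[OF C e'])
  have pd: "partial_deriv i (\<lambda>y. k (x - y)) y = - (kg (x - y) $ i)" for i y
  proof -
    have "((\<lambda>y. k (x - y)) has_derivative (\<lambda>h. kg (x - y) \<bullet> (- h))) (at y)"
      by (rule has_derivative_compose[OF _ C1_grad_derivative[OF C]]) (auto intro!: derivative_eq_intros)
    from partial_deriv_eq[OF this, of i] show ?thesis by (simp add: inner_axis)
  qed
  have iU: "integrable lborel (\<lambda>y. U y *\<^sub>R kg (x - y))"
    by (rule convolution_continuous(1)[OF C1_grad_continuous_grad[OF C] gR U_int])
  show "(LBINT y. U y *\<^sub>R kg (x - y)) = mollify k G x"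
  proof (subst vec_eq_iff, rule allI)
    fix i
    have "(LBINT y. U y *\<^sub>R kg (x - y)) $ i = (LBINT y. U y * kg (x - y) $ i)"
      using integral_inner_left[OF iU, of "axis i 1"] by (simp add: inner_axis)
    also have "\<dots> = (LBINT y. G y $ i * k (x - y))"
      using weak_gradient[OF test, of i] by (simp add: pd)
    also have "\<dots> = mollify k G x $ i"
      using mollify_inner[OF C1_grad_continuous[OF C] e' G_int, where x = x and b = "axis i 1"]
      by (simp add: inner_axis mollify_def mult.commute)
    finally show "(LBINT y. U y *\<^sub>R kg (x - y)) $ i = mollify k G x $ i" .
  qed
  have "(\<chi> i. partial_deriv i (\<lambda>y. k (x - y)) y) = - kg (x - y)" for y by (simp add: pd vec_eq_iff)
  then show "(LBINT y. kg (x - y) \<bullet> H y) \<ge> 0" using subsolution[OF test nn] by simp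
qed

text \<open>Classical integration by parts against \<open>\<eta>^2 F\<close>: the divergence term is
  nonnegative, so the gradient of this factor paired with the mollified flux has nonpositive
  integral. The square leaves one \<open>\<eta>\<close> in the cross term, which the later
  absorption needs.\<close>

lemma mollified_subsolution_tested:
  assumes C: "C1_grad k kg" and e: "\<And>z. norm z \<ge> e \<Longrightarrow> k z = 0" and nn: "\<And>z. k z \<ge> 0"
    and test: "\<And>x. norm x + e < 1 \<Longrightarrow> (\<lambda>y. k (x - y)) \<in> test_functions (ball 0 1)" and R: "R + e < 1"
    and \<eta>: "C1_grad \<eta> \<eta>g" "\<And>x. norm x > R \<Longrightarrow> \<eta> x = 0"
    and F: "\<And>t. (F has_real_derivative F' t) (at t)" "continuous_on UNIV F'" "\<And>t. F t \<ge> 0"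
  shows "(LBINT x. ((\<eta> x)\<^sup>2 * F' (mollify k U x)) * (mollify k G x \<bullet> mollify k H x))
    + 2 * (LBINT x. (F (mollify k U x) *\<^sub>R (\<eta> x *\<^sub>R \<eta>g x)) \<bullet> mollify k H x) \<le> 0"
proof -
  let ?Ue = "mollify k U" and ?Ge = "mollify k G" and ?He = "mollify k H"
  have e': "norm z > e \<Longrightarrow> k z = 0" for z using e by simp
  have gR: "norm z > e \<Longrightarrow> kg z = 0" for z by (rule C1_grad_support_grad[OF C e'])
  have \<eta>gR: "norm x > R \<Longrightarrow> \<eta>g x = 0" for x by (rule C1_grad_support_grad[OF \<eta>])
  define Ug where "Ug x = (LBINT y. U y *\<^sub>R kg (x - y))" for x
  have CU: "C1_grad ?Ue Ug" unfolding Ug_def[abs_def] by (rule mollify_C1_grad[OF C e' U_int])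
  define v where "v x = (\<eta> x * \<eta> x) * F (?Ue x)" for x
  define vg where "vg x = (\<eta> x * \<eta> x) *\<^sub>R (F' (?Ue x) *\<^sub>R Ug x) + F (?Ue x) *\<^sub>R (\<eta> x *\<^sub>R \<eta>g x + \<eta> x *\<^sub>R \<eta>g x)" for x
  have CV: "C1_grad v vg" unfolding v_def[abs_def] vg_def[abs_def]
    by (rule C1_grad_mult[OF C1_grad_mult[OF \<eta>(1) \<eta>(1)] C1_grad_compose[OF CU F(1,2)]])
  define hg where "hg i x = (LBINT y. (H y $ i) *\<^sub>R kg (x - y))" for i x
  have CH: "C1_grad (mollify k (\<lambda>y. H y $ i)) (hg i)" for i
    unfolding hg_def[abs_def] by (rule mollify_C1_grad[OF C e' component_int[OF H_int]])
  have Hei: "?He x $ i = mollify k (\<lambda>y. H y $ i) x" for x i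
    using mollify_inner[OF C1_grad_continuous[OF C] e' H_int, where x = x and b = "axis i 1"] by (simp add: inner_axis)
  \<comment> \<open>The divergence of the mollified flux, whose sign is known from
    \<open>mollified_gradient\<close>.\<close>
  define D where "D x = (\<Sum>i\<in>UNIV. hg i x $ i)" for x
  have ii: "integrable lborel (\<lambda>y. (H y $ i) *\<^sub>R kg (x - y))" for i x
    by (rule convolution_continuous(1)[OF C1_grad_continuous_grad[OF C] gR component_int[OF H_int]])
  have iii: "integrable lborel (\<lambda>y. H y $ i * kg (x - y) $ i)" for i x
    using integrable_inner_left[OF ii[of i x], of "axis i 1"] by (simp add: inner_axis)
  have "hg i x $ i = (LBINT y. H y $ i * kg (x - y) $ i)" for i x
    using integral_inner_left[OF ii[of i x], of "axis i 1"] by (simp add: inner_axis hg_def)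
  then have "D x = (LBINT y. (\<Sum>i\<in>UNIV. H y $ i * kg (x - y) $ i))" for x
    unfolding D_def using iii by (subst Bochner_Integration.integral_sum) simp_all
  then have D: "D x = (LBINT y. kg (x - y) \<bullet> H y)" for x by (simp add: inner_vec_def mult.commute)
  have cHe: "continuous_on UNIV ?He" by (rule mollify_continuous[OF C1_grad_continuous[OF C] e' H_int])
  have cD: "continuous_on UNIV D" unfolding D_def[abs_def]
    by (intro continuous_intros C1_grad_continuous_grad[OF CH])
  have vR: "norm x > R \<Longrightarrow> v x = 0" "norm x > R \<Longrightarrow> vg x = 0" for x by (simp_all add: v_def vg_def \<eta>(2) \<eta>gR)
  have z: "(LBINT x. (v x *\<^sub>R hg i x + mollify k (\<lambda>y. H y $ i) x *\<^sub>R vg x) \<bullet> axis i 1) = 0" for i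
    by (rule integral_grad_eq_0[OF C1_grad_mult[OF CV CH], of R]) (simp add: vR)
  have zi: "integrable lborel (\<lambda>x. (v x *\<^sub>R hg i x + mollify k (\<lambda>y. H y $ i) x *\<^sub>R vg x) \<bullet> axis i 1)" for i
  proof (rule compact_support_integrable[of _ R])
    show "continuous_on UNIV (\<lambda>x. (v x *\<^sub>R hg i x + mollify k (\<lambda>y. H y $ i) x *\<^sub>R vg x) \<bullet> axis i 1)"
      by (intro continuous_intros C1_grad_continuous[OF CV] C1_grad_continuous_grad[OF CV]
          C1_grad_continuous[OF CH] C1_grad_continuous_grad[OF CH])
  qed (simp add: vR)
  have "(LBINT x. (\<Sum>i\<in>UNIV. (v x *\<^sub>R hg i x + mollify k (\<lambda>y. H y $ i) x *\<^sub>R vg x) \<bullet> axis i 1)) = 0"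
    using zi by (subst Bochner_Integration.integral_sum) (simp_all only: z, simp)
  moreover have "(\<Sum>i\<in>UNIV. (v x *\<^sub>R hg i x + mollify k (\<lambda>y. H y $ i) x *\<^sub>R vg x) \<bullet> axis i 1)
    = v x * D x + vg x \<bullet> ?He x" for x
    by (simp only: inner_axis Hei[symmetric])
       (simp add: D_def inner_vec_def[of "vg x"] sum.distrib sum_distrib_left mult.commute)
  ultimately have s0: "(LBINT x. v x * D x + vg x \<bullet> ?He x) = 0" by simp
  have i1: "integrable lborel (\<lambda>x. v x * D x)"
    by (rule compact_support_integrable[of _ R]) (auto intro!: continuous_intros C1_grad_continuous[OF CV] cD simp: vR)
  have i2: "integrable lborel (\<lambda>x. vg x \<bullet> ?He x)"
    by (rule compact_support_integrable[of _ R]) (auto intro!: continuous_intros C1_grad_continuous_grad[OF CV] cHe simp: vR)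
  have "v x * D x \<ge> 0" for x
  proof (cases "norm x > R")
    case False
    then have "(\<lambda>y. k (x - y)) \<in> test_functions (ball 0 1)" using R by (intro test) simp
    then have "D x \<ge> 0" unfolding D by (intro mollified_gradient(2)[OF C e nn])
    then show ?thesis using F(3) by (simp add: v_def)
  qed (simp add: vR)
  then have "(LBINT x. v x * D x) \<ge> 0" by simp
  then have le: "(LBINT x. vg x \<bullet> ?He x) \<le> 0" using s0 i1 i2 by simp
  \<comment> \<open>The classical gradient of the mollified \<open>U\<close> is known to equal the
    mollified \<open>G\<close> only where the kernel stays inside the unit ball; beyond radius
    \<open>R\<close> both sides vanish with the cutoff.\<close>
  have vgH: "vg x \<bullet> ?He x = ((\<eta> x)\<^sup>2 * F' (?Ue x)) * (?Ge x \<bullet> ?He x) + 2 * ((F (?Ue x) *\<^sub>R (\<eta> x *\<^sub>R \<eta>g x)) \<bullet> ?He x)" for x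
  proof (cases "norm x > R")
    case False
    then have "(\<lambda>y. k (x - y)) \<in> test_functions (ball 0 1)" using R by (intro test) simp
    then have "Ug x = ?Ge x" unfolding Ug_def by (intro mollified_gradient(1)[OF C e nn])
    then show ?thesis
      by (simp only: vg_def inner_add_left inner_scaleR_left power2_eq_square) (simp add: algebra_simps)
  qed (simp add: vR \<eta>(2) \<eta>gR)
  have cG: "continuous_on UNIV ?Ge" by (rule mollify_continuous[OF C1_grad_continuous[OF C] e' G_int])
  have cF: "continuous_on UNIV F" by (meson DERIV_isCont F(1) continuous_at_imp_continuous_on)
  note cont = C1_grad_continuous[OF CU] C1_grad_continuous[OF \<eta>(1)] C1_grad_continuous_grad[OF \<eta>(1)] cG cHe
    continuous_on_compose2[OF cF C1_grad_continuous[OF CU]] continuous_on_compose2[OF F(2) C1_grad_continuous[OF CU]]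
  have j1: "integrable lborel (\<lambda>x. ((\<eta> x)\<^sup>2 * F' (?Ue x)) * (?Ge x \<bullet> ?He x))"
    by (rule compact_support_integrable[of _ R]) (auto intro!: continuous_intros cont simp: \<eta>(2))
  have j2: "integrable lborel (\<lambda>x. (F (?Ue x) *\<^sub>R (\<eta> x *\<^sub>R \<eta>g x)) \<bullet> ?He x)"
    by (rule compact_support_integrable[of _ R]) (auto intro!: continuous_intros cont simp: \<eta>(2))
  show ?thesis using le j1 j2 unfolding vgH by simp
qed

text \<open>The gradient of \<open>\<eta> F(U)\<close> has two terms, separated at the price of a
  factor 2. Since 0 <= F' <= 1, the square of \<open>F'\<close> is at most \<open>F'\<close>, so the
  first term carries the same weight as the leading term of the tested inequality.\<close>

lemma mollified_translation_energy:
  assumes C: "C1_grad k kg" and e: "\<And>z. norm z \<ge> e \<Longrightarrow> k z = 0" and nn: "\<And>z. k z \<ge> 0"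
    and test: "\<And>x. norm x + e < 1 \<Longrightarrow> (\<lambda>y. k (x - y)) \<in> test_functions (ball 0 1)" and R: "R + e < 1"
    and \<eta>: "C1_grad \<eta> \<eta>g" "\<And>x. norm x > R \<Longrightarrow> \<eta> x = 0"
    and F: "\<And>t. (F has_real_derivative F' t) (at t)" "continuous_on UNIV F'"
    and F': "\<And>t. 0 \<le> F' t" "\<And>t. F' t \<le> 1"
  shows "(\<integral>\<^sup>+x. ennreal ((\<eta> (x + h) * F (mollify k U (x + h)) - \<eta> x * F (mollify k U x))\<^sup>2) \<partial>lborel)
    \<le> ennreal ((norm h)\<^sup>2 * (2 * (LBINT x. ((\<eta> x)\<^sup>2 * F' (mollify k U x)) * (mollify k G x \<bullet> mollify k G x))
       + 2 * (LBINT x. (F (mollify k U x) *\<^sub>R \<eta>g x) \<bullet> (F (mollify k U x) *\<^sub>R \<eta>g x))))"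
proof -
  let ?Ue = "mollify k U" and ?Ge = "mollify k G"
  let ?E = "\<lambda>x. 2 * (((\<eta> x)\<^sup>2 * F' (?Ue x)) * (?Ge x \<bullet> ?Ge x))
      + 2 * ((F (?Ue x) *\<^sub>R \<eta>g x) \<bullet> (F (?Ue x) *\<^sub>R \<eta>g x))"
  have e': "norm z > e \<Longrightarrow> k z = 0" for z using e by simp
  have \<eta>gR: "norm x > R \<Longrightarrow> \<eta>g x = 0" for x by (rule C1_grad_support_grad[OF \<eta>])
  define Ug where "Ug x = (LBINT y. U y *\<^sub>R kg (x - y))" for x
  have CU: "C1_grad ?Ue Ug" unfolding Ug_def[abs_def] by (rule mollify_C1_grad[OF C e' U_int])
  define wg where "wg x = \<eta> x *\<^sub>R (F' (?Ue x) *\<^sub>R Ug x) + F (?Ue x) *\<^sub>R \<eta>g x" for x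
  have CW: "C1_grad (\<lambda>x. \<eta> x * F (?Ue x)) wg" unfolding wg_def[abs_def]
    by (rule C1_grad_mult[OF \<eta>(1) C1_grad_compose[OF CU F(1,2)]])
  have cG: "continuous_on UNIV ?Ge" by (rule mollify_continuous[OF C1_grad_continuous[OF C] e' G_int])
  have cF: "continuous_on UNIV F" by (meson DERIV_isCont F(1) continuous_at_imp_continuous_on)
  note cont = C1_grad_continuous[OF CU] C1_grad_continuous[OF \<eta>(1)] C1_grad_continuous_grad[OF \<eta>(1)] cG
    continuous_on_compose2[OF cF C1_grad_continuous[OF CU]] continuous_on_compose2[OF F(2) C1_grad_continuous[OF CU]]
  have j1: "integrable lborel (\<lambda>x. ((\<eta> x)\<^sup>2 * F' (?Ue x)) * (?Ge x \<bullet> ?Ge x))"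
    by (rule compact_support_integrable[of _ R]) (auto intro!: continuous_intros cont simp: \<eta>(2))
  have j2: "integrable lborel (\<lambda>x. (F (?Ue x) *\<^sub>R \<eta>g x) \<bullet> (F (?Ue x) *\<^sub>R \<eta>g x))"
    by (rule compact_support_integrable[of _ R]) (auto intro!: continuous_intros cont simp: \<eta>gR)
  have pw: "(norm (wg x))\<^sup>2 \<le> ?E x" for x
  proof (cases "norm x > R")
    case False
    then have "(\<lambda>y. k (x - y)) \<in> test_functions (ball 0 1)" using R by (intro test) simp
    then have Ug: "Ug x = ?Ge x" unfolding Ug_def by (intro mollified_gradient(1)[OF C e nn])
    have par: "(norm (a + b))\<^sup>2 \<le> 2 * (a \<bullet> a) + 2 * (b \<bullet> b)" for a b :: "real^'n"
      using inner_ge_zero[of "a - b"]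
      by (simp add: power2_norm_eq_inner inner_add_left inner_add_right inner_diff_left inner_diff_right inner_commute)
    have "(norm (wg x))\<^sup>2 \<le> 2 * ((\<eta> x *\<^sub>R (F' (?Ue x) *\<^sub>R ?Ge x)) \<bullet> (\<eta> x *\<^sub>R (F' (?Ue x) *\<^sub>R ?Ge x)))
      + 2 * ((F (?Ue x) *\<^sub>R \<eta>g x) \<bullet> (F (?Ue x) *\<^sub>R \<eta>g x))"
      unfolding wg_def Ug by (rule par)
    also have "(\<eta> x *\<^sub>R (F' (?Ue x) *\<^sub>R ?Ge x)) \<bullet> (\<eta> x *\<^sub>R (F' (?Ue x) *\<^sub>R ?Ge x))
      = ((\<eta> x)\<^sup>2 * (?Ge x \<bullet> ?Ge x)) * (F' (?Ue x) * F' (?Ue x))" by (simp add: power2_eq_square mult_ac)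
    also have "\<dots> \<le> ((\<eta> x)\<^sup>2 * (?Ge x \<bullet> ?Ge x)) * (F' (?Ue x) * 1)"
      by (intro mult_left_mono F') auto
    finally show ?thesis by (simp add: mult_ac)
  qed (simp add: wg_def \<eta>(2) \<eta>gR)
  have "(\<integral>\<^sup>+x. ennreal ((\<eta> (x + h) * F (?Ue (x + h)) - \<eta> x * F (?Ue x))\<^sup>2) \<partial>lborel)
    \<le> ennreal ((norm h)\<^sup>2) * (\<integral>\<^sup>+x. ennreal ((norm (wg x))\<^sup>2) \<partial>lborel)"
    by (rule C1_grad_translation_L2[OF CW])
  also have "\<dots> \<le> ennreal ((norm h)\<^sup>2) * (\<integral>\<^sup>+x. ennreal (?E x) \<partial>lborel)"
    by (intro mult_left_mono nn_integral_mono ennreal_leI pw) auto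
  also have "(\<integral>\<^sup>+x. ennreal (?E x) \<partial>lborel)
    = ennreal (LBINT x. ?E x)"
  proof (rule nn_integral_eq_integral)
    show "AE x in lborel. 0 \<le> ?E x"
      using order_trans[OF zero_le_power2 pw] by (intro AE_I2)
  qed (intro Bochner_Integration.integrable_add integrable_mult_right j1 j2)
  also have "ennreal ((norm h)\<^sup>2) * \<dots> = ennreal ((norm h)\<^sup>2 * (LBINT x. ?E x))"
    by (rule ennreal_mult[symmetric], simp, rule Bochner_Integration.integral_nonneg,
        rule order_trans[OF zero_le_power2 pw])
  also have "(LBINT x. ?E x)
    = 2 * (LBINT x. ((\<eta> x)\<^sup>2 * F' (?Ue x)) * (?Ge x \<bullet> ?Ge x))
       + 2 * (LBINT x. (F (?Ue x) *\<^sub>R \<eta>g x) \<bullet> (F (?Ue x) *\<^sub>R \<eta>g x))"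
    using j1 j2 by (simp del: inner_scaleR_left inner_scaleR_right)
  finally show ?thesis .
qed

text \<open>Radii up to (1 - R)/2 leave room between \<open>R\<close> and the unit sphere. The
  \<open>L^1\<close> convergence of the mollified \<open>U\<close> gives pointwise convergence along
  a subsequence, and the other properties survive passing to it.\<close>

lemma mollifier_approximation:
  assumes R: "R < 1"
  obtains k :: "nat \<Rightarrow> real^'n \<Rightarrow> real" and kg e where
    "\<And>n. C1_grad (k n) (kg n)" "\<And>n z. norm z \<ge> e n \<Longrightarrow> k n z = 0" "\<And>n z. k n z \<ge> 0"
    "\<And>n x. norm x + e n < 1 \<Longrightarrow> (\<lambda>y. k n (x - y)) \<in> test_functions (ball 0 1)"
    "\<And>n. R + e n < 1"
    "AE x in lborel. (\<lambda>n. mollify (k n) U x) \<longlonglongrightarrow> U x"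
    "(\<lambda>n. LBINT x. (norm (mollify (k n) U x - U x))\<^sup>2) \<longlonglongrightarrow> 0"
    "(\<lambda>n. LBINT x. (norm (mollify (k n) G x - G x))\<^sup>2) \<longlonglongrightarrow> 0"
    "(\<lambda>n. LBINT x. (norm (mollify (k n) H x - H x))\<^sup>2) \<longlonglongrightarrow> 0"
    "\<And>n. integrable lborel (\<lambda>x. (norm (mollify (k n) U x))\<^sup>2)"
    "\<And>n. integrable lborel (\<lambda>x. (norm (mollify (k n) G x))\<^sup>2)"
    "\<And>n. integrable lborel (\<lambda>x. (norm (mollify (k n) H x))\<^sup>2)"
proof -
  obtain k :: "nat \<Rightarrow> real^'n \<Rightarrow> real" and kg e where k: "\<And>n. C1_grad (k n) (kg n)" "\<And>n z. k n z \<ge> 0"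
    "\<And>n z. norm z \<ge> e n \<Longrightarrow> k n z = 0" "\<And>n. integral\<^sup>L lborel (k n) = 1"
    "\<And>n x. norm x + e n < 1 \<Longrightarrow> (\<lambda>y. k n (x - y)) \<in> test_functions (ball 0 1)"
    "\<And>n. 0 < e n" "\<And>n. e n \<le> (1 - R) / 2" "e \<longlonglongrightarrow> 0"
    by (rule mollifier_kernel_sequence[of "(1 - R) / 2", where 'n='n]) (use R in auto)
  note kc = C1_grad_continuous[OF k(1)]
  have k': "norm z > e n \<Longrightarrow> k n z = 0" for n z using k(3) by simp
  note [measurable] = borel_measurable_continuous_onI[OF kc]
  have Re: "R + e n < 1" for n using k(7)[of n] R by (simp add: field_simps)
  have int2: "integrable lborel (\<lambda>x. (norm (mollify (k n) f x))\<^sup>2)"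
    and int1: "integrable lborel (mollify (k n) f)"
    if f: "integrable lborel f" "\<And>x. x \<notin> ball 0 1 \<Longrightarrow> f x = 0" for n and f :: "real^'n \<Rightarrow> 'b::euclidean_space"
  proof -
    have c: "continuous_on UNIV (mollify (k n) f)" by (rule mollify_continuous[OF kc k' f(1)])
    have s: "mollify (k n) f x = 0" if "norm x > 1 + e n" for x
      by (rule mollify_support[OF k(3) _ that]) (use f(2) in auto)
    show "integrable lborel (mollify (k n) f)" by (rule compact_support_integrable[OF c s])
    show "integrable lborel (\<lambda>x. (norm (mollify (k n) f x))\<^sup>2)"
      by (rule compact_support_integrable[of _ "1 + e n"]) (auto intro!: continuous_intros c simp: s)
  qed
  have lim: "(\<lambda>n. LBINT x. (norm (mollify (k n) f x - f x))\<^sup>2) \<longlonglongrightarrow> 0"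
    if f: "integrable lborel f" "\<And>x. x \<notin> ball 0 1 \<Longrightarrow> f x = 0" and f2: "integrable lborel (\<lambda>x. (norm (f x))\<^sup>2)"
    for f :: "real^'n \<Rightarrow> 'b::euclidean_space"
  proof -
    have [measurable]: "f \<in> borel_measurable borel" using f by auto
    have m: "mollify (k n) f \<in> borel_measurable lborel" for n by simp
    have "(\<lambda>n. \<integral>\<^sup>+x. ennreal (norm (mollify (k n) f x - f x) ^ 2) \<partial>lborel) \<longlonglongrightarrow> 0"
      by (rule mollify_tendsto[OF kc k(3) k(2) k(4) f(1) _ f2 k(8)]) auto
    moreover have "(\<integral>\<^sup>+x. ennreal (norm (mollify (k n) f x - f x) ^ 2) \<partial>lborel)
      = ennreal (LBINT x. (norm (mollify (k n) f x - f x))\<^sup>2)" for n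
      by (rule nn_integral_eq_integral[OF L2_norm_diff_integrable[OF m _ int2[OF f] f2]]) auto
    ultimately have "(\<lambda>n. ennreal (LBINT x. (norm (mollify (k n) f x - f x))\<^sup>2)) \<longlonglongrightarrow> ennreal 0" by simp
    then show ?thesis by (subst (asm) tendsto_ennreal_iff) auto
  qed
  have "(\<lambda>n. LBINT x. norm (mollify (k n) U x - U x)) \<longlonglongrightarrow> 0"
  proof -
    have i: "integrable lborel (\<lambda>x. norm (mollify (k n) U x - U x))" for n
      using int1[OF U_int U_out, of n] U_int by auto
    have "(\<lambda>n. \<integral>\<^sup>+x. ennreal (norm (mollify (k n) U x - U x) ^ 1) \<partial>lborel) \<longlonglongrightarrow> 0"
      by (rule mollify_tendsto[OF kc k(3) k(2) k(4) U_int _ _ k(8)]) auto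
    moreover have "(\<integral>\<^sup>+x. ennreal (norm (mollify (k n) U x - U x) ^ 1) \<partial>lborel)
      = ennreal (LBINT x. norm (mollify (k n) U x - U x))" for n
      using nn_integral_eq_integral[OF i] by simp
    ultimately have "(\<lambda>n. ennreal (LBINT x. norm (mollify (k n) U x - U x))) \<longlonglongrightarrow> ennreal 0" by simp
    then show ?thesis by (subst (asm) tendsto_ennreal_iff) auto
  qed
  then obtain r where r: "strict_mono r" "AE x in lborel. (\<lambda>n. mollify (k (r n)) U x - U x) \<longlonglongrightarrow> 0"
    using tendsto_L1_AE_subseq[of lborel "\<lambda>n x. mollify (k n) U x - U x"] int1[OF U_int U_out] U_int by auto
  have sub: "(\<lambda>n. f (r n)) \<longlonglongrightarrow> 0" if "f \<longlonglongrightarrow> 0" for f :: "nat \<Rightarrow> real"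
    using LIMSEQ_subseq_LIMSEQ[OF that r(1)] by (simp add: o_def)
  have U2: "integrable lborel (\<lambda>x. (norm (U x))\<^sup>2)" using U_L2 by simp
  show ?thesis
  proof (rule that[of "\<lambda>n. k (r n)" "\<lambda>n. kg (r n)" "\<lambda>n. e (r n)"])
    show "AE x in lborel. (\<lambda>n. mollify (k (r n)) U x) \<longlonglongrightarrow> U x"
      using r(2) by eventually_elim (simp add: LIM_zero_iff)
    show "(\<lambda>n. LBINT x. (norm (mollify (k (r n)) U x - U x))\<^sup>2) \<longlonglongrightarrow> 0"
      by (rule sub[OF lim[OF U_int U_out U2]])
    show "(\<lambda>n. LBINT x. (norm (mollify (k (r n)) G x - G x))\<^sup>2) \<longlonglongrightarrow> 0"
      by (rule sub[OF lim[OF G_int G_out G_L2]])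
    show "(\<lambda>n. LBINT x. (norm (mollify (k (r n)) H x - H x))\<^sup>2) \<longlonglongrightarrow> 0"
      by (rule sub[OF lim[OF H_int H_out H_L2]])
    show "integrable lborel (\<lambda>x. (norm (mollify (k (r n)) U x))\<^sup>2)" for n by (rule int2[OF U_int U_out])
    show "integrable lborel (\<lambda>x. (norm (mollify (k (r n)) G x))\<^sup>2)" for n by (rule int2[OF G_int G_out])
    show "integrable lborel (\<lambda>x. (norm (mollify (k (r n)) H x))\<^sup>2)" for n by (rule int2[OF H_int H_out])
  qed (use k Re in auto)
qed

end

subsection \<open>Energy estimate and Faber--Krahn inequality\<close>

lemma Lipschitz_1_of_derivative:
  fixes F :: "real \<Rightarrow> real"
  assumes "\<And>t. (F has_real_derivative F' t) (at t)" "\<And>t. 0 \<le> F' t" "\<And>t. F' t \<le> 1"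
  shows "\<bar>F s - F t\<bar> \<le> \<bar>s - t\<bar>"
proof -
  have *: "\<bar>F s - F t\<bar> \<le> \<bar>s - t\<bar>" if lt: "s < t" for s t
  proof -
    obtain z where z: "F t - F s = (t - s) * F' z" using MVT2[OF lt assms(1)] by blast
    then have "F t - F s \<ge> 0" "F t - F s \<le> (t - s) * 1"
      using lt assms(2,3)[of z] by (auto intro: mult_left_mono simp del: mult_1_right)
    then show ?thesis using lt by simp
  qed
  consider "s < t" | "t < s" | "s = t" by linarith
  then show ?thesis using *[of s t] *[of t s] by cases (auto simp: abs_minus_commute)
qed

context divergence_subsolution
begin

text \<open>Caccioppoli's inequality for \<open>\<eta> F(U)\<close>, with the Dirichlet energy expressed through translations so
  that no weak derivative of a truncation is needed. The bound \<open>F \<le> F' (t - c)\<^sub>+\<close> lets the factor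
  \<open>F'\<close> carry \<open>H\<close> in the cross term.\<close>

lemma truncation_energy:
  assumes R: "R < 1" and \<eta>: "C1_grad \<eta> \<eta>g" "\<And>x. norm x > R \<Longrightarrow> \<eta> x = 0"
    and F: "\<And>t. (F has_real_derivative F' t) (at t)" "continuous_on UNIV F'" "\<And>t. F t \<ge> 0"
    and F': "\<And>t. 0 \<le> F' t" "\<And>t. F' t \<le> 1"
    and Fs: "\<And>t. F t \<le> F' t * max 0 (t - c)" and c: "c \<ge> 0"
  shows "(\<integral>\<^sup>+x. ennreal ((\<eta> (x + h) * F (U (x + h)) - \<eta> x * F (U x))\<^sup>2) \<partial>lborel)
    \<le> ennreal ((norm h)\<^sup>2 * (10 * (Lam / lam) * (LBINT x. (max 0 (U x - c))\<^sup>2 * (norm (\<eta>g x))\<^sup>2)))"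
proof -
  obtain k :: "nat \<Rightarrow> real^'n \<Rightarrow> real" and kg e where
    k: "\<And>n. C1_grad (k n) (kg n)" "\<And>n z. norm z \<ge> e n \<Longrightarrow> k n z = 0" "\<And>n z. k n z \<ge> 0"
      "\<And>n x. norm x + e n < 1 \<Longrightarrow> (\<lambda>y. k n (x - y)) \<in> test_functions (ball 0 1)" "\<And>n. R + e n < 1"
    and ae: "AE x in lborel. (\<lambda>n. mollify (k n) U x) \<longlonglongrightarrow> U x"
    and Ul: "(\<lambda>n. LBINT x. (norm (mollify (k n) U x - U x))\<^sup>2) \<longlonglongrightarrow> 0"
    and Gl: "(\<lambda>n. LBINT x. (norm (mollify (k n) G x - G x))\<^sup>2) \<longlonglongrightarrow> 0"
    and Hl: "(\<lambda>n. LBINT x. (norm (mollify (k n) H x - H x))\<^sup>2) \<longlonglongrightarrow> 0"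
    and Ui: "\<And>n. integrable lborel (\<lambda>x. (norm (mollify (k n) U x))\<^sup>2)"
    and Gi: "\<And>n. integrable lborel (\<lambda>x. (norm (mollify (k n) G x))\<^sup>2)"
    and Hi: "\<And>n. integrable lborel (\<lambda>x. (norm (mollify (k n) H x))\<^sup>2)"
    using mollifier_approximation[OF R] by blast
  have \<eta>gR: "norm x > R \<Longrightarrow> \<eta>g x = 0" for x by (rule C1_grad_support_grad[OF \<eta>])
  obtain M where M: "M \<ge> 0" "\<And>x. norm (\<eta> x) \<le> M"
    using compact_support_bounded[OF C1_grad_continuous[OF \<eta>(1)] \<eta>(2)] by blast
  obtain N where N: "N \<ge> 0" "\<And>x. norm (\<eta>g x) \<le> N"
    using compact_support_bounded[OF C1_grad_continuous_grad[OF \<eta>(1)] \<eta>gR] by blast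
  have cF: "continuous_on UNIV F" by (meson DERIV_isCont F(1) continuous_at_imp_continuous_on)
  note [measurable] = borel_measurable_continuous_onI[OF C1_grad_continuous[OF k(1)]]
    borel_measurable_continuous_onI[OF C1_grad_continuous[OF \<eta>(1)]]
    borel_measurable_continuous_onI[OF C1_grad_continuous_grad[OF \<eta>(1)]]
    borel_measurable_continuous_onI[OF cF] borel_measurable_continuous_onI[OF F(2)]
  have Lip: "\<bar>F s - F t\<bar> \<le> \<bar>s - t\<bar>" for s t by (rule Lipschitz_1_of_derivative[OF F(1) F'])
  have Fle: "F t \<le> max 0 (t - c)" for t
    by (rule order_trans[OF Fs]) (simp add: F' mult_left_le_one_le)
  \<comment> \<open>Here \<open>c >= 0\<close> matters: above a nonnegative level the truncation is
    dominated by |t|, so it is square integrable along with \<open>U\<close>.\<close>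
  have Fabs: "\<bar>F t\<bar> \<le> \<bar>t\<bar>" for t using Fle[of t] F(3)[of t] c by linarith
  have U2: "integrable lborel (\<lambda>x. (norm (U x))\<^sup>2)" using U_L2 by simp
  have FL: "integrable lborel (\<lambda>x. (norm (F (f x) *\<^sub>R \<zeta> x))\<^sup>2)"
    if [measurable]: "f \<in> borel_measurable borel" "\<zeta> \<in> borel_measurable borel"
      and f: "integrable lborel (\<lambda>x. (norm (f x))\<^sup>2)" and C: "\<And>x. norm (\<zeta> x) \<le> C" for f :: "real^'n \<Rightarrow> real" and \<zeta> :: "real^'n \<Rightarrow> real^'n" and C
  proof (rule Bochner_Integration.integrable_bound)
    show "integrable lborel (\<lambda>x. C\<^sup>2 * (norm (f x))\<^sup>2)" using f by simp
    show "AE x in lborel. norm ((norm (F (f x) *\<^sub>R \<zeta> x))\<^sup>2) \<le> norm (C\<^sup>2 * (norm (f x))\<^sup>2)"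
    proof (rule AE_I2)
      fix x
      have "norm (F (f x) *\<^sub>R \<zeta> x) \<le> C * norm (f x)"
        using mult_mono[OF C[of x] Fabs[of "f x"]] order_trans[OF norm_ge_zero C] by (simp add: mult.commute)
      then have "(norm (F (f x) *\<^sub>R \<zeta> x))\<^sup>2 \<le> (C * norm (f x))\<^sup>2" by (intro power_mono) auto
      then show "norm ((norm (F (f x) *\<^sub>R \<zeta> x))\<^sup>2) \<le> norm (C\<^sup>2 * (norm (f x))\<^sup>2)"
        by (simp add: power_mult_distrib)
    qed
  qed measurable
  \<comment> \<open>\<open>F\<close> has Lipschitz constant 1, so \<open>L^2\<close> convergence
    passes to \<open>F(U)\<close> times a bounded field.\<close>
  have Fl: "(\<lambda>n. LBINT x. (norm (F (mollify (k n) U x) *\<^sub>R \<zeta> x - F (U x) *\<^sub>R \<zeta> x))\<^sup>2) \<longlonglongrightarrow> 0"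
    if [measurable]: "\<zeta> \<in> borel_measurable borel" and C: "\<And>x. norm (\<zeta> x) \<le> C" for \<zeta> :: "real^'n \<Rightarrow> real^'n" and C
  proof (rule tendsto_sandwich[OF _ _ tendsto_const])
    show "(\<lambda>n. C\<^sup>2 * (LBINT x. (norm (mollify (k n) U x - U x))\<^sup>2)) \<longlonglongrightarrow> 0"
      using tendsto_mult[OF tendsto_const Ul, of "C\<^sup>2"] by simp
    show "\<forall>\<^sub>F n in sequentially. (LBINT x. (norm (F (mollify (k n) U x) *\<^sub>R \<zeta> x - F (U x) *\<^sub>R \<zeta> x))\<^sup>2)
      \<le> C\<^sup>2 * (LBINT x. (norm (mollify (k n) U x - U x))\<^sup>2)"
    proof (rule always_eventually, rule allI)
      fix n
      have mU: "mollify (k n) U \<in> borel_measurable lborel" "U \<in> borel_measurable lborel" by simp_all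
      have dU: "integrable lborel (\<lambda>x. (norm (mollify (k n) U x - U x))\<^sup>2)"
        by (rule L2_norm_diff_integrable[OF mU Ui U2])
      have "(LBINT x. (norm (F (mollify (k n) U x) *\<^sub>R \<zeta> x - F (U x) *\<^sub>R \<zeta> x))\<^sup>2)
        \<le> (LBINT x. C\<^sup>2 * (norm (mollify (k n) U x - U x))\<^sup>2)"
      proof (rule Bochner_Integration.integral_mono')
        show "integrable lborel (\<lambda>x. C\<^sup>2 * (norm (mollify (k n) U x - U x))\<^sup>2)" using dU by simp
        fix x
        have "norm (F (mollify (k n) U x) *\<^sub>R \<zeta> x - F (U x) *\<^sub>R \<zeta> x) = \<bar>F (mollify (k n) U x) - F (U x)\<bar> * norm (\<zeta> x)"
          by (simp flip: scaleR_diff_left)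
        also have "\<dots> \<le> \<bar>mollify (k n) U x - U x\<bar> * C"
          using order_trans[OF norm_ge_zero C] by (intro mult_mono Lip C) auto
        finally have "(norm (F (mollify (k n) U x) *\<^sub>R \<zeta> x - F (U x) *\<^sub>R \<zeta> x))\<^sup>2 \<le> (\<bar>mollify (k n) U x - U x\<bar> * C)\<^sup>2"
          by (intro power_mono) auto
        then show "(norm (F (mollify (k n) U x) *\<^sub>R \<zeta> x - F (U x) *\<^sub>R \<zeta> x))\<^sup>2 \<le> C\<^sup>2 * (norm (mollify (k n) U x - U x))\<^sup>2"
          by (simp add: power_mult_distrib mult.commute)
      qed simp
      then show "(LBINT x. (norm (F (mollify (k n) U x) *\<^sub>R \<zeta> x - F (U x) *\<^sub>R \<zeta> x))\<^sup>2)
      \<le> C\<^sup>2 * (LBINT x. (norm (mollify (k n) U x - U x))\<^sup>2)" by simp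
    qed
  qed simp
  have mb: "\<bar>(\<eta> x)\<^sup>2 * F' t\<bar> \<le> M\<^sup>2" for x t
  proof -
    have "(\<eta> x)\<^sup>2 \<le> M\<^sup>2" using M(2)[of x] M(1) by (simp add: abs_le_square_iff[symmetric])
    then have "(\<eta> x)\<^sup>2 * F' t \<le> M\<^sup>2 * 1" using F' by (intro mult_mono) auto
    then show ?thesis using F' by simp
  qed
  have mlim: "AE x in lborel. (\<lambda>n. (\<eta> x)\<^sup>2 * F' (mollify (k n) U x)) \<longlonglongrightarrow> (\<eta> x)\<^sup>2 * F' (U x)"
    using ae
  proof eventually_elim
    case (elim x)
    have "isCont F' (U x)" using F(2) by (simp add: continuous_on_eq_continuous_at)
    then show ?case by (intro tendsto_mult tendsto_const isCont_tendsto_compose[OF _ elim])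
  qed
  have z1: "norm (\<eta> x *\<^sub>R \<eta>g x) \<le> M * N" for x using M N by (auto intro!: mult_mono)
  \<comment> \<open>The factor \<open>\<eta>^2 F'\<close> converges pointwise and is bounded, hence
    acts as the multiplier. In \<open>T2\<close> and \<open>T4\<close> the factor
    \<open>F(U)\<close> converges in \<open>L^2\<close> and joins the inner product, with multiplier
    1.\<close>
  have T1: "(\<lambda>n. LBINT x. ((\<eta> x)\<^sup>2 * F' (mollify (k n) U x)) * (mollify (k n) G x \<bullet> mollify (k n) H x))
    \<longlonglongrightarrow> (LBINT x. ((\<eta> x)\<^sup>2 * F' (U x)) * (G x \<bullet> H x))"
    by (rule L2_product_tendsto[OF _ _ _ _ _ _ Gi Hi G_L2 H_L2 Gl Hl mb mlim]) simp_all
  have T2: "(\<lambda>n. LBINT x. 1 * ((F (mollify (k n) U x) *\<^sub>R (\<eta> x *\<^sub>R \<eta>g x)) \<bullet> mollify (k n) H x))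
    \<longlonglongrightarrow> (LBINT x. 1 * ((F (U x) *\<^sub>R (\<eta> x *\<^sub>R \<eta>g x)) \<bullet> H x))"
    by (rule L2_product_tendsto[OF _ _ _ _ _ _ FL[OF _ _ Ui z1] Hi FL[OF _ _ U2 z1] H_L2 Fl[OF _ z1] Hl, where C = 1]) simp_all
  have T3: "(\<lambda>n. LBINT x. ((\<eta> x)\<^sup>2 * F' (mollify (k n) U x)) * (mollify (k n) G x \<bullet> mollify (k n) G x))
    \<longlonglongrightarrow> (LBINT x. ((\<eta> x)\<^sup>2 * F' (U x)) * (G x \<bullet> G x))"
    by (rule L2_product_tendsto[OF _ _ _ _ _ _ Gi Gi G_L2 G_L2 Gl Gl mb mlim]) simp_all
  have T4: "(\<lambda>n. LBINT x. 1 * ((F (mollify (k n) U x) *\<^sub>R \<eta>g x) \<bullet> (F (mollify (k n) U x) *\<^sub>R \<eta>g x)))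
    \<longlonglongrightarrow> (LBINT x. 1 * ((F (U x) *\<^sub>R \<eta>g x) \<bullet> (F (U x) *\<^sub>R \<eta>g x)))"
    by (rule L2_product_tendsto[OF _ _ _ _ _ _ FL[OF _ _ Ui N(2)] FL[OF _ _ Ui N(2)] FL[OF _ _ U2 N(2)] FL[OF _ _ U2 N(2)]
         Fl[OF _ N(2)] Fl[OF _ N(2)], where C = 1]) simp_all
  define X where "X = (LBINT x. ((\<eta> x)\<^sup>2 * F' (U x)) * (G x \<bullet> H x))"
  define Y where "Y = (LBINT x. (F (U x) *\<^sub>R (\<eta> x *\<^sub>R \<eta>g x)) \<bullet> H x)"
  define W where "W = (LBINT x. ((\<eta> x)\<^sup>2 * F' (U x)) * (G x \<bullet> G x))"
  define V where "V = (LBINT x. (F (U x) *\<^sub>R \<eta>g x) \<bullet> (F (U x) *\<^sub>R \<eta>g x))"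
  define Z where "Z = (LBINT x. (max 0 (U x - c))\<^sup>2 * (norm (\<eta>g x))\<^sup>2)"
  have "(\<lambda>n. (LBINT x. ((\<eta> x)\<^sup>2 * F' (mollify (k n) U x)) * (mollify (k n) G x \<bullet> mollify (k n) H x))
    + 2 * (LBINT x. (F (mollify (k n) U x) *\<^sub>R (\<eta> x *\<^sub>R \<eta>g x)) \<bullet> mollify (k n) H x)) \<longlonglongrightarrow> X + 2 * Y"
    unfolding X_def Y_def using T1 T2 by (intro tendsto_intros) simp_all
  then have XY: "X + 2 * Y \<le> 0"
    by (rule LIMSEQ_le_const2) (intro exI allI impI mollified_subsolution_tested[OF k(1-5) \<eta> F])
  have mi: "integrable lborel (\<lambda>x. ((\<eta> x)\<^sup>2 * F' (U x)) * q x)" if "integrable lborel q" for q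
  proof (rule Bochner_Integration.integrable_bound)
    show "integrable lborel (\<lambda>x. M\<^sup>2 * q x)" using that by simp
    have "q \<in> borel_measurable borel" using that by auto
    then show "(\<lambda>x. ((\<eta> x)\<^sup>2 * F' (U x)) * q x) \<in> borel_measurable lborel" by measurable
    show "AE x in lborel. norm (((\<eta> x)\<^sup>2 * F' (U x)) * q x) \<le> norm (M\<^sup>2 * q x)"
      using mb by (auto simp: abs_mult intro!: AE_I2 mult_right_mono)
  qed
  have GHi: "integrable lborel (\<lambda>x. G x \<bullet> H x)" "integrable lborel (\<lambda>x. G x \<bullet> G x)"
    by (rule L2_inner_integrable(2); use G_L2 H_L2 in simp)+
  note Xi = mi[OF GHi(1)] and Wi = mi[OF GHi(2)]
  have mY: "(\<lambda>x. F (U x) *\<^sub>R (\<eta> x *\<^sub>R \<eta>g x)) \<in> borel_measurable lborel"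
    "(\<lambda>x. F (U x) *\<^sub>R \<eta>g x) \<in> borel_measurable lborel" "H \<in> borel_measurable lborel" by measurable
  have Yi: "integrable lborel (\<lambda>x. (F (U x) *\<^sub>R (\<eta> x *\<^sub>R \<eta>g x)) \<bullet> H x)"
    by (rule L2_inner_integrable(2)[OF mY(1,3) FL[OF _ _ U2 z1] H_L2]) simp_all
  have Vi: "integrable lborel (\<lambda>x. (F (U x) *\<^sub>R \<eta>g x) \<bullet> (F (U x) *\<^sub>R \<eta>g x))"
    by (rule L2_inner_integrable(2)[OF mY(2,2) FL[OF _ _ U2 N(2)] FL[OF _ _ U2 N(2)]]) simp_all
  have Zi: "integrable lborel (\<lambda>x. (max 0 (U x - c))\<^sup>2 * (norm (\<eta>g x))\<^sup>2)"
  proof (rule Bochner_Integration.integrable_bound)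
    show "integrable lborel (\<lambda>x. N\<^sup>2 * (U x)\<^sup>2)" using U_L2 by simp
    show "AE x in lborel. norm ((max 0 (U x - c))\<^sup>2 * (norm (\<eta>g x))\<^sup>2) \<le> norm (N\<^sup>2 * (U x)\<^sup>2)"
    proof (rule AE_I2)
      fix x
      have "\<bar>max 0 (U x - c)\<bar> \<le> \<bar>U x\<bar>" using c by linarith
      then have "(max 0 (U x - c))\<^sup>2 \<le> (U x)\<^sup>2" by (simp only: abs_le_square_iff)
      moreover have "(norm (\<eta>g x))\<^sup>2 \<le> N\<^sup>2" using N by (intro power_mono) auto
      ultimately have "(max 0 (U x - c))\<^sup>2 * (norm (\<eta>g x))\<^sup>2 \<le> (U x)\<^sup>2 * N\<^sup>2" by (intro mult_mono) auto
      then show "norm ((max 0 (U x - c))\<^sup>2 * (norm (\<eta>g x))\<^sup>2) \<le> norm (N\<^sup>2 * (U x)\<^sup>2)" by (simp add: mult.commute abs_mult)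
    qed
  qed measurable
  have Lp: "Lam > 0" using lam_pos lam_le by simp
  have "- 2 * Y = (LBINT x. - 2 * ((F (U x) *\<^sub>R (\<eta> x *\<^sub>R \<eta>g x)) \<bullet> H x))"
    unfolding Y_def by (rule integral_mult_right_zero[symmetric])
  also have "\<dots> \<le> (LBINT x. 1/2 * (((\<eta> x)\<^sup>2 * F' (U x)) * (G x \<bullet> H x)) + 2 * Lam * ((max 0 (U x - c))\<^sup>2 * (norm (\<eta>g x))\<^sup>2))"
  proof (rule integral_mono_AE)
    show "integrable lborel (\<lambda>x. - 2 * ((F (U x) *\<^sub>R (\<eta> x *\<^sub>R \<eta>g x)) \<bullet> H x))"
      by (rule integrable_mult_right[OF Yi])
    show "integrable lborel (\<lambda>x. 1/2 * (((\<eta> x)\<^sup>2 * F' (U x)) * (G x \<bullet> H x)) + 2 * Lam * ((max 0 (U x - c))\<^sup>2 * (norm (\<eta>g x))\<^sup>2))"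
      by (intro Bochner_Integration.integrable_add integrable_mult_right Xi Zi)
    show "AE x in lborel. - 2 * ((F (U x) *\<^sub>R (\<eta> x *\<^sub>R \<eta>g x)) \<bullet> H x)
      \<le> 1/2 * (((\<eta> x)\<^sup>2 * F' (U x)) * (G x \<bullet> H x)) + 2 * Lam * ((max 0 (U x - c))\<^sup>2 * (norm (\<eta>g x))\<^sup>2)"
      using ellipticity
    proof eventually_elim
      case (elim x)
      define p s where "p = F' (U x)" and "s = max 0 (U x - c)"
      have p: "0 \<le> p" "p \<le> 1" and s: "s \<ge> 0" using F' by (auto simp: p_def s_def)
      \<comment> \<open>The weight is chosen so that |H|^2 <= Lam G.H returns exactly half of the
        leading term.\<close>
      have young: "2 * (\<bar>\<eta> x\<bar> * norm (H x)) * (s * norm (\<eta>g x)) \<le> 1/2 * ((\<eta> x)\<^sup>2 * (G x \<bullet> H x)) + 2 * Lam * (s\<^sup>2 * (norm (\<eta>g x))\<^sup>2)"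
      proof -
        define A B where "A = \<bar>\<eta> x\<bar> * norm (H x)" and "B = s * norm (\<eta>g x)"
        have "0 \<le> (A - 2 * Lam * B)\<^sup>2 / (2 * Lam)" using Lp by simp
        also have "\<dots> = A\<^sup>2 / (2 * Lam) - 2 * A * B + 2 * Lam * B\<^sup>2"
          using Lp by (simp add: field_simps power2_eq_square)
        finally have "2 * A * B \<le> A\<^sup>2 / (2 * Lam) + 2 * Lam * B\<^sup>2" by simp
        also have "A\<^sup>2 \<le> (\<eta> x)\<^sup>2 * (Lam * (G x \<bullet> H x))"
          unfolding A_def power_mult_distrib power2_abs using elim by (intro mult_left_mono) auto
        then have "A\<^sup>2 / (2 * Lam) \<le> 1/2 * ((\<eta> x)\<^sup>2 * (G x \<bullet> H x))" using Lp by (simp add: field_simps)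
        finally show ?thesis by (simp add: A_def B_def power_mult_distrib)
      qed
      have "- 2 * ((F (U x) *\<^sub>R (\<eta> x *\<^sub>R \<eta>g x)) \<bullet> H x) \<le> 2 * (F (U x) * (\<bar>\<eta> x\<bar> * \<bar>\<eta>g x \<bullet> H x\<bar>))"
      proof -
        have "- ((F (U x) *\<^sub>R (\<eta> x *\<^sub>R \<eta>g x)) \<bullet> H x) \<le> \<bar>F (U x) * (\<eta> x * (\<eta>g x \<bullet> H x))\<bar>" by simp
        also have "\<dots> = F (U x) * (\<bar>\<eta> x\<bar> * \<bar>\<eta>g x \<bullet> H x\<bar>)" using F(3) by (simp add: abs_mult)
        finally show ?thesis by linarith
      qed
      also have "\<dots> \<le> 2 * ((p * s) * (\<bar>\<eta> x\<bar> * (norm (\<eta>g x) * norm (H x))))"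
      proof (rule mult_left_mono[OF mult_mono])
        show "F (U x) \<le> p * s" unfolding p_def s_def by (rule Fs)
        show "\<bar>\<eta> x\<bar> * \<bar>\<eta>g x \<bullet> H x\<bar> \<le> \<bar>\<eta> x\<bar> * (norm (\<eta>g x) * norm (H x))"
          by (rule mult_left_mono[OF Cauchy_Schwarz_ineq2]) simp
        show "0 \<le> p * s" using p s by simp
      qed simp_all
      also have "\<dots> = p * (2 * (\<bar>\<eta> x\<bar> * norm (H x)) * (s * norm (\<eta>g x)))" by (simp only: mult_ac)
      also have "\<dots> \<le> p * (1/2 * ((\<eta> x)\<^sup>2 * (G x \<bullet> H x)) + 2 * Lam * (s\<^sup>2 * (norm (\<eta>g x))\<^sup>2))"
        by (rule mult_left_mono[OF young p(1)])
      also have "\<dots> = 1/2 * (((\<eta> x)\<^sup>2 * p) * (G x \<bullet> H x)) + p * (2 * Lam * (s\<^sup>2 * (norm (\<eta>g x))\<^sup>2))"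
        by (simp add: algebra_simps)
      also have "p * (2 * Lam * (s\<^sup>2 * (norm (\<eta>g x))\<^sup>2)) \<le> 2 * Lam * (s\<^sup>2 * (norm (\<eta>g x))\<^sup>2)"
        using p Lp by (intro mult_left_le_one_le) auto
      finally show ?case by (simp add: p_def s_def)
    qed
  qed
  also have "\<dots> = 1/2 * X + 2 * Lam * Z"
    unfolding X_def Z_def using Xi Zi by simp
  \<comment> \<open>From \<open>X <= - 2 * Y\<close> and the bound just found, half of
    \<open>X\<close> is absorbed on the left.\<close>
  finally have X: "X \<le> 4 * Lam * Z" using XY by simp
  have "lam * W = (LBINT x. lam * (((\<eta> x)\<^sup>2 * F' (U x)) * (G x \<bullet> G x)))"
    unfolding W_def by (rule integral_mult_right_zero[symmetric])
  also have "\<dots> \<le> X" unfolding X_def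
  proof (rule integral_mono_AE[OF integrable_mult_right[OF Wi] Xi])
    show "AE x in lborel. lam * (((\<eta> x)\<^sup>2 * F' (U x)) * (G x \<bullet> G x)) \<le> ((\<eta> x)\<^sup>2 * F' (U x)) * (G x \<bullet> H x)"
      using ellipticity
    proof eventually_elim
      case (elim x)
      have "((\<eta> x)\<^sup>2 * F' (U x)) * (lam * (G x \<bullet> G x)) \<le> ((\<eta> x)\<^sup>2 * F' (U x)) * (G x \<bullet> H x)"
        using elim F' by (intro mult_left_mono) (auto simp: power2_norm_eq_inner)
      then show ?case by (simp add: mult_ac)
    qed
  qed
  finally have "W \<le> 4 * (Lam / lam) * Z" using X lam_pos by (simp add: field_simps)
  moreover have VZ: "V \<le> Z" unfolding V_def Z_def
  proof (rule integral_mono[OF Vi Zi])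
    fix x
    have "(F (U x))\<^sup>2 \<le> (max 0 (U x - c))\<^sup>2" using Fle F(3) by (intro power_mono) auto
    then have "(F (U x))\<^sup>2 * (norm (\<eta>g x))\<^sup>2 \<le> (max 0 (U x - c))\<^sup>2 * (norm (\<eta>g x))\<^sup>2" by (rule mult_right_mono) simp
    then show "(F (U x) *\<^sub>R \<eta>g x) \<bullet> (F (U x) *\<^sub>R \<eta>g x) \<le> (max 0 (U x - c))\<^sup>2 * (norm (\<eta>g x))\<^sup>2"
      by (simp add: power2_norm_eq_inner power2_eq_square[of "F (U x)"])
  qed
  moreover have "Z \<le> (Lam / lam) * Z"
  proof -
    have "Z \<ge> 0" by (simp add: Z_def)
    then have "1 * Z \<le> (Lam / lam) * Z" using lam_pos lam_le by (intro mult_right_mono) auto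
    then show ?thesis by simp
  qed
  \<comment> \<open>The origin of the constant 10: 8 from the gradient of \<open>U\<close> and 2
    from that of the cutoff, the latter enlarged by \<open>Lam / lam >= 1\<close>.\<close>
  ultimately have WV: "2 * W + 2 * V \<le> 10 * (Lam / lam) * Z" by linarith
  let ?q = "\<lambda>n x. ennreal ((\<eta> (x + h) * F (mollify (k n) U (x + h)) - \<eta> x * F (mollify (k n) U x))\<^sup>2)"
  \<comment> \<open>Fatou's lemma is enough for the translated energy, as only an upper bound has to
    survive the limit.\<close>
  have "(\<integral>\<^sup>+x. ennreal ((\<eta> (x + h) * F (U (x + h)) - \<eta> x * F (U x))\<^sup>2) \<partial>lborel)
    \<le> (\<integral>\<^sup>+x. liminf (\<lambda>n. ?q n x) \<partial>lborel)"
  proof (rule nn_integral_mono_AE)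
    show "AE x in lborel. ennreal ((\<eta> (x + h) * F (U (x + h)) - \<eta> x * F (U x))\<^sup>2) \<le> liminf (\<lambda>n. ?q n x)"
      using ae AE_translate[OF ae, of h]
    proof eventually_elim
      case (elim x)
      have iF: "isCont F t" for t using F(1) DERIV_isCont by blast
      have "(\<lambda>n. ?q n x) \<longlonglongrightarrow> ennreal ((\<eta> (x + h) * F (U (x + h)) - \<eta> x * F (U x))\<^sup>2)"
        by (intro tendsto_ennrealI tendsto_power tendsto_diff tendsto_mult tendsto_const
            isCont_tendsto_compose[OF iF] elim)
      then have "liminf (\<lambda>n. ?q n x) = ennreal ((\<eta> (x + h) * F (U (x + h)) - \<eta> x * F (U x))\<^sup>2)"
        by (intro lim_imp_Liminf) simp_all
      then show ?case by (simp only: order_refl)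
    qed
  qed
  also have "\<dots> \<le> liminf (\<lambda>n. \<integral>\<^sup>+x. ?q n x \<partial>lborel)"
    by (rule nn_integral_liminf) measurable
  also have "\<dots> \<le> liminf (\<lambda>n. ennreal ((norm h)\<^sup>2 * (2 * (LBINT x. ((\<eta> x)\<^sup>2 * F' (mollify (k n) U x)) * (mollify (k n) G x \<bullet> mollify (k n) G x))
       + 2 * (LBINT x. (F (mollify (k n) U x) *\<^sub>R \<eta>g x) \<bullet> (F (mollify (k n) U x) *\<^sub>R \<eta>g x)))))"
    by (intro Liminf_mono always_eventually allI mollified_translation_energy[OF k(1-5) \<eta> F(1,2) F'])
  also have "\<dots> = ennreal ((norm h)\<^sup>2 * (2 * W + 2 * V))"
  proof (rule lim_imp_Liminf)
    show "(\<lambda>n. ennreal ((norm h)\<^sup>2 * (2 * (LBINT x. ((\<eta> x)\<^sup>2 * F' (mollify (k n) U x)) * (mollify (k n) G x \<bullet> mollify (k n) G x))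
       + 2 * (LBINT x. (F (mollify (k n) U x) *\<^sub>R \<eta>g x) \<bullet> (F (mollify (k n) U x) *\<^sub>R \<eta>g x)))))
      \<longlonglongrightarrow> ennreal ((norm h)\<^sup>2 * (2 * W + 2 * V))"
      unfolding W_def V_def by (intro tendsto_ennrealI tendsto_intros T3 T4[unfolded mult_1])
  qed simp
  also have "\<dots> \<le> ennreal ((norm h)\<^sup>2 * (10 * (Lam / lam) * Z))"
    by (intro ennreal_leI mult_left_mono WV) auto
  finally show ?thesis unfolding Z_def .
qed

end

text \<open>Averaging \<open>\<integral> w x * w (x + h) dx \<ge> \<integral> w\<^sup>2 - |h|\<^sup>2 K / 2\<close> over \<open>h\<close> in the cube \<open>[0, s]\<^sup>d\<close> bounds
  \<open>s\<^sup>d (\<integral> w\<^sup>2 - d s\<^sup>2 K / 2)\<close> by \<open>(\<integral> w)\<^sup>2 \<le> m \<integral> w\<^sup>2\<close>. This replaces the Sobolev inequality.\<close>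

lemma faber_krahn_translation:
  fixes w :: "real^'n::finite \<Rightarrow> real"
  assumes [measurable]: "w \<in> borel_measurable borel" and nn: "\<And>x. w x \<ge> 0"
    and w2: "integrable lborel (\<lambda>x. (w x)\<^sup>2)"
    and A [measurable]: "A \<in> sets borel" and w0: "\<And>x. x \<notin> A \<Longrightarrow> w x = 0"
    and m: "emeasure lborel A \<le> ennreal m" "m \<ge> 0" and s: "s > 0" "2 * m \<le> s ^ CARD('n)" and K: "K \<ge> 0"
    and tr: "\<And>h. (\<integral>\<^sup>+x. ennreal ((w (x + h) - w x)\<^sup>2) \<partial>lborel) \<le> ennreal ((norm h)\<^sup>2 * K)"
  shows "(LBINT x. (w x)\<^sup>2) \<le> real CARD('n) * s\<^sup>2 * K"
proof -
  define d where "d = real CARD('n)"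
  define I where "I = (LBINT x. (w x)\<^sup>2)"
  \<comment> \<open>A lower bound for the correlation of \<open>w\<close> with its shift by any h in
    the cube, where |h|^2 <= d s^2. It may be negative; \<open>ennreal c\<close> is then 0 and that
    case is settled by sign at the end.\<close>
  define c where "c = I - d * s\<^sup>2 * K / 2"
  define Q where "Q = cbox (0::real^'n) (\<chi> i. s)"
  have I0: "I \<ge> 0" by (simp add: I_def)
  have Q: "emeasure lborel Q = ennreal (s ^ CARD('n))"
  proof -
    have "emeasure lborel Q = ennreal (\<Prod>b\<in>Basis. ((\<chi> i. s) - (0::real^'n)) \<bullet> b)"
      unfolding Q_def using s by (intro emeasure_lborel_cbox) (auto simp: Basis_vec_def inner_axis)
    also have "(\<Prod>b\<in>Basis. ((\<chi> i. s) - (0::real^'n)) \<bullet> b) = (\<Prod>b\<in>(Basis::(real^'n) set). s)"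
      by (intro prod.cong) (auto simp: Basis_vec_def inner_axis)
    finally show ?thesis by simp
  qed
  have cross: "ennreal c \<le> (\<integral>\<^sup>+x. ennreal (w x) * ennreal (w (x + h)) \<partial>lborel)" if h: "h \<in> Q" for h
  proof -
    have "(norm h)\<^sup>2 = (\<Sum>i\<in>UNIV. (h $ i)\<^sup>2)" by (simp add: norm_vec_def L2_set_def sum_nonneg)
    also have "\<dots> \<le> (\<Sum>i\<in>(UNIV::'n set). s\<^sup>2)"
      using h by (intro sum_mono power_mono) (auto simp: Q_def mem_box_cart)
    finally have nh: "(norm h)\<^sup>2 \<le> d * s\<^sup>2" by (simp add: d_def)
    have t2: "integrable lborel (\<lambda>x. (w (x + h))\<^sup>2)" by (rule integrable_translate[OF w2])
    have I': "(LBINT x. (w (x + h))\<^sup>2) = I"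
      unfolding I_def by (rule integral_translate[of "\<lambda>x. (w x)\<^sup>2"]) simp
    have wm: "w \<in> borel_measurable lborel" "(\<lambda>x. w (x + h)) \<in> borel_measurable lborel" by simp_all
    have pi: "integrable lborel (\<lambda>x. w x * w (x + h))"
      using L2_inner_integrable(2)[OF wm] w2 t2 by simp
    have di: "integrable lborel (\<lambda>x. (w (x + h) - w x)\<^sup>2)"
      using L2_norm_diff_integrable[OF wm(2,1)] w2 t2 by simp
    have "ennreal (LBINT x. (w (x + h) - w x)\<^sup>2) \<le> ennreal ((norm h)\<^sup>2 * K)"
      using tr[of h] nn_integral_eq_integral[OF di] by simp
    then have "(LBINT x. (w (x + h) - w x)\<^sup>2) \<le> (norm h)\<^sup>2 * K" using K by (simp add: ennreal_le_iff)
    also have "\<dots> \<le> d * s\<^sup>2 * K" by (rule mult_right_mono[OF nh K])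
    finally have le: "(LBINT x. (w (x + h) - w x)\<^sup>2) \<le> d * s\<^sup>2 * K" .
    have "(\<lambda>x. (w (x + h) - w x)\<^sup>2) = (\<lambda>x. (w (x + h))\<^sup>2 + (w x)\<^sup>2 - 2 * (w x * w (x + h)))"
      by (auto simp: power2_eq_square algebra_simps)
    then have "(LBINT x. (w (x + h) - w x)\<^sup>2) = I + I - 2 * (LBINT x. w x * w (x + h))"
      using t2 w2 pi I' by (simp add: I_def)
    then have "c \<le> (LBINT x. w x * w (x + h))" using le by (simp add: c_def)
    then have "ennreal c \<le> ennreal (LBINT x. w x * w (x + h))" by (rule ennreal_leI)
    also have "\<dots> = (\<integral>\<^sup>+x. ennreal (w x * w (x + h)) \<partial>lborel)"
      by (rule nn_integral_eq_integral[symmetric, OF pi]) (simp add: nn)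
    finally show ?thesis by (simp add: ennreal_mult nn)
  qed
  have "ennreal (s ^ CARD('n)) * ennreal c = (\<integral>\<^sup>+h. ennreal c * indicator Q h \<partial>lborel)"
    by (subst nn_integral_cmult_indicator) (simp_all add: Q mult.commute, simp add: Q_def)
  \<comment> \<open>Since \<open>w >= 0\<close>, the cube may be enlarged to the whole space; this
    decouples the variables and the double integral becomes the square of the integral of
    \<open>w\<close>.\<close>
  also have "\<dots> \<le> (\<integral>\<^sup>+h. (\<integral>\<^sup>+x. ennreal (w x) * ennreal (w (x + h)) \<partial>lborel) \<partial>lborel)"
    by (intro nn_integral_mono) (auto simp: indicator_def cross)
  also have "\<dots> = (\<integral>\<^sup>+x. (\<integral>\<^sup>+h. ennreal (w x) * ennreal (w (x + h)) \<partial>lborel) \<partial>lborel)"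
    by (rule lborel_pair.Fubini') measurable
  also have "\<dots> = (\<integral>\<^sup>+x. ennreal (w x) * (\<integral>\<^sup>+h. ennreal (w h) \<partial>lborel) \<partial>lborel)"
  proof (rule nn_integral_cong)
    fix x
    have "(\<integral>\<^sup>+h. ennreal (w (h + x)) \<partial>lborel) = (\<integral>\<^sup>+h. ennreal (w h) \<partial>lborel)"
      by (rule nn_integral_translate[of "\<lambda>h. ennreal (w h)"]) simp
    then show "(\<integral>\<^sup>+h. ennreal (w x) * ennreal (w (x + h)) \<partial>lborel) = ennreal (w x) * (\<integral>\<^sup>+h. ennreal (w h) \<partial>lborel)"
      by (simp add: nn_integral_cmult add.commute)
  qed
  also have "\<dots> = (\<integral>\<^sup>+x. ennreal (w x) \<partial>lborel)\<^sup>2" by (simp add: nn_integral_multc power2_eq_square)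
  also have "(\<integral>\<^sup>+x. ennreal (w x) \<partial>lborel) = (\<integral>\<^sup>+x. indicator A x * ennreal (w x) \<partial>lborel)"
    using w0 by (intro nn_integral_cong) (auto simp: indicator_def)
  also have "\<dots>\<^sup>2 \<le> (\<integral>\<^sup>+x. (indicator A x)\<^sup>2 \<partial>lborel) * (\<integral>\<^sup>+x. (ennreal (w x))\<^sup>2 \<partial>lborel)"
    by (rule Cauchy_Schwarz_nn_integral) measurable
  also have "(\<integral>\<^sup>+x. (indicator A x)\<^sup>2 \<partial>lborel) = (\<integral>\<^sup>+x. indicator A x \<partial>lborel)"
    by (intro nn_integral_cong) (auto simp: indicator_def)
  also have "\<dots> = emeasure lborel A" by simp
  also have "(\<integral>\<^sup>+x. (ennreal (w x))\<^sup>2 \<partial>lborel) = ennreal I"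
    using nn_integral_eq_integral[OF w2] by (simp add: ennreal_power nn I_def)
  also have "emeasure lborel A * ennreal I \<le> ennreal m * ennreal I" by (intro mult_right_mono m) simp
  finally have "ennreal (s ^ CARD('n)) * ennreal c \<le> ennreal (m * I)" by (simp add: ennreal_mult m I0)
  then have "s ^ CARD('n) * c \<le> m * I"
  proof (cases "c \<ge> 0")
    case False
    then have "s ^ CARD('n) * c \<le> 0" using s by (simp add: mult_nonneg_nonpos)
    moreover have "m * I \<ge> 0" using m I0 by simp
    ultimately show ?thesis by linarith
  qed (use s m I0 in \<open>simp add: ennreal_le_iff flip: ennreal_mult\<close>)
  \<comment> \<open>The cube has at least twice the volume \<open>m\<close>, so half of
    \<open>I\<close> remains: I - d s^2 K / 2 <= I / 2.\<close>
  also have "\<dots> \<le> (s ^ CARD('n) / 2) * I" using s I0 by (intro mult_right_mono) auto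
  finally have "s ^ CARD('n) * c \<le> s ^ CARD('n) * (I / 2)" by simp
  then have "c \<le> I / 2" using s by (simp add: mult_le_cancel_left_pos)
  then show ?thesis by (simp add: c_def I_def d_def)
qed

subsection \<open>De Giorgi iteration\<close>

text \<open>The building block of both the cutoff and the truncation: squaring smooths the corner of
  the positive part just enough for class \<open>C^1\<close>.\<close>

lemma positive_part_square_deriv:
  "((\<lambda>t::real. (max 0 t)\<^sup>2) has_real_derivative 2 * max 0 t) (at t)"
proof -
  consider "t > 0" | "t < 0" | "t = 0" by linarith
  then show ?thesis
  proof cases
    case 1
    have "((\<lambda>t. t\<^sup>2) has_real_derivative 2 * max 0 t) (at t)"
      using 1 by (auto intro!: derivative_eq_intros)
    then show ?thesis
      by (rule has_field_derivative_transform_within_open[where S = "{0<..}"]) (use 1 in auto)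
  next
    case 2
    have "((\<lambda>t. 0) has_real_derivative 2 * max 0 t) (at t)" using 2 by auto
    then show ?thesis
      by (rule has_field_derivative_transform_within_open[where S = "{..<0}"]) (use 2 in auto)
  next
    case 3
    have "((\<lambda>h. (max 0 h)\<^sup>2 / h) \<longlongrightarrow> 0) (at (0::real))"
    proof (rule Lim_null_comparison)
      show "\<forall>\<^sub>F h in at 0. norm ((max 0 h)\<^sup>2 / h) \<le> \<bar>h\<bar>"
        by (rule always_eventually) (auto simp: max_def power2_eq_square)
      show "((\<lambda>h. \<bar>h\<bar>) \<longlongrightarrow> 0) (at (0::real))" by (auto intro!: tendsto_eq_intros)
    qed
    then show ?thesis using 3 by (simp add: DERIV_def)
  qed
qed

text \<open>A \<open>C^1\<close> step is composed with R^2 - |x|^2, which avoids the singularity of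
  the norm at the origin. Its layer has width (R - r)(R + r), at least \<open>R - r\<close> because
  \<open>1 <= R + r\<close>; a slope of at most 4 over the width times 2 |x| <= 2 gives the
  bound.\<close>

lemma cutoff_exists:
  fixes r R :: real
  assumes r: "0 < r" "r < R" "R \<le> 1" "1 \<le> R + r"
  obtains \<eta> :: "'a::euclidean_space \<Rightarrow> real" and \<eta>g where
    "C1_grad \<eta> \<eta>g" "\<And>x. 0 \<le> \<eta> x" "\<And>x. norm x \<le> r \<Longrightarrow> \<eta> x = 1" "\<And>x. norm x > R \<Longrightarrow> \<eta> x = 0"
    "\<And>x. norm (\<eta>g x) \<le> 8 / (R - r)"
proof -
  define A where "A = R\<^sup>2 - r\<^sup>2"
  have "A = (R - r) * (R + r)" by (simp add: A_def power2_eq_square algebra_simps)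
  moreover have "(R - r) * 1 \<le> (R - r) * (R + r)" using r by (intro mult_left_mono) auto
  ultimately have A: "R - r \<le> A" "A > 0" using r by auto
  \<comment> \<open>Equals 0 for t <= 0 and 1 for t >= A; both corners are rounded by squaring a
    positive part.\<close>
  define X where "X t = 1 - (max 0 (1 - (max 0 (t / A))\<^sup>2))\<^sup>2" for t :: real
  define X' where "X' t = (2 * max 0 (1 - (max 0 (t / A))\<^sup>2)) * (2 * max 0 (t / A) * (1 / A))" for t :: real
  have dX: "(X has_real_derivative X' t) (at t)" for t
  proof -
    have "((\<lambda>t. (max 0 (t / A))\<^sup>2) has_real_derivative 2 * max 0 (t / A) * (1 / A)) (at t)"
      by (rule DERIV_chain2[OF positive_part_square_deriv]) (use A in \<open>auto intro!: derivative_eq_intros\<close>)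
    then have "((\<lambda>t. 1 - (max 0 (t / A))\<^sup>2) has_real_derivative - (2 * max 0 (t / A) * (1 / A))) (at t)"
      using DERIV_diff[OF DERIV_const[of 1]] by fastforce
    from DERIV_chain2[OF positive_part_square_deriv this]
    have "((\<lambda>t. (max 0 (1 - (max 0 (t / A))\<^sup>2))\<^sup>2) has_real_derivative - X' t) (at t)"
      by (simp add: X'_def)
    from DERIV_diff[OF DERIV_const[of 1] this] show ?thesis by (simp add: X_def[abs_def])
  qed
  have cX: "continuous_on UNIV X'" unfolding X'_def[abs_def] using A by (intro continuous_intros) auto
  have X'b: "\<bar>X' t\<bar> \<le> 4 / A" for t
  proof -
    have "max 0 (1 - (max 0 (t / A))\<^sup>2) * max 0 (t / A) \<le> 1"
    proof (cases "t / A \<le> 1")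
      case True
      then have "max 0 (1 - (max 0 (t / A))\<^sup>2) * max 0 (t / A) \<le> 1 * 1" by (intro mult_mono) auto
      then show ?thesis by simp
    next
      case False
      then have "1 \<le> (max 0 (t / A))\<^sup>2" by (intro one_le_power) auto
      then show ?thesis by simp
    qed
    then have "4 * (max 0 (1 - (max 0 (t / A))\<^sup>2) * max 0 (t / A)) / A \<le> 4 * 1 / A"
      using A by (intro divide_right_mono mult_left_mono) auto
    moreover have "X' t = 4 * (max 0 (1 - (max 0 (t / A))\<^sup>2) * max 0 (t / A)) / A" by (simp add: X'_def)
    moreover have "X' t \<ge> 0" using A by (simp add: X'_def)
    ultimately show ?thesis by linarith
  qed
  define \<eta> where "\<eta> x = X (R\<^sup>2 - (norm (x - 0))\<^sup>2)" for x :: 'a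
  define \<eta>g where "\<eta>g x = X' (R\<^sup>2 - (norm (x - 0))\<^sup>2) *\<^sub>R (- (2 *\<^sub>R (x - 0)))" for x :: 'a
  show ?thesis
  proof (rule that[of \<eta> \<eta>g])
    show "C1_grad \<eta> \<eta>g" unfolding \<eta>_def[abs_def] \<eta>g_def[abs_def]
      by (rule C1_grad_compose[OF C1_grad_sq_dist dX cX])
    show "0 \<le> \<eta> x" for x
    proof -
      have "(max 0 (1 - q\<^sup>2))\<^sup>2 \<le> 1\<^sup>2" for q :: real by (intro power_mono) auto
      then show ?thesis by (simp add: \<eta>_def X_def)
    qed
    show "\<eta> x = 1" if "norm x \<le> r" for x
    proof -
      have "(norm x)\<^sup>2 \<le> r\<^sup>2" using that by (intro power_mono) auto
      then have "1 \<le> (R\<^sup>2 - (norm x)\<^sup>2) / A" using A by (simp add: A_def)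
      then have "1 \<le> (max 0 ((R\<^sup>2 - (norm x)\<^sup>2) / A))\<^sup>2" by (intro one_le_power) auto
      then show ?thesis by (simp add: \<eta>_def X_def)
    qed
    have out: "(R\<^sup>2 - (norm x)\<^sup>2) / A \<le> 0" if "norm x > R" for x :: 'a
    proof -
      have "R\<^sup>2 \<le> (norm x)\<^sup>2" using that r by (intro power_mono) auto
      then show ?thesis using A by (simp add: divide_nonpos_pos)
    qed
    show "\<eta> x = 0" if "norm x > R" for x using out[OF that] by (simp add: \<eta>_def X_def max_def)
    show "norm (\<eta>g x) \<le> 8 / (R - r)" for x
    proof (cases "norm x > R")
      case True
      then have "\<eta>g x = 0" using out[OF True] by (simp add: \<eta>g_def X'_def max_def)
      then show ?thesis using r by simp
    next
      case False
      have "norm (\<eta>g x) = \<bar>X' (R\<^sup>2 - (norm x)\<^sup>2)\<bar> * (2 * norm x)" by (simp add: \<eta>g_def abs_mult)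
      also have "\<dots> \<le> 4 / A * (2 * 1)" using False r X'b A by (intro mult_mono) auto
      also have "\<dots> = 8 / A" by simp
      also have "\<dots> \<le> 8 / (R - r)" using A r by (intro divide_left_mono) auto
      finally show ?thesis .
    qed
  qed
qed

text \<open>With \<open>s\<close> the positive part of \<open>t - c\<close> and \<open>q\<close> the
  square root of s^2 + \<delta>^2, all bounds reduce to s <= q and \<delta> <= q. In particular (q -
  \<delta>) q <= q^2 - \<delta>^2 = s^2 bounds \<open>F\<close> by \<open>F' s\<close>, and q >= s
  shows that at most \<delta> is lost against the true truncation.\<close>

lemma smooth_truncation:
  fixes c \<delta> :: real
  assumes \<delta>: "\<delta> > 0"
  defines "F \<equiv> \<lambda>t. sqrt ((max 0 (t - c))\<^sup>2 + \<delta>\<^sup>2) - \<delta>"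
    and "F' \<equiv> \<lambda>t. max 0 (t - c) / sqrt ((max 0 (t - c))\<^sup>2 + \<delta>\<^sup>2)"
  shows "(F has_real_derivative F' t) (at t)" "continuous_on UNIV F'" "0 \<le> F t" "0 \<le> F' t" "F' t \<le> 1"
    "F t \<le> F' t * max 0 (t - c)" "max 0 (t - c - \<delta>) \<le> F t" "t \<le> c \<Longrightarrow> F t = 0"
proof -
  have pos: "(max 0 (t - c))\<^sup>2 + \<delta>\<^sup>2 > 0" for t using \<delta> by (simp add: add_nonneg_pos)
  have "((\<lambda>t. (max 0 (t - c))\<^sup>2) has_real_derivative 2 * max 0 (t - c) * 1) (at t)"
    by (rule DERIV_chain2[OF positive_part_square_deriv]) (auto intro!: derivative_eq_intros)
  then have "((\<lambda>t. (max 0 (t - c))\<^sup>2 + \<delta>\<^sup>2) has_real_derivative 2 * max 0 (t - c)) (at t)"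
    using DERIV_add[OF _ DERIV_const[of "\<delta>\<^sup>2"]] by fastforce
  then have "((\<lambda>t. sqrt ((max 0 (t - c))\<^sup>2 + \<delta>\<^sup>2)) has_real_derivative
      inverse (sqrt ((max 0 (t - c))\<^sup>2 + \<delta>\<^sup>2)) / 2 * (2 * max 0 (t - c))) (at t)"
    by (rule DERIV_chain2[where f = sqrt and g = "\<lambda>t. (max 0 (t - c))\<^sup>2 + \<delta>\<^sup>2", OF DERIV_real_sqrt[OF pos]])
  moreover have "inverse q / 2 * (2 * s) = s / q" for q s :: real by (cases "q = 0") (auto simp: field_simps)
  ultimately have "((\<lambda>t. sqrt ((max 0 (t - c))\<^sup>2 + \<delta>\<^sup>2)) has_real_derivative F' t) (at t)"
    by (simp only: F'_def)
  from DERIV_diff[OF this DERIV_const[of \<delta>]] show "(F has_real_derivative F' t) (at t)"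
    by (simp add: F_def)
  show "continuous_on UNIV F'" unfolding F'_def using pos by (intro continuous_intros) (metis less_irrefl real_sqrt_gt_0_iff)
  define s where "s = max 0 (t - c)"
  define q where "q = sqrt (s\<^sup>2 + \<delta>\<^sup>2)"
  have s0: "s \<ge> 0" by (simp add: s_def)
  have q: "q > 0" "q\<^sup>2 = s\<^sup>2 + \<delta>\<^sup>2" using pos[of t] by (auto simp: q_def s_def)
  have q\<delta>: "\<delta> \<le> q" unfolding q_def by (rule real_le_rsqrt) simp
  have qs: "s \<le> q" unfolding q_def by (rule real_le_rsqrt) simp
  have F: "F t = q - \<delta>" "F' t = s / q" by (simp_all add: F_def F'_def s_def q_def)
  show "0 \<le> F t" "0 \<le> F' t" "F' t \<le> 1" using q\<delta> qs q s0 by (auto simp: F)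
  have "\<delta> * \<delta> \<le> \<delta> * q" using q\<delta> \<delta> by (intro mult_left_mono) auto
  then have "(q - \<delta>) * q \<le> s * s" using q(2) by (simp add: power2_eq_square algebra_simps)
  then show "F t \<le> F' t * max 0 (t - c)" using q(1) by (simp add: F s_def[symmetric] field_simps)
  show "max 0 (t - c - \<delta>) \<le> F t" using q\<delta> qs by (auto simp: F s_def)
  show "t \<le> c \<Longrightarrow> F t = 0" using \<delta> by (simp add: F_def)
qed

section \<open>The excess over a level and one step of the iteration\<close>

context divergence_subsolution
begin

definition excess :: "real \<Rightarrow> real \<Rightarrow> real" where
  "excess r k = (LBINT x. indicator (ball 0 r) x * (max 0 (U x - k))\<^sup>2)"

lemma excess_integrand_measurable [measurable]:
  "(\<lambda>x. indicator (ball 0 r) x * (max 0 (U x - k))\<^sup>2) \<in> borel_measurable borel"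
proof -
  have [measurable]: "ball (0::real^'n) r \<in> sets borel" by simp
  show ?thesis by measurable
qed

lemma excess_integrable:
  assumes "k \<ge> 0"
  shows "integrable lborel (\<lambda>x. indicator (ball 0 r) x * (max 0 (U x - k))\<^sup>2)"
proof (rule Bochner_Integration.integrable_bound[OF U_L2])
  show "AE x in lborel. norm (indicator (ball 0 r) x * (max 0 (U x - k))\<^sup>2) \<le> norm ((U x)\<^sup>2)"
  proof (rule AE_I2)
    fix x
    have "\<bar>max 0 (U x - k)\<bar> \<le> \<bar>U x\<bar>" using assms by linarith
    then have "(max 0 (U x - k))\<^sup>2 \<le> (U x)\<^sup>2" by (simp only: abs_le_square_iff)
    then show "norm (indicator (ball 0 r) x * (max 0 (U x - k))\<^sup>2) \<le> norm ((U x)\<^sup>2)"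
      by (auto simp: indicator_def)
  qed
qed (use excess_integrand_measurable in simp)

text \<open>The level rises by \<delta> twice. The truncation starts at k + \<delta>, so that
  Chebyshev bounds the set where it is nonzero by the excess over \<open>k\<close>; its smoothing
  loses another \<delta>. The strict \<open>R < \<rho>\<close> puts the closed ball carrying the
  cutoff inside the open ball of the excess.\<close>

lemma De_Giorgi_step:
  assumes r: "0 < r" "r < R" "R < \<rho>" "\<rho> \<le> 1" "1 \<le> R + r" and k: "k \<ge> 0" and \<delta>: "\<delta> > 0"
    and m: "excess \<rho> k \<le> m * \<delta>\<^sup>2" "m \<ge> 0" and s: "s > 0" "2 * m \<le> s ^ CARD('n)"
  shows "excess r (k + 2 * \<delta>) \<le> real CARD('n) * s\<^sup>2 * (10 * (Lam / lam) * ((8 / (R - r))\<^sup>2 * excess \<rho> k))"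
proof -
  obtain \<eta> :: "real^'n \<Rightarrow> real" and \<eta>g where \<eta>: "C1_grad \<eta> \<eta>g" "\<And>x. 0 \<le> \<eta> x" "\<And>x. norm x \<le> r \<Longrightarrow> \<eta> x = 1"
    "\<And>x. norm x > R \<Longrightarrow> \<eta> x = 0" "\<And>x. norm (\<eta>g x) \<le> 8 / (R - r)"
    by (rule cutoff_exists[of r R, where 'a = "real^'n"]) (use r in auto)
  have \<eta>gR: "norm x > R \<Longrightarrow> \<eta>g x = 0" for x by (rule C1_grad_support_grad[OF \<eta>(1,4)])
  define F where "F t = sqrt ((max 0 (t - (k + \<delta>)))\<^sup>2 + \<delta>\<^sup>2) - \<delta>" for t
  define F' where "F' t = max 0 (t - (k + \<delta>)) / sqrt ((max 0 (t - (k + \<delta>)))\<^sup>2 + \<delta>\<^sup>2)" for t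
  have tr: "(F has_real_derivative F' t) (at t)" "continuous_on UNIV F'" "0 \<le> F t" "0 \<le> F' t" "F' t \<le> 1"
    "F t \<le> F' t * max 0 (t - (k + \<delta>))" "max 0 (t - (k + \<delta>) - \<delta>) \<le> F t" for t
    unfolding F_def[abs_def] F'_def[abs_def] by (rule smooth_truncation[OF \<delta>])+
  have F0: "F t = 0" if "t \<le> k + \<delta>" for t
    unfolding F_def by (rule smooth_truncation(8)[OF \<delta> that])
  have cF: "continuous_on UNIV F" by (meson DERIV_isCont tr(1) continuous_at_imp_continuous_on)
  note [measurable] = borel_measurable_continuous_onI[OF C1_grad_continuous[OF \<eta>(1)]]
    borel_measurable_continuous_onI[OF C1_grad_continuous_grad[OF \<eta>(1)]] borel_measurable_continuous_onI[OF cF]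
  define w where "w x = \<eta> x * F (U x)" for x
  have wm [measurable]: "w \<in> borel_measurable borel" unfolding w_def[abs_def] by measurable
  define Z where "Z = (LBINT x. (max 0 (U x - (k + \<delta>)))\<^sup>2 * (norm (\<eta>g x))\<^sup>2)"
  have en: "(\<integral>\<^sup>+x. ennreal ((w (x + h) - w x)\<^sup>2) \<partial>lborel) \<le> ennreal ((norm h)\<^sup>2 * (10 * (Lam / lam) * Z))" for h
    unfolding w_def Z_def using r k \<delta>
    by (intro truncation_energy[OF _ \<eta>(1,4) tr(1-6)]) auto
  note ei = excess_integrable[OF k, of \<rho>]
  have Zle: "Z \<le> (8 / (R - r))\<^sup>2 * excess \<rho> k"
  proof -
    have "Z \<le> (LBINT x. (8 / (R - r))\<^sup>2 * (indicator (ball 0 \<rho>) x * (max 0 (U x - k))\<^sup>2))"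
      unfolding Z_def
    proof (rule Bochner_Integration.integral_mono')
      show "integrable lborel (\<lambda>x. (8 / (R - r))\<^sup>2 * (indicator (ball 0 \<rho>) x * (max 0 (U x - k))\<^sup>2))"
        by (rule integrable_mult_right[OF ei])
      fix x
      show "(max 0 (U x - (k + \<delta>)))\<^sup>2 * (norm (\<eta>g x))\<^sup>2 \<le> (8 / (R - r))\<^sup>2 * (indicator (ball 0 \<rho>) x * (max 0 (U x - k))\<^sup>2)"
      proof (cases "norm x > R")
        case False
        have "(max 0 (U x - (k + \<delta>)))\<^sup>2 * (norm (\<eta>g x))\<^sup>2 \<le> (max 0 (U x - k))\<^sup>2 * (8 / (R - r))\<^sup>2"
          using \<delta> by (intro mult_mono power_mono \<eta>(5)) auto
        then show ?thesis using False r by (simp add: indicator_def mult.commute)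
      qed (simp add: \<eta>gR)
    qed simp
    also have "\<dots> = (8 / (R - r))\<^sup>2 * excess \<rho> k"
      unfolding excess_def by (rule integral_mult_right_zero)
    finally show ?thesis .
  qed
  have \<eta>R: "\<eta> x \<noteq> 0 \<Longrightarrow> norm x \<le> R" for x using \<eta>(4)[of x] by linarith
  obtain M where M: "M \<ge> 0" "\<And>x. norm (\<eta> x) \<le> M"
    using compact_support_bounded[OF C1_grad_continuous[OF \<eta>(1)] \<eta>(4)] by blast
  have w2: "integrable lborel (\<lambda>x. (w x)\<^sup>2)"
  proof (rule Bochner_Integration.integrable_bound)
    show "integrable lborel (\<lambda>x. M\<^sup>2 * (U x)\<^sup>2)" using U_L2 by simp
    show "AE x in lborel. norm ((w x)\<^sup>2) \<le> norm (M\<^sup>2 * (U x)\<^sup>2)"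
    proof (rule AE_I2)
      fix x
      have "F (U x) \<le> max 0 (U x - (k + \<delta>))"
        by (rule order_trans[OF tr(6)]) (simp add: tr(4,5) mult_left_le_one_le)
      then have "\<bar>F (U x)\<bar> \<le> \<bar>U x\<bar>" using tr(3)[of "U x"] k \<delta> by linarith
      then have "\<bar>w x\<bar> \<le> M * \<bar>U x\<bar>" unfolding w_def abs_mult using M by (intro mult_mono) auto
      then have "\<bar>w x\<bar>\<^sup>2 \<le> (M * \<bar>U x\<bar>)\<^sup>2" by (intro power_mono) auto
      then show "norm ((w x)\<^sup>2) \<le> norm (M\<^sup>2 * (U x)\<^sup>2)" by (simp add: power_mult_distrib)
    qed
  qed measurable
  define A where "A = {x \<in> ball 0 \<rho>. U x > k + \<delta>}"
  have A [measurable]: "A \<in> sets borel" unfolding A_def by measurable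
  have wA: "w x = 0" if "x \<notin> A" for x
  proof (cases "U x \<le> k + \<delta>")
    case False
    then have "norm x > R" using that r by (auto simp: A_def)
    then show ?thesis by (simp add: w_def \<eta>(4))
  qed (simp add: w_def F0)
  have Am: "emeasure lborel A \<le> ennreal m"
  proof -
    have "ennreal (\<delta>\<^sup>2) * emeasure lborel A = (\<integral>\<^sup>+x. ennreal (\<delta>\<^sup>2) * indicator A x \<partial>lborel)"
      by (simp add: nn_integral_cmult_indicator)
    also have "\<dots> \<le> (\<integral>\<^sup>+x. ennreal (indicator (ball 0 \<rho>) x * (max 0 (U x - k))\<^sup>2) \<partial>lborel)"
    proof (rule nn_integral_mono)
      fix x
      show "ennreal (\<delta>\<^sup>2) * indicator A x \<le> ennreal (indicator (ball 0 \<rho>) x * (max 0 (U x - k))\<^sup>2)"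
      proof (cases "x \<in> A")
        case True
        then have "\<delta>\<^sup>2 \<le> (max 0 (U x - k))\<^sup>2" using \<delta> by (intro power_mono) (auto simp: A_def)
        then show ?thesis using True by (auto simp: A_def intro: ennreal_leI)
      qed simp
    qed
    also have "\<dots> = ennreal (excess \<rho> k)"
      unfolding excess_def by (rule nn_integral_eq_integral[OF ei]) auto
    also have "\<dots> \<le> ennreal (\<delta>\<^sup>2) * ennreal m" using m by (simp add: mult.commute flip: ennreal_mult)
    finally have le: "ennreal (\<delta>\<^sup>2) * emeasure lborel A \<le> ennreal (\<delta>\<^sup>2) * ennreal m" .
    \<comment> \<open>Finiteness of the measure permits cancelling \<delta>^2 among real
      numbers.\<close>
    have "A \<subseteq> cball 0 \<rho>" by (auto simp: A_def)
    then have "emeasure lborel A \<le> emeasure lborel (cball (0::real^'n) \<rho>)" by (intro emeasure_mono) auto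
    then have fin: "emeasure lborel A \<noteq> \<infinity>"
      using emeasure_bounded_finite[of "cball (0::real^'n) \<rho>"] by auto
    then obtain a where a: "emeasure lborel A = ennreal a" "a \<ge> 0" by (metis ennreal_cases infinity_ennreal_def)
    have "\<delta>\<^sup>2 * a \<le> \<delta>\<^sup>2 * m" using le a m by (simp flip: ennreal_mult)
    then show ?thesis using \<delta> a m by (simp add: mult_le_cancel_left_pos)
  qed
  have K0: "10 * (Lam / lam) * Z \<ge> 0" using lam_pos lam_le by (simp add: Z_def)
  have "excess r (k + 2 * \<delta>) \<le> (LBINT x. (w x)\<^sup>2)"
    unfolding excess_def
  proof (rule Bochner_Integration.integral_mono'[OF w2])
    fix x
    show "indicator (ball 0 r) x * (max 0 (U x - (k + 2 * \<delta>)))\<^sup>2 \<le> (w x)\<^sup>2"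
    proof (cases "x \<in> ball 0 r")
      case True
      then have "w x = F (U x)" using \<eta>(3)[of x] by (simp add: w_def)
      moreover have "max 0 (U x - (k + 2 * \<delta>)) \<le> F (U x)" using tr(7)[of "U x"] by (simp add: algebra_simps)
      ultimately have "(max 0 (U x - (k + 2 * \<delta>)))\<^sup>2 \<le> (w x)\<^sup>2" by (intro power_mono) auto
      then show ?thesis using True by simp
    qed simp
  qed simp
  also have "\<dots> \<le> real CARD('n) * s\<^sup>2 * (10 * (Lam / lam) * Z)"
    by (rule faber_krahn_translation[OF wm _ w2 A wA Am m(2) s K0 en]) (simp add: w_def \<eta>(2) tr(3))
  also have "\<dots> \<le> real CARD('n) * s\<^sup>2 * (10 * (Lam / lam) * ((8 / (R - r))\<^sup>2 * excess \<rho> k))"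
    using Zle lam_pos lam_le by (intro mult_left_mono) auto
  finally show ?thesis .
qed

end

text \<open>With \<open>\<sigma> = 2\<^bsup>-d\<^esup> / 4\<close> and cubes of side \<open>s\<^sub>0 2\<^bsup>-j\<^esup>\<close> in step \<open>j\<close>, the excess contracts by \<open>\<sigma>\<close>
  as soon as \<open>40960 d q s\<^sub>0\<^sup>2 = \<sigma>\<close>, where \<open>40960 = 10 * 64\<^sup>2\<close> stems from the energy estimate, and
  the cubes are large enough if the threshold is \<open>s\<^sub>0\<^sup>d / 32\<close>.\<close>

definition De_Giorgi_threshold :: "nat \<Rightarrow> real \<Rightarrow> real" where
  "De_Giorgi_threshold d q = sqrt ((1 / 2) ^ d / 4 / (40960 * real d * q)) ^ d / 32"

lemma De_Giorgi_threshold_pos: "d > 0 \<Longrightarrow> q > 0 \<Longrightarrow> De_Giorgi_threshold d q > 0"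
  by (simp add: De_Giorgi_threshold_def)

context divergence_subsolution
begin

text \<open>The rate is forced by balance: level gaps halve, so Chebyshev multiplies the volume
  bound by 4 \<sigma> in each step, and 4 \<sigma> = 2^(-d) is exactly how the volume of the cubes
  shrinks. The squared side then falls by 4 and cancels the growth of the squared cutoff
  gradient.\<close>

lemma excess_decay:
  assumes K: "K > 0" and small: "excess 1 0 \<le> De_Giorgi_threshold CARD('n) (Lam / lam) * K\<^sup>2"
  shows "excess (1/2 + (1/2) ^ (j + 1)) (K * (1 - (1/2) ^ j))
    \<le> De_Giorgi_threshold CARD('n) (Lam / lam) * K\<^sup>2 * ((1/2) ^ CARD('n) / 4) ^ j"
proof (induction j)
  case 0
  then show ?case using small by simp
next
  case (Suc j)
  define d where "d = CARD('n)"
  define q where "q = Lam / lam"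
  define \<sigma> where "\<sigma> = (1/2 :: real) ^ d / 4"
  define s0 where "s0 = sqrt (\<sigma> / (40960 * real d * q))"
  define \<theta> where "\<theta> = De_Giorgi_threshold d q"
  have d0: "d > 0" and q0: "q > 0" and \<sigma>0: "\<sigma> > 0" using lam_pos lam_le by (simp_all add: d_def q_def \<sigma>_def)
  have s0: "s0 > 0" "s0\<^sup>2 = \<sigma> / (40960 * real d * q)" using d0 q0 \<sigma>0 by (simp_all add: s0_def)
  have \<theta>: "32 * \<theta> = s0 ^ d" "\<theta> > 0" using De_Giorgi_threshold_pos[OF d0 q0]
    by (simp_all add: \<theta>_def De_Giorgi_threshold_def s0_def \<sigma>_def)
  define p where "p = (1/2 :: real) ^ j"
  have p: "p > 0" "p \<le> 1" "p * 2 ^ j = 1" by (simp_all add: p_def power_le_one power_one_over)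
  define k where "k = K * (1 - p)"
  \<comment> \<open>Two such increments raise the level from K (1 - p) to K (1 - p / 2).\<close>
  define \<delta> where "\<delta> = K * p / 4"
  define \<rho> where "\<rho> = 1/2 + p / 2"
  \<comment> \<open>Midway between \<open>r\<close> and \<rho>, leaving a gap of p / 8 for the
    cutoff.\<close>
  define R where "R = 1/2 + 3 * p / 8"
  define r where "r = 1/2 + p / 4"
  define a where "a = excess \<rho> k"
  \<comment> \<open>Chebyshev's volume bound: the induction hypothesis divided by \<delta>^2, where
    1 / p^2 = 4^j.\<close>
  define m where "m = 16 * \<theta> * (4 * \<sigma>) ^ j"
  define s where "s = s0 * p"
  have IH: "a \<le> \<theta> * K\<^sup>2 * \<sigma> ^ j"
    using Suc by (simp add: a_def \<rho>_def k_def p_def \<theta>_def d_def q_def \<sigma>_def)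
  have "4 ^ j * p\<^sup>2 = 1"
  proof -
    have "(4::real) ^ j = 2 ^ j * 2 ^ j" using power_mult_distrib[of "2::real" 2 j] by simp
    then have "4 ^ j * p\<^sup>2 = (p * 2 ^ j) * (p * 2 ^ j)" by (simp only: power2_eq_square mult_ac)
    then show ?thesis by (simp only: p(3) mult_1)
  qed
  moreover have "m * \<delta>\<^sup>2 = (\<theta> * K\<^sup>2 * \<sigma> ^ j) * (4 ^ j * p\<^sup>2)"
    by (simp add: m_def \<delta>_def power_mult_distrib power_divide)
  ultimately have md: "m * \<delta>\<^sup>2 = \<theta> * K\<^sup>2 * \<sigma> ^ j" by simp
  have ps: "(4 * \<sigma>) ^ j = p ^ d"
  proof -
    have "4 * \<sigma> = (1/2) ^ d" by (simp add: \<sigma>_def)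
    then show ?thesis by (simp only: p_def power_mult[symmetric] mult.commute[of d j])
  qed
  have "2 * m = (32 * \<theta>) * (4 * \<sigma>) ^ j" by (simp only: m_def)
  also have "\<dots> = s ^ d" by (simp only: \<theta>(1) ps s_def power_mult_distrib[of s0 p])
  finally have sm: "2 * m \<le> s ^ d" by simp
  have "excess r (k + 2 * \<delta>) \<le> real CARD('n) * s\<^sup>2 * (10 * (Lam / lam) * ((8 / (R - r))\<^sup>2 * excess \<rho> k))"
  proof (rule De_Giorgi_step)
    show "excess \<rho> k \<le> m * \<delta>\<^sup>2" using IH by (simp add: md a_def)
    show "2 * m \<le> s ^ CARD('n)" using sm by (simp add: d_def)
    show "0 \<le> m" using \<theta> \<sigma>0 by (simp add: m_def)
    show "0 < s" using s0 p by (simp add: s_def)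
    show "0 \<le> k" using K p by (simp add: k_def)
    show "0 < \<delta>" using K p by (simp add: \<delta>_def)
  qed (use p in \<open>simp_all add: r_def R_def \<rho>_def\<close>)
  \<comment> \<open>The powers of \<open>p\<close> from the cube side and from the cutoff gradient
    cancel, so the factor does not depend on \<open>j\<close>.\<close>
  also have "\<dots> = \<sigma> * a"
  proof -
    have "8 / (R - r) = 64 / p" by (simp add: R_def r_def)
    then have "real CARD('n) * s\<^sup>2 * (10 * (Lam / lam) * ((8 / (R - r))\<^sup>2 * excess \<rho> k))
      = real d * (s0\<^sup>2 * p\<^sup>2) * (10 * q * ((64 / p)\<^sup>2 * a))"
      by (simp add: d_def q_def a_def s_def power_mult_distrib)
    also have "\<dots> = 40960 * real d * q * s0\<^sup>2 * a" using p by (simp add: field_simps power2_eq_square)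
    also have "\<dots> = \<sigma> * a" using d0 q0 by (simp add: s0(2))
    finally show ?thesis .
  qed
  also have "\<dots> \<le> \<sigma> * (\<theta> * K\<^sup>2 * \<sigma> ^ j)" using IH \<sigma>0 by (intro mult_left_mono) auto
  finally have "excess r (k + 2 * \<delta>) \<le> \<theta> * K\<^sup>2 * \<sigma> ^ Suc j" by (simp add: mult_ac)
  moreover have "r = 1/2 + (1/2) ^ (Suc j + 1)" by (simp add: r_def p_def)
  moreover have "k + 2 * \<delta> = K * (1 - (1/2) ^ Suc j)" by (simp add: k_def \<delta>_def p_def algebra_simps)
  ultimately show ?case by (simp only: \<theta>_def d_def q_def \<sigma>_def)
qed

text \<open>The ball of radius 1/2 is smaller and the level \<open>K\<close> at least as high as at
  every stage of the iteration, so the excess there lies below a null sequence; a nonnegative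
  function with zero integral vanishes almost everywhere.\<close>

lemma De_Giorgi_bound:
  assumes K: "K > 0" and small: "excess 1 0 \<le> De_Giorgi_threshold CARD('n) (Lam / lam) * K\<^sup>2"
  shows "AE x in lborel. x \<in> ball 0 (1/2) \<longrightarrow> U x \<le> K"
proof -
  let ?\<theta> = "De_Giorgi_threshold CARD('n) (Lam / lam)"
  let ?\<sigma> = "(1/2::real) ^ CARD('n) / 4"
  have le: "excess (1/2) K \<le> ?\<theta> * K\<^sup>2 * ?\<sigma> ^ j" for j
  proof -
    have "(1/2::real) ^ j \<le> 1" by (simp add: power_le_one)
    then have k0: "K * (1 - (1/2) ^ j) \<ge> 0" "K * (1 - (1/2) ^ j) \<le> K" using K by (auto simp: mult_left_le)
    have "excess (1/2) K \<le> excess (1/2 + (1/2) ^ (j + 1)) (K * (1 - (1/2) ^ j))"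
      unfolding excess_def
    proof (rule Bochner_Integration.integral_mono'[OF excess_integrable[OF k0(1)]])
      fix x
      show "indicator (ball 0 (1/2)) x * (max 0 (U x - K))\<^sup>2
        \<le> indicator (ball 0 (1/2 + (1/2) ^ (j + 1))) x * (max 0 (U x - K * (1 - (1/2) ^ j)))\<^sup>2"
      proof (rule mult_mono)
        have "0 < (1/2::real) ^ (j + 1)" by simp
        then have "ball (0::real^'n) (1/2) \<subseteq> ball 0 (1/2 + (1/2) ^ (j + 1))" by (intro subset_ball) linarith
        then show "indicator (ball 0 (1/2)) x \<le> (indicator (ball 0 (1/2 + (1/2) ^ (j + 1))) x :: real)"
          by (auto simp: indicator_def simp del: power_Suc)
        show "(max 0 (U x - K))\<^sup>2 \<le> (max 0 (U x - K * (1 - (1/2) ^ j)))\<^sup>2"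
          using k0 by (intro power_mono) auto
      qed auto
    qed simp
    then show ?thesis using excess_decay[OF K small, of j] by linarith
  qed
  have "?\<sigma> < 1"
  proof -
    have "(1/2::real) ^ CARD('n) \<le> 1" by (simp add: power_le_one)
    then show ?thesis by simp
  qed
  then have "(\<lambda>j. ?\<theta> * K\<^sup>2 * ?\<sigma> ^ j) \<longlonglongrightarrow> ?\<theta> * K\<^sup>2 * 0"
    by (intro tendsto_mult tendsto_const LIMSEQ_power_zero) simp
  then have "excess (1/2) K \<le> 0" using le by (intro LIMSEQ_le_const) auto
  moreover have "excess (1/2) K \<ge> 0" by (simp add: excess_def)
  ultimately have "excess (1/2) K = 0" by linarith
  then have "(LBINT x. indicator (ball 0 (1/2)) x * (max 0 (U x - K))\<^sup>2) = 0" unfolding excess_def .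
  then have "AE x in lborel. indicator (ball 0 (1/2)) x * (max 0 (U x - K))\<^sup>2 = 0"
    using K by (subst (asm) integral_nonneg_eq_0_iff_AE) (auto intro: excess_integrable)
  then show ?thesis
    by eventually_elim (auto simp: indicator_def max_def split: if_splits)
qed

end

theorem theorem2p1:
  assumes "CARD('n::finite) \<ge> 3"
  shows "\<exists>C\<^sub>D\<^sub>G :: real \<Rightarrow> real.
    \<forall>(a :: real ^ 'n \<Rightarrow> real ^ 'n ^ 'n) lam Lam (u :: real ^ 'n \<Rightarrow> real).
      elliptic_field (ball 0 1) a lam Lam \<longrightarrow>
      weak_subsolution (ball 0 1) a u \<longrightarrow>
      (\<lambda>x. max (u x) 0) \<in> L2 (ball 0 1) \<longrightarrow>
      (AE x in lebesgue_on (ball 0 (1/2)).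
         max (u x) 0 \<le> C\<^sub>D\<^sub>G (Lam / lam) * sqrt (\<integral>y. (max (u y) 0)\<^sup>2 \<partial>lebesgue_on (ball 0 1)))"
proof (intro exI[of _ "\<lambda>q. 1 / sqrt (De_Giorgi_threshold CARD('n) q)"] allI impI)
  fix a :: "real ^ 'n \<Rightarrow> real ^ 'n ^ 'n" and lam Lam and u :: "real ^ 'n \<Rightarrow> real"
  assume ell: "elliptic_field (ball 0 1) a lam Lam" and sub: "weak_subsolution (ball 0 1) a u"
  obtain U G H where data: "divergence_subsolution U G H lam Lam"
    and uU: "AE x in lborel. x \<in> ball 0 1 \<longrightarrow> u x = U x"
    by (rule weak_subsolution_borel_data[OF ell sub])
  interpret divergence_subsolution U G H lam Lam by (rule data)
  define \<theta> where "\<theta> = De_Giorgi_threshold CARD('n) (Lam / lam)"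
  have \<theta>: "\<theta> > 0" unfolding \<theta>_def using lam_pos lam_le by (intro De_Giorgi_threshold_pos) auto
  have "(\<integral>y. (max (u y) 0)\<^sup>2 \<partial>lebesgue_on (ball 0 1)) = (\<integral>y. indicator (ball 0 1) y * (max 0 (U y - 0))\<^sup>2 \<partial>lborel)"
  proof (rule borel_version_integral(1))
    show "AE x in lborel. x \<in> ball 0 1 \<longrightarrow> (max (u x) 0)\<^sup>2 = indicator (ball 0 1) x * (max 0 (U x - 0))\<^sup>2"
      using uU by eventually_elim (auto simp: max.commute)
  qed (auto intro: excess_integrand_measurable[of 1 0, simplified])
  then have I: "(\<integral>y. (max (u y) 0)\<^sup>2 \<partial>lebesgue_on (ball 0 1)) = excess 1 0" by (simp add: excess_def)
  have E0: "excess 1 0 \<ge> 0" by (simp add: excess_def)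
  \<comment> \<open>Zero excess is treated apart because the level chosen below would be 0, while
    the iteration needs \<open>K > 0\<close>.\<close>
  have "AE x in lborel. x \<in> ball 0 (1/2) \<longrightarrow> max (U x) 0 \<le> 1 / sqrt \<theta> * sqrt (excess 1 0)"
  proof (cases "excess 1 0 = 0")
    case True
    then have "AE x in lborel. indicator (ball 0 1) x * (max 0 (U x - 0))\<^sup>2 = 0"
      unfolding excess_def by (subst (asm) integral_nonneg_eq_0_iff_AE) (auto intro: excess_integrable[of 0, simplified])
    then show ?thesis
      by eventually_elim (auto simp: True indicator_def max_def split: if_splits)
  next
    case False
    \<comment> \<open>The smallest level meeting the smallness condition, with equality; it is
      \<theta>^(-1/2) times the norm, whence the constant.\<close>
    define K where "K = sqrt (excess 1 0) / sqrt \<theta>"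
    have K: "K > 0" using False E0 \<theta> by (simp add: K_def)
    have "K\<^sup>2 = excess 1 0 / \<theta>" using E0 \<theta> by (simp add: K_def power_divide)
    then have "excess 1 0 \<le> De_Giorgi_threshold CARD('n) (Lam / lam) * K\<^sup>2" using \<theta> by (simp add: \<theta>_def)
    from De_Giorgi_bound[OF K this] show ?thesis
      by eventually_elim (use K in \<open>auto simp: K_def\<close>)
  qed
  then have "AE x in lborel. x \<in> ball 0 (1/2) \<longrightarrow> max (u x) 0 \<le> 1 / sqrt \<theta> * sqrt (excess 1 0)"
    using uU
  proof eventually_elim
    case (elim x)
    show ?case using elim by (auto simp: dist_norm)
  qed
  then show "AE x in lebesgue_on (ball 0 (1/2)). max (u x) 0
    \<le> 1 / sqrt (De_Giorgi_threshold CARD('n) (Lam / lam)) * sqrt (\<integral>y. (max (u y) 0)\<^sup>2 \<partial>lebesgue_on (ball 0 1))"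
    unfolding I \<theta>_def[symmetric] by (subst AE_lebesgue_on_iff) (simp, assumption)
qed

end
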